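(* Let $\mathcal{F}$ be a stably $2$-Calabi--Yau Frobenius extriangulated category and let $\mathcal{X}\subseteq\mathcal{F}$ be a rigid, functorially finite subcategory. Then there is a triangle equivalence \[\underline{\mathcal{X}^{\perp_1}}\ \simeq\ \mathcal{X}^{\perp_1}_{\underline{\mathcal{F}}}/\mathrm{add}(\mathcal{X})\] between the stable category of the Frobenius extriangulated category $\mathcal{X}^{\perp_1}\subseteq\mathcal{F}$ and the Iyama--Yoshino reduction of the stable category $\underline{\mathcal{F}}$ at $\mathcal{X}$.
   Context: Let $\mathbb{K}$ be a field. An extriangulated category (Nakaoka--Palu) $(\mathcal{C},\mathbb{E}_{\mathcal{C}},\mathfrak{s})$ consists of a $\mathbb{K}$-linear additive category, a $\mathbb{K}$-bilinear bifunctor $\mathbb{E}_{\mathcal{C}}\colon\mathcal{C}^{\mathrm{op}}\times\mathcal{C}\to\{\mathbb{K}\text{-modules}\}$, and an additive realisation $\mathfrak{s}$ sending $\delta\in\mathbb{E}_{\mathcal{C}}(C,A)$ to an equivalence class of sequences $A\to B\to C$ (called conflations; first maps are inflations, second maps deflations), satisfying (ET3), (ET3)$^{\mathrm{op}}$, (ET4), (ET4)$^{\mathrm{op}}$. Extension-closed full subcategories inherit an extriangulated structure. Projective objects are those having the lifting property against deflations, injective objects those having the extension property along inflations; the category is Frobenius if it has enough projectives and injectives and the two classes coincide. The stable category $\underline{\mathcal{C}}$ of a Frobenius extriangulated category is the additive quotient by morphisms factoring through projective-injectives. It is triangulated: fix for each $X$ a conflation $X\to I(X)\to\Sigma X$ with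 $I(X)$ injective; $\Sigma$ induces the suspension, and each conflation $X\to Y\to Z$, together with the map $Z\to\Sigma X$ obtained from a morphism of conflations to $X\to I(X)\to\Sigma X$ that is the identity on $X$, gives a standard triangle; distinguished triangles are those isomorphic to standard ones. Moreover $\mathbb{E}_{\mathcal{C}}(X,Y)=\mathrm{Hom}_{\underline{\mathcal{C}}}(X,\Sigma Y)$. $\mathcal{C}$ is stably $2$-Calabi--Yau if $\underline{\mathcal{C}}$ is Hom-finite and there is a functorial isomorphism $\mathrm{Ext}^1_{\underline{\mathcal{C}}}(X,Y)\cong\mathrm{Hom}_{\mathbb{K}}(\mathrm{Ext}^1_{\underline{\mathcal{C}}}(Y,X),\mathbb{K})$. Subcategories are full. $\mathcal{X}^{\perp_1}=\{M\in\mathcal{F}:\mathbb{E}_{\mathcal{F}}(X,M)=0\ \forall X\in\mathcal{X}\}$; $\mathcal{X}$ is rigid if $\mathcal{X}\subseteq\mathcal{X}^{\perp_1}$, and functorially finite if every object has left and right $\mathcal{X}$-approximations. Under the hypotheses $\mathcal{X}^{\perp_1}$, which is extension-closed in $\mathcal{F}$, is a Frobenius extriangulated category whose projective-injectives are $\mathrm{add}(\mathcal{X},\mathcal{P})$, the closure of $\mathcal{X}\cup\mathcal{P}$ under finite direct sums and direct summands, where $\mathcal{P}$ is the class of projective-injectives of $\mathcal{F}$; so $\underline{\mathcal{X}^{\perp_1}}=\mathcal{X}^{\perp_1}/\mathrm{add}(\mathcal{X},\mathcal{P})$. $\mathcal{X}^{\perp_1}_{\underline{\mathcal{F}}}$ is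 the full subcategory of $\underline{\mathcal{F}}$ of objects $M$ with $\mathrm{Ext}^1_{\underline{\mathcal{F}}}(M,X)=\mathrm{Hom}_{\underline{\mathcal{F}}}(M,\Sigma X)=0$ for all $X\in\mathcal{X}$ (equivalently $\mathrm{Ext}^1_{\underline{\mathcal{F}}}(X,M)=0$ for all $X\in\mathcal{X}$). The Iyama--Yoshino reduction of $\underline{\mathcal{F}}$ at $\mathcal{X}$ is the quotient $\mathcal{X}^{\perp_1}_{\underline{\mathcal{F}}}/\mathrm{add}(\mathcal{X})$ by morphisms factoring through $\mathrm{add}_{\underline{\mathcal F}}(\mathcal{X})$, triangulated as follows: the suspension $Y\langle1\rangle$ is given by a triangle $Y\to X_Y\to Y\langle1\rangle\to\Sigma Y$ in $\underline{\mathcal{F}}$ with $Y\to X_Y$ a left $\mathrm{add}(\mathcal{X})$-approximation, and triangles come from triangles $A\to B\to C\to\Sigma A$ of $\underline{\mathcal{F}}$ with $A,B,C\in\mathcal{X}^{\perp_1}_{\underline{\mathcal{F}}}$, with third map $C\to A\langle1\rangle$ induced by a morphism of triangles to $A\to X_A\to A\langle1\rangle\to\Sigma A$ that is the identity on $A$. *)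

theory Defs
  imports "HOL-Algebra.AbelCoset" "HOL-Algebra.Module"
begin

section \<open>Linear and additive categories\<close>

text \<open>
  Composition is indexed by objects, so hom-spaces of different pairs of objects need not be
  disjoint: \<open>cmp C X Y Z g f\<close> is the composite of \<open>f : X \<rightarrow> Y\<close> followed by \<open>g : Y \<rightarrow> Z\<close>.
  The ring multiplication and the ring unit of the record type
  \<^typ>\<open>('k,'m) module\<close> are irrelevant throughout.
\<close>

record ('k,'o,'m) lincat =
  Ob  :: "'o set"
  Hom :: "'o \<Rightarrow> 'o \<Rightarrow> ('k,'m) module"
  cmp :: "'o \<Rightarrow> 'o \<Rightarrow> 'o \<Rightarrow> 'm \<Rightarrow> 'm \<Rightarrow> 'm"
  ide :: "'o \<Rightarrow> 'm"

abbreviation arr :: "('k,'o,'m,'z) lincat_scheme \<Rightarrow> 'o \<Rightarrow> 'o \<Rightarrow> 'm set" where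
  "arr C X Y \<equiv> carrier (Hom C X Y)"

definition linear_map ::
  "('k,'r) ring_scheme \<Rightarrow> ('k,'m,'a) module_scheme \<Rightarrow> ('k,'n,'b) module_scheme \<Rightarrow> ('m \<Rightarrow> 'n) \<Rightarrow> bool"
where
  "linear_map K M N \<phi> \<longleftrightarrow>
     \<phi> \<in> carrier M \<rightarrow> carrier N \<and>
     (\<forall>x\<in>carrier M. \<forall>y\<in>carrier M. \<phi> (x \<oplus>\<^bsub>M\<^esub> y) = \<phi> x \<oplus>\<^bsub>N\<^esub> \<phi> y) \<and>
     (\<forall>k\<in>carrier K. \<forall>x\<in>carrier M. \<phi> (k \<odot>\<^bsub>M\<^esub> x) = k \<odot>\<^bsub>N\<^esub> \<phi> x)"

locale linear_category =
  fixes K :: "('k,'r) ring_scheme" and C :: "('k,'o,'m,'z) lincat_scheme"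
  assumes field_K: "field K"
    and hom_module: "\<lbrakk>X \<in> Ob C; Y \<in> Ob C\<rbrakk> \<Longrightarrow> module K (Hom C X Y)"
    and ide_arr: "X \<in> Ob C \<Longrightarrow> ide C X \<in> arr C X X"
    and cmp_linear_left: "\<lbrakk>X \<in> Ob C; Y \<in> Ob C; Z \<in> Ob C; f \<in> arr C X Y\<rbrakk>
          \<Longrightarrow> linear_map K (Hom C Y Z) (Hom C X Z) (\<lambda>g. cmp C X Y Z g f)"
    and cmp_linear_right: "\<lbrakk>X \<in> Ob C; Y \<in> Ob C; Z \<in> Ob C; g \<in> arr C Y Z\<rbrakk>
          \<Longrightarrow> linear_map K (Hom C X Y) (Hom C X Z) (\<lambda>f. cmp C X Y Z g f)"
    and ide_left: "\<lbrakk>X \<in> Ob C; Y \<in> Ob C; f \<in> arr C X Y\<rbrakk> \<Longrightarrow> cmp C X Y Y (ide C Y) f = f"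
    and ide_right: "\<lbrakk>X \<in> Ob C; Y \<in> Ob C; f \<in> arr C X Y\<rbrakk> \<Longrightarrow> cmp C X X Y f (ide C X) = f"
    and cmp_assoc: "\<lbrakk>W \<in> Ob C; X \<in> Ob C; Y \<in> Ob C; Z \<in> Ob C;
            f \<in> arr C W X; g \<in> arr C X Y; h \<in> arr C Y Z\<rbrakk>
          \<Longrightarrow> cmp C W X Z (cmp C X Y Z h g) f = cmp C W Y Z h (cmp C W X Y g f)"

definition zero_object :: "('k,'o,'m,'z) lincat_scheme \<Rightarrow> 'o \<Rightarrow> bool" where
  "zero_object C Z \<longleftrightarrow> Z \<in> Ob C \<and>
     (\<forall>X\<in>Ob C. arr C X Z = {\<zero>\<^bsub>Hom C X Z\<^esub>} \<and> arr C Z X = {\<zero>\<^bsub>Hom C Z X\<^esub>})"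

definition biproduct ::
  "('k,'o,'m,'z) lincat_scheme \<Rightarrow> 'o \<Rightarrow> 'o \<Rightarrow> 'o \<Rightarrow> 'm \<Rightarrow> 'm \<Rightarrow> 'm \<Rightarrow> 'm \<Rightarrow> bool"
where
  "biproduct C X Y S i j p q \<longleftrightarrow>
     X \<in> Ob C \<and> Y \<in> Ob C \<and> S \<in> Ob C \<and>
     i \<in> arr C X S \<and> j \<in> arr C Y S \<and> p \<in> arr C S X \<and> q \<in> arr C S Y \<and>
     cmp C X S X p i = ide C X \<and> cmp C Y S Y q j = ide C Y \<and>
     cmp C Y S X p j = \<zero>\<^bsub>Hom C Y X\<^esub> \<and> cmp C X S Y q i = \<zero>\<^bsub>Hom C X Y\<^esub> \<and>
     cmp C S X S i p \<oplus>\<^bsub>Hom C S S\<^esub> cmp C S Y S j q = ide C S"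

locale additive_category = linear_category K C
  for K :: "('k,'r) ring_scheme" and C :: "('k,'o,'m,'z) lincat_scheme" +
  assumes ex_zero_object: "\<exists>Z. zero_object C Z"
    and ex_biproduct: "\<lbrakk>X \<in> Ob C; Y \<in> Ob C\<rbrakk> \<Longrightarrow> \<exists>S i j p q. biproduct C X Y S i j p q"

definition iso_arr :: "('k,'o,'m,'z) lincat_scheme \<Rightarrow> 'o \<Rightarrow> 'o \<Rightarrow> 'm \<Rightarrow> bool" where
  "iso_arr C X Y f \<longleftrightarrow> X \<in> Ob C \<and> Y \<in> Ob C \<and> f \<in> arr C X Y \<and>
     (\<exists>g\<in>arr C Y X. cmp C X Y X g f = ide C X \<and> cmp C Y X Y f g = ide C Y)"

inductive_set add_closure :: "('k,'o,'m,'z) lincat_scheme \<Rightarrow> 'o set \<Rightarrow> 'o set"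
  for C :: "('k,'o,'m,'z) lincat_scheme" and \<X> :: "'o set"
where
  base: "\<lbrakk>X \<in> \<X>; X \<in> Ob C\<rbrakk> \<Longrightarrow> X \<in> add_closure C \<X>"
| zero: "zero_object C Z \<Longrightarrow> Z \<in> add_closure C \<X>"
| sum: "\<lbrakk>X \<in> add_closure C \<X>; Y \<in> add_closure C \<X>; biproduct C X Y S i j p q\<rbrakk>
    \<Longrightarrow> S \<in> add_closure C \<X>"
| summand: "\<lbrakk>S \<in> add_closure C \<X>; biproduct C X Y S i j p q\<rbrakk> \<Longrightarrow> X \<in> add_closure C \<X>"

definition left_approximation ::
  "('k,'o,'m,'z) lincat_scheme \<Rightarrow> 'o set \<Rightarrow> 'o \<Rightarrow> 'o \<Rightarrow> 'm \<Rightarrow> bool"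
where
  "left_approximation C \<X> M X f \<longleftrightarrow> X \<in> \<X> \<and> f \<in> arr C M X \<and>
     (\<forall>X'\<in>\<X>. \<forall>g\<in>arr C M X'. \<exists>h\<in>arr C X X'. cmp C M X X' h f = g)"

definition right_approximation ::
  "('k,'o,'m,'z) lincat_scheme \<Rightarrow> 'o set \<Rightarrow> 'o \<Rightarrow> 'o \<Rightarrow> 'm \<Rightarrow> bool"
where
  "right_approximation C \<X> M X f \<longleftrightarrow> X \<in> \<X> \<and> f \<in> arr C X M \<and>
     (\<forall>X'\<in>\<X>. \<forall>g\<in>arr C X' M. \<exists>h\<in>arr C X' X. cmp C X' X M f h = g)"

definition functorially_finite :: "('k,'o,'m,'z) lincat_scheme \<Rightarrow> 'o set \<Rightarrow> bool" where
  "functorially_finite C \<X> \<longleftrightarrow>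
     (\<forall>M\<in>Ob C. (\<exists>X f. left_approximation C \<X> M X f) \<and> (\<exists>X f. right_approximation C \<X> M X f))"

subsection \<open>Additive quotients\<close>

text \<open>The morphisms \<open>X \<rightarrow> Y\<close> factoring through an object of \<open>\<P>\<close>. They form an ideal when
  \<open>\<P>\<close> is closed under finite direct sums, which holds wherever this is used.\<close>

definition factoring :: "('k,'o,'m,'z) lincat_scheme \<Rightarrow> 'o set \<Rightarrow> 'o \<Rightarrow> 'o \<Rightarrow> 'm set" where
  "factoring C \<P> X Y = {cmp C X P Y b a | P a b. P \<in> \<P> \<and> a \<in> arr C X P \<and> b \<in> arr C P Y}"

definition quot_arr :: "('k,'o,'m,'z) lincat_scheme \<Rightarrow> 'o set \<Rightarrow> 'o \<Rightarrow> 'o \<Rightarrow> 'm \<Rightarrow> 'm set" where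
  "quot_arr C \<P> X Y f = factoring C \<P> X Y +>\<^bsub>Hom C X Y\<^esub> f"

definition quot_module :: "('k,'m,'z) module_scheme \<Rightarrow> 'm set \<Rightarrow> ('k,'m set) module" where
  "quot_module M J = \<lparr>carrier = a_rcosets\<^bsub>M\<^esub> J, mult = undefined, one = undefined,
     zero = J, add = set_add M, smult = (\<lambda>k F. \<Union>f\<in>F. J +>\<^bsub>M\<^esub> (k \<odot>\<^bsub>M\<^esub> f))\<rparr>"

definition quot_cat :: "('k,'o,'m,'z) lincat_scheme \<Rightarrow> 'o set \<Rightarrow> ('k,'o,'m set) lincat" where
  "quot_cat C \<P> =
     \<lparr>Ob = Ob C,
      Hom = (\<lambda>X Y. quot_module (Hom C X Y) (factoring C \<P> X Y)),
      cmp = (\<lambda>X Y Z G F. \<Union>g\<in>G. \<Union>f\<in>F. quot_arr C \<P> X Z (cmp C X Y Z g f)),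
      ide = (\<lambda>X. quot_arr C \<P> X X (ide C X))\<rparr>"

subsection \<open>Functors and equivalences\<close>

definition linear_functor ::
  "('k,'r) ring_scheme \<Rightarrow> ('k,'o,'m,'y) lincat_scheme \<Rightarrow> ('k,'p,'n,'z) lincat_scheme
    \<Rightarrow> ('o \<Rightarrow> 'p) \<Rightarrow> ('o \<Rightarrow> 'o \<Rightarrow> 'm \<Rightarrow> 'n) \<Rightarrow> bool"
where
  "linear_functor K C D F Fa \<longleftrightarrow>
     F \<in> Ob C \<rightarrow> Ob D \<and>
     (\<forall>X\<in>Ob C. \<forall>Y\<in>Ob C. linear_map K (Hom C X Y) (Hom D (F X) (F Y)) (Fa X Y)) \<and>
     (\<forall>X\<in>Ob C. Fa X X (ide C X) = ide D (F X)) \<and>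
     (\<forall>X\<in>Ob C. \<forall>Y\<in>Ob C. \<forall>Z\<in>Ob C. \<forall>f\<in>arr C X Y. \<forall>g\<in>arr C Y Z.
        Fa X Z (cmp C X Y Z g f) = cmp D (F X) (F Y) (F Z) (Fa Y Z g) (Fa X Y f))"

definition natural_iso ::
  "('k,'o,'m,'y) lincat_scheme \<Rightarrow> ('k,'p,'n,'z) lincat_scheme
    \<Rightarrow> ('o \<Rightarrow> 'p) \<Rightarrow> ('o \<Rightarrow> 'o \<Rightarrow> 'm \<Rightarrow> 'n)
    \<Rightarrow> ('o \<Rightarrow> 'p) \<Rightarrow> ('o \<Rightarrow> 'o \<Rightarrow> 'm \<Rightarrow> 'n) \<Rightarrow> ('o \<Rightarrow> 'n) \<Rightarrow> bool"
where
  "natural_iso C D F Fa G Ga \<eta> \<longleftrightarrow>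
     (\<forall>X\<in>Ob C. iso_arr D (F X) (G X) (\<eta> X)) \<and>
     (\<forall>X\<in>Ob C. \<forall>Y\<in>Ob C. \<forall>f\<in>arr C X Y.
        cmp D (F X) (F Y) (G Y) (\<eta> Y) (Fa X Y f) = cmp D (F X) (G X) (G Y) (Ga X Y f) (\<eta> X))"

definition equivalence_functor ::
  "('k,'r) ring_scheme \<Rightarrow> ('k,'o,'m,'y) lincat_scheme \<Rightarrow> ('k,'p,'n,'z) lincat_scheme
    \<Rightarrow> ('o \<Rightarrow> 'p) \<Rightarrow> ('o \<Rightarrow> 'o \<Rightarrow> 'm \<Rightarrow> 'n) \<Rightarrow> bool"
where
  "equivalence_functor K C D F Fa \<longleftrightarrow> linear_functor K C D F Fa \<and>
     (\<exists>G Ga \<epsilon> \<theta>. linear_functor K D C G Ga \<and>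
        natural_iso C C (\<lambda>X. X) (\<lambda>X Y f. f) (\<lambda>X. G (F X)) (\<lambda>X Y f. Ga (F X) (F Y) (Fa X Y f)) \<epsilon> \<and>
        natural_iso D D (\<lambda>X. F (G X)) (\<lambda>X Y f. Fa (G X) (G Y) (Ga X Y f)) (\<lambda>X. X) (\<lambda>X Y f. f) \<theta>)"


section \<open>Suspensions and triangles\<close>

text \<open>
  A linear category with a suspension (on objects and on morphisms) and a class of
  distinguished triangles \<open>X \<rightarrow> Y \<rightarrow> Z \<rightarrow> susp X\<close>, given as tuples \<open>(X, Y, Z, u, v, w)\<close>.
  The record only carries the data of a triangulated category, not its axioms.
\<close>

type_synonym ('o,'m) triangle = "'o \<times> 'o \<times> 'o \<times> 'm \<times> 'm \<times> 'm"

record ('k,'o,'m) tricat = "('k,'o,'m) lincat" +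
  susp     :: "'o \<Rightarrow> 'o"
  susp_arr :: "'o \<Rightarrow> 'o \<Rightarrow> 'm \<Rightarrow> 'm"
  dist     :: "('o,'m) triangle set"

text \<open>The suspension is a separate argument here, since these notions are used to define
  the field \<^const>\<open>dist\<close>.\<close>

fun is_triangle :: "('k,'o,'m,'z) lincat_scheme \<Rightarrow> ('o \<Rightarrow> 'o) \<Rightarrow> ('o,'m) triangle \<Rightarrow> bool" where
  "is_triangle C S (X,Y,Z,u,v,w) \<longleftrightarrow>
     X \<in> Ob C \<and> Y \<in> Ob C \<and> Z \<in> Ob C \<and> u \<in> arr C X Y \<and> v \<in> arr C Y Z \<and> w \<in> arr C Z (S X)"

fun triangle_morphism ::
  "('k,'o,'m,'z) lincat_scheme \<Rightarrow> ('o \<Rightarrow> 'o) \<Rightarrow> ('o \<Rightarrow> 'o \<Rightarrow> 'm \<Rightarrow> 'm)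
    \<Rightarrow> ('o,'m) triangle \<Rightarrow> ('o,'m) triangle \<Rightarrow> 'm \<Rightarrow> 'm \<Rightarrow> 'm \<Rightarrow> bool"
where
  "triangle_morphism C S Sa (X,Y,Z,u,v,w) (X',Y',Z',u',v',w') a b c \<longleftrightarrow>
     a \<in> arr C X X' \<and> b \<in> arr C Y Y' \<and> c \<in> arr C Z Z' \<and>
     cmp C X Y Y' b u = cmp C X X' Y' u' a \<and>
     cmp C Y Z Z' c v = cmp C Y Y' Z' v' b \<and>
     cmp C Z (S X) (S X') (Sa X X' a) w = cmp C Z Z' (S X') w' c"

fun triangle_iso ::
  "('k,'o,'m,'z) lincat_scheme \<Rightarrow> ('o \<Rightarrow> 'o) \<Rightarrow> ('o \<Rightarrow> 'o \<Rightarrow> 'm \<Rightarrow> 'm)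
    \<Rightarrow> ('o,'m) triangle \<Rightarrow> ('o,'m) triangle \<Rightarrow> bool"
where
  "triangle_iso C S Sa (X,Y,Z,u,v,w) (X',Y',Z',u',v',w') \<longleftrightarrow>
     (\<exists>a b c. triangle_morphism C S Sa (X,Y,Z,u,v,w) (X',Y',Z',u',v',w') a b c \<and>
        iso_arr C X X' a \<and> iso_arr C Y Y' b \<and> iso_arr C Z Z' c)"

definition triangle_iso_closure ::
  "('k,'o,'m,'z) lincat_scheme \<Rightarrow> ('o \<Rightarrow> 'o) \<Rightarrow> ('o \<Rightarrow> 'o \<Rightarrow> 'm \<Rightarrow> 'm)
    \<Rightarrow> ('o,'m) triangle set \<Rightarrow> ('o,'m) triangle set"
where
  "triangle_iso_closure C S Sa \<T> =
     {t. is_triangle C S t \<and> (\<exists>t'\<in>\<T>. is_triangle C S t' \<and> triangle_iso C S Sa t t')}"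

definition triangle_functor ::
  "('k,'r) ring_scheme \<Rightarrow> ('k,'o,'m) tricat \<Rightarrow> ('k,'p,'n) tricat
    \<Rightarrow> ('o \<Rightarrow> 'p) \<Rightarrow> ('o \<Rightarrow> 'o \<Rightarrow> 'm \<Rightarrow> 'n) \<Rightarrow> ('o \<Rightarrow> 'n) \<Rightarrow> bool"
where
  "triangle_functor K C D F Fa \<eta> \<longleftrightarrow>
     linear_functor K C D F Fa \<and>
     natural_iso C D (\<lambda>X. F (susp C X)) (\<lambda>X Y f. Fa (susp C X) (susp C Y) (susp_arr C X Y f))
       (\<lambda>X. susp D (F X)) (\<lambda>X Y f. susp_arr D (F X) (F Y) (Fa X Y f)) \<eta> \<and>
     (\<forall>(X,Y,Z,u,v,w)\<in>dist C.
        (F X, F Y, F Z, Fa X Y u, Fa Y Z v,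
         cmp D (F Z) (F (susp C X)) (susp D (F X)) (\<eta> X) (Fa Z (susp C X) w)) \<in> dist D)"

definition triangle_equivalent ::
  "('k,'r) ring_scheme \<Rightarrow> ('k,'o,'m) tricat \<Rightarrow> ('k,'p,'n) tricat \<Rightarrow> bool"
where
  "triangle_equivalent K C D \<longleftrightarrow>
     (\<exists>F Fa \<eta>. triangle_functor K C D F Fa \<eta> \<and> equivalence_functor K C D F Fa)"

subsection \<open>The 2-Calabi--Yau property\<close>

definition ext1 :: "('k,'o,'m) tricat \<Rightarrow> 'o \<Rightarrow> 'o \<Rightarrow> ('k,'m) module" where
  "ext1 T X Y = Hom T X (susp T Y)"

text \<open>The action of \<open>f : X' \<rightarrow> X\<close> and \<open>g : Y \<rightarrow> Y'\<close> as a map from \<open>ext1 T X Y\<close> to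
  \<open>ext1 T X' Y'\<close>.\<close>

definition ext1_map ::
  "('k,'o,'m) tricat \<Rightarrow> 'o \<Rightarrow> 'o \<Rightarrow> 'o \<Rightarrow> 'o \<Rightarrow> 'm \<Rightarrow> 'm \<Rightarrow> 'm \<Rightarrow> 'm"
where
  "ext1_map T X Y X' Y' f g e =
     cmp T X' (susp T Y) (susp T Y') (susp_arr T Y Y' g) (cmp T X' X (susp T Y) e f)"

definition finite_dimensional :: "('k,'r) ring_scheme \<Rightarrow> ('k,'m,'z) module_scheme \<Rightarrow> bool" where
  "finite_dimensional K M \<longleftrightarrow>
     (\<exists>B. finite B \<and> B \<subseteq> carrier M \<and>
        (\<forall>x\<in>carrier M. \<exists>c\<in>B \<rightarrow> carrier K. x = (\<Oplus>\<^bsub>M\<^esub>b\<in>B. c b \<odot>\<^bsub>M\<^esub> b)))"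

definition hom_finite :: "('k,'r) ring_scheme \<Rightarrow> ('k,'o,'m,'z) lincat_scheme \<Rightarrow> bool" where
  "hom_finite K C \<longleftrightarrow> (\<forall>X\<in>Ob C. \<forall>Y\<in>Ob C. finite_dimensional K (Hom C X Y))"

text \<open>The module \<open>K\<close> itself has \<open>smult\<close> equal to the multiplication of \<open>K\<close>; functionals are
  extensional, so that equal functionals are equal as functions.\<close>

definition self_module :: "('k,'r) ring_scheme \<Rightarrow> ('k,'k) module" where
  "self_module K = \<lparr>carrier = carrier K, mult = mult K, one = one K, zero = zero K,
     add = add K, smult = mult K\<rparr>"

definition dual_module :: "('k,'r) ring_scheme \<Rightarrow> ('k,'m,'z) module_scheme \<Rightarrow> ('k,'m \<Rightarrow> 'k) module" where
  "dual_module K M =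
     \<lparr>carrier = {\<phi> \<in> extensional (carrier M). linear_map K M (self_module K) \<phi>},
      mult = undefined, one = undefined,
      zero = (\<lambda>x\<in>carrier M. \<zero>\<^bsub>K\<^esub>),
      add = (\<lambda>\<phi> \<psi>. \<lambda>x\<in>carrier M. \<phi> x \<oplus>\<^bsub>K\<^esub> \<psi> x),
      smult = (\<lambda>k \<phi>. \<lambda>x\<in>carrier M. k \<otimes>\<^bsub>K\<^esub> \<phi> x)\<rparr>"

definition two_calabi_yau :: "('k,'r) ring_scheme \<Rightarrow> ('k,'o,'m) tricat \<Rightarrow> bool" where
  "two_calabi_yau K T \<longleftrightarrow> hom_finite K T \<and>
     (\<exists>\<phi>. (\<forall>X\<in>Ob T. \<forall>Y\<in>Ob T.
             linear_map K (ext1 T X Y) (dual_module K (ext1 T Y X)) (\<phi> X Y) \<and>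
             bij_betw (\<phi> X Y) (carrier (ext1 T X Y)) (carrier (dual_module K (ext1 T Y X)))) \<and>
          (\<forall>X\<in>Ob T. \<forall>Y\<in>Ob T. \<forall>X'\<in>Ob T. \<forall>Y'\<in>Ob T. \<forall>f\<in>arr T X' X. \<forall>g\<in>arr T Y Y'.
             \<forall>e\<in>carrier (ext1 T X Y). \<forall>d\<in>carrier (ext1 T Y' X').
               \<phi> X' Y' (ext1_map T X Y X' Y' f g e) d = \<phi> X Y e (ext1_map T Y' X' Y X g f d)))"


section \<open>Extriangulated categories\<close>

text \<open>
  \<open>Ext E Z A\<close> is the module of extensions of \<open>Z\<close> by \<open>A\<close> (contravariant in \<open>Z\<close>, covariant in \<open>A\<close>);
  for \<open>c : Z' \<rightarrow> Z\<close> and \<open>a : A \<rightarrow> A'\<close>, \<open>ext_map E Z A Z' A' c a\<close> maps \<open>Ext E Z A\<close> to \<open>Ext E Z' A'\<close>.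
  \<open>rlz E Z A \<delta>\<close> is the realisation of \<open>\<delta>\<close>, the class of all \<open>(B, x, y)\<close> for which the sequence
  \<open>x : A \<rightarrow> B\<close>, \<open>y : B \<rightarrow> Z\<close> belongs to it.
\<close>

record ('k,'o,'m,'e) excat = "('k,'o,'m) lincat" +
  Ext     :: "'o \<Rightarrow> 'o \<Rightarrow> ('k,'e) module"
  ext_map :: "'o \<Rightarrow> 'o \<Rightarrow> 'o \<Rightarrow> 'o \<Rightarrow> 'm \<Rightarrow> 'm \<Rightarrow> 'e \<Rightarrow> 'e"
  rlz     :: "'o \<Rightarrow> 'o \<Rightarrow> 'e \<Rightarrow> ('o \<times> 'm \<times> 'm) set"

abbreviation push :: "('k,'o,'m,'e) excat \<Rightarrow> 'o \<Rightarrow> 'o \<Rightarrow> 'o \<Rightarrow> 'm \<Rightarrow> 'e \<Rightarrow> 'e" where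
  "push E Z A A' a \<equiv> ext_map E Z A Z A' (ide E Z) a"

abbreviation pull :: "('k,'o,'m,'e) excat \<Rightarrow> 'o \<Rightarrow> 'o \<Rightarrow> 'o \<Rightarrow> 'm \<Rightarrow> 'e \<Rightarrow> 'e" where
  "pull E Z Z' A c \<equiv> ext_map E Z A Z' A c (ide E A)"

text \<open>A conflation is recorded together with the extension \<open>\<delta>\<close> that it realises, which in general
  is not determined by the sequence: \<open>(A, B, Z, x, y, \<delta>)\<close> stands for \<open>A \<rightarrow> B \<rightarrow> Z\<close>.
  A morphism of conflations has to be compatible with these extensions.\<close>

type_synonym ('o,'m,'e) confl = "'o \<times> 'o \<times> 'o \<times> 'm \<times> 'm \<times> 'e"

definition conflations :: "('k,'o,'m,'e) excat \<Rightarrow> ('o,'m,'e) confl set" where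
  "conflations E = {(A,B,Z,x,y,\<delta>). A \<in> Ob E \<and> Z \<in> Ob E \<and>
     \<delta> \<in> carrier (Ext E Z A) \<and> (B,x,y) \<in> rlz E Z A \<delta>}"

fun confl_morphism ::
  "('k,'o,'m,'e) excat \<Rightarrow> ('o,'m,'e) confl \<Rightarrow> ('o,'m,'e) confl \<Rightarrow> 'm \<Rightarrow> 'm \<Rightarrow> 'm \<Rightarrow> bool"
where
  "confl_morphism E (A,B,Z,x,y,\<delta>) (A',B',Z',x',y',\<delta>') a b c \<longleftrightarrow>
     a \<in> arr E A A' \<and> b \<in> arr E B B' \<and> c \<in> arr E Z Z' \<and>
     cmp E A B B' b x = cmp E A A' B' x' a \<and>
     cmp E B Z Z' c y = cmp E B B' Z' y' b \<and>
     push E Z A A' a \<delta> = pull E Z' Z A' c \<delta>'"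

definition equiv_seq ::
  "('k,'o,'m,'z) lincat_scheme \<Rightarrow> 'o \<Rightarrow> 'o \<Rightarrow> 'o \<times> 'm \<times> 'm \<Rightarrow> 'o \<times> 'm \<times> 'm \<Rightarrow> bool"
where
  "equiv_seq C A Z s s' \<longleftrightarrow> (case (s, s') of ((B,x,y), (B',x',y')) \<Rightarrow>
     x \<in> arr C A B \<and> y \<in> arr C B Z \<and> x' \<in> arr C A B' \<and> y' \<in> arr C B' Z \<and>
     (\<exists>b. iso_arr C B B' b \<and> cmp C A B B' b x = x' \<and> cmp C B B' Z y' b = y))"

definition sum_arr ::
  "('k,'o,'m,'z) lincat_scheme \<Rightarrow> 'o \<Rightarrow> 'o \<Rightarrow> 'o \<Rightarrow> 'o \<Rightarrow> 'o \<Rightarrow> 'o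
    \<Rightarrow> 'm \<Rightarrow> 'm \<Rightarrow> 'm \<Rightarrow> 'm \<Rightarrow> 'm \<Rightarrow> 'm \<Rightarrow> 'm"
where
  "sum_arr C A A' S B B' T p p' i i' f f' =
     cmp C S B T i (cmp C S A B f p) \<oplus>\<^bsub>Hom C S T\<^esub> cmp C S B' T i' (cmp C S A' B' f' p')"

locale extriangulated = additive_category K E
  for K :: "('k,'r) ring_scheme" and E :: "('k,'o,'m,'e) excat" +
  assumes ext_module: "\<lbrakk>Z \<in> Ob E; A \<in> Ob E\<rbrakk> \<Longrightarrow> module K (Ext E Z A)"
    and ext_map_linear:
      "\<lbrakk>Z \<in> Ob E; A \<in> Ob E; Z' \<in> Ob E; A' \<in> Ob E; c \<in> arr E Z' Z; a \<in> arr E A A'\<rbrakk>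
        \<Longrightarrow> linear_map K (Ext E Z A) (Ext E Z' A') (ext_map E Z A Z' A' c a)"
    and ext_map_linear_contra:
      "\<lbrakk>Z \<in> Ob E; A \<in> Ob E; Z' \<in> Ob E; A' \<in> Ob E; a \<in> arr E A A'; \<delta> \<in> carrier (Ext E Z A)\<rbrakk>
        \<Longrightarrow> linear_map K (Hom E Z' Z) (Ext E Z' A') (\<lambda>c. ext_map E Z A Z' A' c a \<delta>)"
    and ext_map_linear_co:
      "\<lbrakk>Z \<in> Ob E; A \<in> Ob E; Z' \<in> Ob E; A' \<in> Ob E; c \<in> arr E Z' Z; \<delta> \<in> carrier (Ext E Z A)\<rbrakk>
        \<Longrightarrow> linear_map K (Hom E A A') (Ext E Z' A') (\<lambda>a. ext_map E Z A Z' A' c a \<delta>)"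
    and ext_map_ide:
      "\<lbrakk>Z \<in> Ob E; A \<in> Ob E; \<delta> \<in> carrier (Ext E Z A)\<rbrakk>
        \<Longrightarrow> ext_map E Z A Z A (ide E Z) (ide E A) \<delta> = \<delta>"
    and ext_map_cmp:
      "\<lbrakk>Z \<in> Ob E; A \<in> Ob E; Z' \<in> Ob E; A' \<in> Ob E; Z'' \<in> Ob E; A'' \<in> Ob E;
        c \<in> arr E Z' Z; a \<in> arr E A A'; c' \<in> arr E Z'' Z'; a' \<in> arr E A' A''; \<delta> \<in> carrier (Ext E Z A)\<rbrakk>
        \<Longrightarrow> ext_map E Z A Z'' A'' (cmp E Z'' Z' Z c c') (cmp E A A' A'' a' a) \<delta> =
            ext_map E Z' A' Z'' A'' c' a' (ext_map E Z A Z' A' c a \<delta>)"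
    and rlz_class:
      "\<lbrakk>Z \<in> Ob E; A \<in> Ob E; \<delta> \<in> carrier (Ext E Z A)\<rbrakk>
        \<Longrightarrow> \<exists>B x y. B \<in> Ob E \<and> x \<in> arr E A B \<and> y \<in> arr E B Z \<and>
              rlz E Z A \<delta> = {s. equiv_seq E A Z (B,x,y) s}"
    and rlz_morphism:
      "\<lbrakk>(A,B,Z,x,y,\<delta>) \<in> conflations E; (A',B',Z',x',y',\<delta>') \<in> conflations E;
        a \<in> arr E A A'; c \<in> arr E Z Z'; push E Z A A' a \<delta> = pull E Z' Z A' c \<delta>'\<rbrakk>
        \<Longrightarrow> \<exists>b. confl_morphism E (A,B,Z,x,y,\<delta>) (A',B',Z',x',y',\<delta>') a b c"
    and rlz_zero:
      "biproduct E A Z B i j p q \<Longrightarrow> (A,B,Z,i,q,\<zero>\<^bsub>Ext E Z A\<^esub>) \<in> conflations E"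
    and rlz_sum:
      "\<lbrakk>(A,B,Z,x,y,\<delta>) \<in> conflations E; (A',B',Z',x',y',\<delta>') \<in> conflations E;
        biproduct E A A' SA iA jA pA qA; biproduct E B B' SB iB jB pB qB;
        biproduct E Z Z' SZ iZ jZ pZ qZ\<rbrakk>
        \<Longrightarrow> (SA, SB, SZ,
              sum_arr E A A' SA B B' SB pA qA iB jB x x',
              sum_arr E B B' SB Z Z' SZ pB qB iZ jZ y y',
              ext_map E Z A SZ SA pZ iA \<delta> \<oplus>\<^bsub>Ext E SZ SA\<^esub> ext_map E Z' A' SZ SA qZ jA \<delta>')
             \<in> conflations E"
    and ET3:
      "\<lbrakk>(A,B,Z,x,y,\<delta>) \<in> conflations E; (A',B',Z',x',y',\<delta>') \<in> conflations E;
        a \<in> arr E A A'; b \<in> arr E B B'; cmp E A B B' b x = cmp E A A' B' x' a\<rbrakk>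
        \<Longrightarrow> \<exists>c. confl_morphism E (A,B,Z,x,y,\<delta>) (A',B',Z',x',y',\<delta>') a b c"
    and ET3_op:
      "\<lbrakk>(A,B,Z,x,y,\<delta>) \<in> conflations E; (A',B',Z',x',y',\<delta>') \<in> conflations E;
        b \<in> arr E B B'; c \<in> arr E Z Z'; cmp E B Z Z' c y = cmp E B B' Z' y' b\<rbrakk>
        \<Longrightarrow> \<exists>a. confl_morphism E (A,B,Z,x,y,\<delta>) (A',B',Z',x',y',\<delta>') a b c"
    and ET4:
      "\<lbrakk>(A,B,D,f,f',\<delta>) \<in> conflations E; (B,Z,F,g,g',\<delta>') \<in> conflations E\<rbrakk>
        \<Longrightarrow> \<exists>G h h' d e \<delta>''.
              (A,Z,G,h,h',\<delta>'') \<in> conflations E \<and>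
              (D,G,F,d,e, push E F B D f' \<delta>') \<in> conflations E \<and>
              h = cmp E A B Z g f \<and>
              cmp E B Z G h' g = cmp E B D G d f' \<and>
              cmp E Z G F e h' = g' \<and>
              pull E G D A d \<delta>'' = \<delta> \<and>
              push E G A B f \<delta>'' = pull E F G B e \<delta>'"
    and ET4_op:
      "\<lbrakk>(D,A,B,f',f,\<delta>) \<in> conflations E; (F,B,Z,g',g,\<delta>') \<in> conflations E\<rbrakk>
        \<Longrightarrow> \<exists>G h h' d e \<delta>''.
              (G,A,Z,h',h,\<delta>'') \<in> conflations E \<and>
              (D,G,F,d,e, pull E B F D g' \<delta>) \<in> conflations E \<and>
              h = cmp E A B Z g f \<and>
              cmp E D G A h' d = f' \<and>
              cmp E G A B f h' = cmp E G F B g' e \<and>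
              push E Z G F e \<delta>'' = \<delta>' \<and>
              push E B D G d \<delta> = pull E Z B G g \<delta>''"

definition projective :: "('k,'o,'m,'e) excat \<Rightarrow> 'o \<Rightarrow> bool" where
  "projective E P \<longleftrightarrow> P \<in> Ob E \<and>
     (\<forall>(A,B,Z,x,y,\<delta>)\<in>conflations E. \<forall>c\<in>arr E P Z. \<exists>b\<in>arr E P B. cmp E P B Z y b = c)"

definition injective :: "('k,'o,'m,'e) excat \<Rightarrow> 'o \<Rightarrow> bool" where
  "injective E I \<longleftrightarrow> I \<in> Ob E \<and>
     (\<forall>(A,B,Z,x,y,\<delta>)\<in>conflations E. \<forall>a\<in>arr E A I. \<exists>b\<in>arr E B I. cmp E A B I b x = a)"

definition proj_inj :: "('k,'o,'m,'e) excat \<Rightarrow> 'o set" where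
  "proj_inj E = {P. projective E P \<and> injective E P}"

locale frobenius_extriangulated = extriangulated K E
  for K :: "('k,'r) ring_scheme" and E :: "('k,'o,'m,'e) excat" +
  assumes enough_projectives:
      "Z \<in> Ob E \<Longrightarrow> \<exists>A P x y \<delta>. (A,P,Z,x,y,\<delta>) \<in> conflations E \<and> projective E P"
    and enough_injectives:
      "A \<in> Ob E \<Longrightarrow> \<exists>I Z x y \<delta>. (A,I,Z,x,y,\<delta>) \<in> conflations E \<and> injective E I"
    and projective_iff_injective: "projective E P \<longleftrightarrow> injective E P"

text \<open>The structure that a full subcategory on an extension-closed class \<open>\<U>\<close> inherits.\<close>

definition ext_subcat :: "('k,'o,'m,'e) excat \<Rightarrow> 'o set \<Rightarrow> ('k,'o,'m,'e) excat" where
  "ext_subcat E \<U> =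
     E\<lparr>Ob := \<U>, rlz := (\<lambda>Z A \<delta>. {(B,x,y). (B,x,y) \<in> rlz E Z A \<delta> \<and> B \<in> \<U>})\<rparr>"

definition ext_perp :: "('k,'o,'m,'e) excat \<Rightarrow> 'o set \<Rightarrow> 'o set" where
  "ext_perp E \<X> = {M \<in> Ob E. \<forall>X\<in>\<X>. carrier (Ext E X M) = {\<zero>\<^bsub>Ext E X M\<^esub>}}"

definition rigid :: "('k,'o,'m,'e) excat \<Rightarrow> 'o set \<Rightarrow> bool" where
  "rigid E \<X> \<longleftrightarrow> \<X> \<subseteq> ext_perp E \<X>"

subsection \<open>The stable category\<close>

text \<open>The conflation \<open>X \<rightarrow> I X \<rightarrow> \<Sigma> X\<close> fixed for each \<open>X\<close>. Up to isomorphism nothing below depends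
  on the choice.\<close>

definition susp_confl :: "('k,'o,'m,'e) excat \<Rightarrow> 'o \<Rightarrow> ('o,'m,'e) confl" where
  "susp_confl E X = (SOME t. t \<in> conflations E \<and>
     (\<exists>I S i p \<sigma>. t = (X,I,S,i,p,\<sigma>) \<and> injective E I))"

definition stable_susp :: "('k,'o,'m,'e) excat \<Rightarrow> 'o \<Rightarrow> 'o" where
  "stable_susp E X = (case susp_confl E X of (_,_,S,_,_,_) \<Rightarrow> S)"

definition stable_susp_arr :: "('k,'o,'m,'e) excat \<Rightarrow> 'o \<Rightarrow> 'o \<Rightarrow> 'm set \<Rightarrow> 'm set" where
  "stable_susp_arr E X Y F =
     (SOME G. \<exists>f\<in>F. \<exists>b s. confl_morphism E (susp_confl E X) (susp_confl E Y) f b s \<and>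
        G = quot_arr E (proj_inj E) (stable_susp E X) (stable_susp E Y) s)"

definition stable_standard :: "('k,'o,'m,'e) excat \<Rightarrow> ('o,'m set) triangle set" where
  "stable_standard E =
     {(X, Y, Z, quot_arr E (proj_inj E) X Y f, quot_arr E (proj_inj E) Y Z g,
       quot_arr E (proj_inj E) Z (stable_susp E X) h) | X Y Z f g h.
      \<exists>\<delta> b. (X,Y,Z,f,g,\<delta>) \<in> conflations E \<and>
        confl_morphism E (X,Y,Z,f,g,\<delta>) (susp_confl E X) (ide E X) b h}"

definition stable_cat :: "('k,'o,'m,'e) excat \<Rightarrow> ('k,'o,'m set) tricat" where
  "stable_cat E = (let Q = quot_cat E (proj_inj E) in
     \<lparr>Ob = Ob Q, Hom = Hom Q, cmp = cmp Q, ide = ide Q,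
      susp = stable_susp E,
      susp_arr = stable_susp_arr E,
      dist = triangle_iso_closure Q (stable_susp E) (stable_susp_arr E) (stable_standard E)\<rparr>)"

definition stably_two_calabi_yau :: "('k,'r) ring_scheme \<Rightarrow> ('k,'o,'m,'e) excat \<Rightarrow> bool" where
  "stably_two_calabi_yau K E \<longleftrightarrow> two_calabi_yau K (stable_cat E)"


section \<open>Iyama--Yoshino reduction\<close>

definition ext1_perp :: "('k,'o,'m) tricat \<Rightarrow> 'o set \<Rightarrow> 'o set" where
  "ext1_perp T \<X> = {M \<in> Ob T. \<forall>X\<in>\<X>. carrier (ext1 T M X) = {\<zero>\<^bsub>ext1 T M X\<^esub>}}"

definition full_subcat :: "('k,'o,'m) tricat \<Rightarrow> 'o set \<Rightarrow> ('k,'o,'m) lincat" where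
  "full_subcat T \<U> = \<lparr>Ob = \<U>, Hom = Hom T, cmp = cmp T, ide = ide T\<rparr>"

definition iy_cat :: "('k,'o,'m) tricat \<Rightarrow> 'o set \<Rightarrow> ('k,'o,'m set) lincat" where
  "iy_cat T \<X> = quot_cat (full_subcat T (ext1_perp T \<X>)) (add_closure T \<X>)"

text \<open>The triangle \<open>Y \<rightarrow> X\<^sub>Y \<rightarrow> Y\<langle>1\<rangle> \<rightarrow> \<Sigma> Y\<close> fixed for each \<open>Y\<close>.\<close>

definition approx_triangle :: "('k,'o,'m) tricat \<Rightarrow> 'o set \<Rightarrow> 'o \<Rightarrow> ('o,'m) triangle" where
  "approx_triangle T \<X> Y = (SOME t. t \<in> dist T \<and>
     (\<exists>X Y1 f g h. t = (Y,X,Y1,f,g,h) \<and> left_approximation T (add_closure T \<X>) Y X f))"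

definition iy_susp :: "('k,'o,'m) tricat \<Rightarrow> 'o set \<Rightarrow> 'o \<Rightarrow> 'o" where
  "iy_susp T \<X> Y = (case approx_triangle T \<X> Y of (_,_,Y1,_,_,_) \<Rightarrow> Y1)"

definition iy_susp_arr :: "('k,'o,'m) tricat \<Rightarrow> 'o set \<Rightarrow> 'o \<Rightarrow> 'o \<Rightarrow> 'm set \<Rightarrow> 'm set" where
  "iy_susp_arr T \<X> Y Y' F =
     (SOME G. \<exists>f\<in>F. \<exists>x c.
        triangle_morphism T (susp T) (susp_arr T) (approx_triangle T \<X> Y) (approx_triangle T \<X> Y') f x c \<and>
        G = quot_arr T (add_closure T \<X>) (iy_susp T \<X> Y) (iy_susp T \<X> Y') c)"

definition iy_standard :: "('k,'o,'m) tricat \<Rightarrow> 'o set \<Rightarrow> ('o,'m set) triangle set" where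
  "iy_standard T \<X> =
     {(A, B, C, quot_arr T (add_closure T \<X>) A B a, quot_arr T (add_closure T \<X>) B C b,
       quot_arr T (add_closure T \<X>) C (iy_susp T \<X> A) g) | A B C a b g.
      A \<in> ext1_perp T \<X> \<and> B \<in> ext1_perp T \<X> \<and> C \<in> ext1_perp T \<X> \<and>
      (\<exists>c x. (A,B,C,a,b,c) \<in> dist T \<and>
        triangle_morphism T (susp T) (susp_arr T) (A,B,C,a,b,c) (approx_triangle T \<X> A) (ide T A) x g)}"

definition iy_reduction :: "('k,'o,'m) tricat \<Rightarrow> 'o set \<Rightarrow> ('k,'o,'m set) tricat" where
  "iy_reduction T \<X> = (let Q = iy_cat T \<X> in
     \<lparr>Ob = Ob Q, Hom = Hom Q, cmp = cmp Q, ide = ide Q,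
      susp = iy_susp T \<X>,
      susp_arr = iy_susp_arr T \<X>,
      dist = triangle_iso_closure Q (iy_susp T \<X>) (iy_susp_arr T \<X>) (iy_standard T \<X>)\<rparr>)"

end

theory Submission
  imports Defs
begin

text \<open>
  Write \<open>\<U>\<close> for the perpendicular category of \<open>\<X>\<close>, which by the 2-Calabi--Yau property may be
  computed on either side. Its projective-injectives are the objects of \<open>\<U>\<close> without extensions, in
  either direction, with objects of \<open>\<U>\<close>; up to retracts in the stable category these are the objects
  of \<open>add \<X>\<close>. Indeed a left \<open>\<X>\<close>-approximation \<open>Y \<rightarrow> X\<close> and an injective inflation \<open>Y \<rightarrow> I\<close> give a
  conflation \<open>Y \<rightarrow> X \<oplus> I \<rightarrow> Z\<close> with \<open>Z\<close> in \<open>\<U>\<close>. Hence both categories have the objects of \<open>\<U>\<close> and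
  the same morphisms, those of \<open>\<F>\<close> modulo maps factoring through these projective-injectives.
  Both suspensions of \<open>Y\<close> represent the functor \<open>Ext(-, Y)\<close> on this category, so by Yoneda they are
  naturally isomorphic, and maps into a suspension can be replaced by extensions throughout. In this
  form the standard triangles of either side are the conflations in \<open>\<U>\<close> with their extensions.
\<close>

section \<open>Linear maps and quotient modules\<close>

text \<open>Three features of the definitions shape the argument. Suspensions of arrows are choices
  among all representatives, so each has to be shown to admit one value only; extensions are
  insensitive to these choices, which is why maps into a suspension are traded for them.
  Distinguished triangles are closed under isomorphism in the stable category, so the triangle fixed
  for the suspension of the reduction need not come from a conflation on its own objects; exactness
  is therefore proved for stable retracts of conflations. Finally, the reduction divides twice, by
  maps through projective-injectives of \<open>F\<close> and then by maps through
  \<open>add_closure\<close>, while the stable category of the subcategory divides once. All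
  quotients are formed on the hom-spaces of \<open>F\<close> and over all its objects, so that the
  comparison becomes the third isomorphism theorem for two nested ideals, and the functor is the
  identity on objects.\<close>

lemma module_abelian_group: "module K M \<Longrightarrow> abelian_group M"
  by (rule module.axioms(2))

lemma linear_map_closed: "linear_map K M N \<phi> \<Longrightarrow> x \<in> carrier M \<Longrightarrow> \<phi> x \<in> carrier N"
  unfolding linear_map_def by blast

lemma linear_map_add:
  "linear_map K M N \<phi> \<Longrightarrow> x \<in> carrier M \<Longrightarrow> y \<in> carrier M \<Longrightarrow> \<phi> (x \<oplus>\<^bsub>M\<^esub> y) = \<phi> x \<oplus>\<^bsub>N\<^esub> \<phi> y"
  unfolding linear_map_def by blast

lemma linear_map_smult:
  "linear_map K M N \<phi> \<Longrightarrow> k \<in> carrier K \<Longrightarrow> x \<in> carrier M \<Longrightarrow> \<phi> (k \<odot>\<^bsub>M\<^esub> x) = k \<odot>\<^bsub>N\<^esub> \<phi> x"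
  unfolding linear_map_def by blast

lemma linear_map_zero:
  assumes "linear_map K M N \<phi>" "module K M" "module K N"
  shows "\<phi> \<zero>\<^bsub>M\<^esub> = \<zero>\<^bsub>N\<^esub>"
proof -
  interpret M: abelian_group M using assms(2) by (rule module_abelian_group)
  interpret N: abelian_group N using assms(3) by (rule module_abelian_group)
  have c: "\<phi> \<zero>\<^bsub>M\<^esub> \<in> carrier N" by (rule linear_map_closed[OF assms(1)]) simp
  have "\<phi> \<zero>\<^bsub>M\<^esub> \<oplus>\<^bsub>N\<^esub> \<phi> \<zero>\<^bsub>M\<^esub> = \<phi> \<zero>\<^bsub>M\<^esub>"
    using linear_map_add[OF assms(1), of "\<zero>\<^bsub>M\<^esub>" "\<zero>\<^bsub>M\<^esub>"] by simp
  then show ?thesis using c N.add.l_cancel_one by metis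
qed

lemma linear_map_minus:
  assumes "linear_map K M N \<phi>" "module K M" "module K N" "x \<in> carrier M" "y \<in> carrier M"
  shows "\<phi> (x \<ominus>\<^bsub>M\<^esub> y) = \<phi> x \<ominus>\<^bsub>N\<^esub> \<phi> y"
proof -
  interpret M: abelian_group M using assms(2) by (rule module_abelian_group)
  interpret N: abelian_group N using assms(3) by (rule module_abelian_group)
  note c = linear_map_closed[OF assms(1)]
  have d: "x \<ominus>\<^bsub>M\<^esub> y \<in> carrier M" using assms by simp
  have "(x \<ominus>\<^bsub>M\<^esub> y) \<oplus>\<^bsub>M\<^esub> y = x"
    using assms by (simp add: M.minus_eq M.a_assoc M.l_neg)
  then have "\<phi> x = \<phi> (x \<ominus>\<^bsub>M\<^esub> y) \<oplus>\<^bsub>N\<^esub> \<phi> y"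
    using linear_map_add[OF assms(1) d assms(5)] by simp
  then show ?thesis
    using c[OF d] c[OF assms(5)] by (simp add: N.minus_eq N.a_assoc N.r_neg)
qed

lemma (in abelian_group) minus_zero_iff:
  "x \<in> carrier G \<Longrightarrow> y \<in> carrier G \<Longrightarrow> x \<ominus> y = \<zero> \<longleftrightarrow> x = y"
  by (metis a_inv_closed l_zero local.minus_eq minus_equality minus_minus r_neg)

text \<open>\<open>quot_module\<close> is a bare record with operations on arbitrary sets; closure
  of \<open>J\<close> under scalars is what turns the quotient group of cosets into a module over
  \<open>K\<close>.\<close>

locale submodule_quotient =
  fixes K :: "('k,'r) ring_scheme" and M :: "('k,'m,'z) module_scheme" and J :: "'m set"
  assumes mod: "module K M"
    and sub: "additive_subgroup J M"
    and smult_sub: "k \<in> carrier K \<Longrightarrow> x \<in> J \<Longrightarrow> k \<odot>\<^bsub>M\<^esub> x \<in> J"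
begin

interpretation module K M by (rule mod)
interpretation J: abelian_subgroup J M
  by (rule abelian_subgroupI3[OF sub module_abelian_group[OF mod]])

lemma coset_self: "x \<in> carrier M \<Longrightarrow> x \<in> J +>\<^bsub>M\<^esub> x"
  by (rule J.a_rcos_self)

lemma coset_eq_iff:
  assumes "x \<in> carrier M" "y \<in> carrier M"
  shows "J +>\<^bsub>M\<^esub> x = J +>\<^bsub>M\<^esub> y \<longleftrightarrow> x \<ominus>\<^bsub>M\<^esub> y \<in> J"
proof -
  have "J +>\<^bsub>M\<^esub> x = J +>\<^bsub>M\<^esub> y \<longleftrightarrow> x \<in> J +>\<^bsub>M\<^esub> y"
    using J.a_repr_independence'[of x y] J.a_rcos_self[of x] assms by auto
  then show ?thesis using J.a_rcos_module[of y x] assms by (simp add: M.minus_eq)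
qed

lemma coset_memD:
  assumes "x \<in> carrier M" "y \<in> J +>\<^bsub>M\<^esub> x"
  shows "y \<in> carrier M" "J +>\<^bsub>M\<^esub> y = J +>\<^bsub>M\<^esub> x"
proof -
  show "y \<in> carrier M"
    using M.a_r_coset_subset_G[OF J.a_subset assms(1)] assms(2) by blast
  show "J +>\<^bsub>M\<^esub> y = J +>\<^bsub>M\<^esub> x"
    using J.a_repr_independence'[OF assms(2,1)] by simp
qed

lemma coset_zero: "J +>\<^bsub>M\<^esub> \<zero>\<^bsub>M\<^esub> = J"
  using M.a_coset_add_zero J.a_subset by simp

lemma carrier_quot: "carrier (quot_module M J) = (\<lambda>x. J +>\<^bsub>M\<^esub> x) ` carrier M"
  unfolding quot_module_def A_RCOSETS_def' by auto

lemma zero_quot: "\<zero>\<^bsub>quot_module M J\<^esub> = J +>\<^bsub>M\<^esub> \<zero>\<^bsub>M\<^esub>"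
  unfolding coset_zero by (simp add: quot_module_def)

lemma add_quot:
  "x \<in> carrier M \<Longrightarrow> y \<in> carrier M \<Longrightarrow>
    (J +>\<^bsub>M\<^esub> x) \<oplus>\<^bsub>quot_module M J\<^esub> (J +>\<^bsub>M\<^esub> y) = J +>\<^bsub>M\<^esub> (x \<oplus>\<^bsub>M\<^esub> y)"
  by (simp add: quot_module_def J.a_rcos_sum)

text \<open>The definition takes a union over all representatives. They differ by elements of
  \<open>J\<close>, which absorbs scalars, so every coset in the union is the same one.\<close>

lemma smult_quot:
  assumes "k \<in> carrier K" "x \<in> carrier M"
  shows "k \<odot>\<^bsub>quot_module M J\<^esub> (J +>\<^bsub>M\<^esub> x) = J +>\<^bsub>M\<^esub> (k \<odot>\<^bsub>M\<^esub> x)"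
proof -
  have eq: "J +>\<^bsub>M\<^esub> (k \<odot>\<^bsub>M\<^esub> y) = J +>\<^bsub>M\<^esub> (k \<odot>\<^bsub>M\<^esub> x)" if y: "y \<in> J +>\<^bsub>M\<^esub> x" for y
  proof -
    have yc: "y \<in> carrier M" using coset_memD(1)[OF assms(2) y] .
    then have "y \<ominus>\<^bsub>M\<^esub> x \<in> J" using coset_memD(2)[OF assms(2) y] coset_eq_iff assms by blast
    then have "k \<odot>\<^bsub>M\<^esub> (y \<ominus>\<^bsub>M\<^esub> x) \<in> J" using smult_sub assms by blast
    then have "k \<odot>\<^bsub>M\<^esub> y \<ominus>\<^bsub>M\<^esub> k \<odot>\<^bsub>M\<^esub> x \<in> J"
      using assms yc by (simp add: M.minus_eq smult_r_distr smult_r_minus)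
    then show ?thesis using coset_eq_iff assms yc by simp
  qed
  then have "(\<Union>y\<in>J +>\<^bsub>M\<^esub> x. J +>\<^bsub>M\<^esub> (k \<odot>\<^bsub>M\<^esub> y)) = J +>\<^bsub>M\<^esub> (k \<odot>\<^bsub>M\<^esub> x)"
    by (intro UN_constant_eq[OF coset_self[OF assms(2)]] ballI eq)
  then show ?thesis by (simp add: quot_module_def)
qed

lemma module_quot: "module K (quot_module M J)"
proof (rule moduleI)
  show "cring K" by (rule R.is_cring)
  let ?c = "\<lambda>x. J +>\<^bsub>M\<^esub> x"
  show "abelian_group (quot_module M J)"
  proof (rule abelian_groupI)
    fix x assume "x \<in> carrier (quot_module M J)"
    then obtain a where a: "a \<in> carrier M" "x = ?c a" unfolding carrier_quot by blast
    have "?c (\<ominus>\<^bsub>M\<^esub> a) \<oplus>\<^bsub>quot_module M J\<^esub> x = \<zero>\<^bsub>quot_module M J\<^esub>"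
      using a by (simp add: add_quot zero_quot M.l_neg)
    then show "\<exists>y\<in>carrier (quot_module M J). y \<oplus>\<^bsub>quot_module M J\<^esub> x = \<zero>\<^bsub>quot_module M J\<^esub>"
      using a carrier_quot by blast
  qed (auto simp: carrier_quot add_quot zero_quot M.a_ac)
qed (auto simp: carrier_quot add_quot smult_quot smult_l_distr smult_r_distr smult_assoc1)

end

section \<open>Linear categories and their quotients\<close>

context linear_category
begin

lemma hom_group: "X \<in> Ob C \<Longrightarrow> Y \<in> Ob C \<Longrightarrow> abelian_group (Hom C X Y)"
  by (rule module_abelian_group[OF hom_module])

lemma hom_closed [simp]:
  assumes "X \<in> Ob C" "Y \<in> Ob C"
  shows "\<zero>\<^bsub>Hom C X Y\<^esub> \<in> arr C X Y"
    and "f \<in> arr C X Y \<Longrightarrow> g \<in> arr C X Y \<Longrightarrow> f \<oplus>\<^bsub>Hom C X Y\<^esub> g \<in> arr C X Y"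
    and "f \<in> arr C X Y \<Longrightarrow> g \<in> arr C X Y \<Longrightarrow> f \<ominus>\<^bsub>Hom C X Y\<^esub> g \<in> arr C X Y"
    and "f \<in> arr C X Y \<Longrightarrow> \<ominus>\<^bsub>Hom C X Y\<^esub> f \<in> arr C X Y"
    and "k \<in> carrier K \<Longrightarrow> f \<in> arr C X Y \<Longrightarrow> k \<odot>\<^bsub>Hom C X Y\<^esub> f \<in> arr C X Y"
proof -
  interpret module K "Hom C X Y" using assms by (rule hom_module)
  show "\<zero>\<^bsub>Hom C X Y\<^esub> \<in> arr C X Y"
    and "f \<in> arr C X Y \<Longrightarrow> g \<in> arr C X Y \<Longrightarrow> f \<oplus>\<^bsub>Hom C X Y\<^esub> g \<in> arr C X Y"
    and "f \<in> arr C X Y \<Longrightarrow> g \<in> arr C X Y \<Longrightarrow> f \<ominus>\<^bsub>Hom C X Y\<^esub> g \<in> arr C X Y"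
    and "f \<in> arr C X Y \<Longrightarrow> \<ominus>\<^bsub>Hom C X Y\<^esub> f \<in> arr C X Y"
    and "k \<in> carrier K \<Longrightarrow> f \<in> arr C X Y \<Longrightarrow> k \<odot>\<^bsub>Hom C X Y\<^esub> f \<in> arr C X Y"
    by simp_all
qed

lemma hom_arith [simp]:
  assumes "X \<in> Ob C" "Y \<in> Ob C" "f \<in> arr C X Y"
  shows "\<zero>\<^bsub>Hom C X Y\<^esub> \<oplus>\<^bsub>Hom C X Y\<^esub> f = f"
    and "f \<oplus>\<^bsub>Hom C X Y\<^esub> \<zero>\<^bsub>Hom C X Y\<^esub> = f"
    and "f \<ominus>\<^bsub>Hom C X Y\<^esub> f = \<zero>\<^bsub>Hom C X Y\<^esub>"
    and "f \<ominus>\<^bsub>Hom C X Y\<^esub> \<zero>\<^bsub>Hom C X Y\<^esub> = f"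
    and "g \<in> arr C X Y \<Longrightarrow> (g \<ominus>\<^bsub>Hom C X Y\<^esub> f) \<oplus>\<^bsub>Hom C X Y\<^esub> f = g"
    and "g \<in> arr C X Y \<Longrightarrow> f \<oplus>\<^bsub>Hom C X Y\<^esub> (g \<ominus>\<^bsub>Hom C X Y\<^esub> f) = g"
proof -
  interpret module K "Hom C X Y" using assms by (intro hom_module)
  show "\<zero>\<^bsub>Hom C X Y\<^esub> \<oplus>\<^bsub>Hom C X Y\<^esub> f = f"
    and "f \<oplus>\<^bsub>Hom C X Y\<^esub> \<zero>\<^bsub>Hom C X Y\<^esub> = f"
    and "f \<ominus>\<^bsub>Hom C X Y\<^esub> f = \<zero>\<^bsub>Hom C X Y\<^esub>"
    and "f \<ominus>\<^bsub>Hom C X Y\<^esub> \<zero>\<^bsub>Hom C X Y\<^esub> = f"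
    and "g \<in> arr C X Y \<Longrightarrow> (g \<ominus>\<^bsub>Hom C X Y\<^esub> f) \<oplus>\<^bsub>Hom C X Y\<^esub> f = g"
    and "g \<in> arr C X Y \<Longrightarrow> f \<oplus>\<^bsub>Hom C X Y\<^esub> (g \<ominus>\<^bsub>Hom C X Y\<^esub> f) = g"
    using assms(3) M.a_lcomm[of f g "\<ominus>\<^bsub>Hom C X Y\<^esub> f"]
    by (simp_all add: M.minus_eq M.a_assoc M.l_neg M.r_neg)
qed

lemma minus_zero_iff:
  "X \<in> Ob C \<Longrightarrow> Y \<in> Ob C \<Longrightarrow> f \<in> arr C X Y \<Longrightarrow> g \<in> arr C X Y \<Longrightarrow>
    f \<ominus>\<^bsub>Hom C X Y\<^esub> g = \<zero>\<^bsub>Hom C X Y\<^esub> \<longleftrightarrow> f = g"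
  by (rule abelian_group.minus_zero_iff[OF hom_group])

lemma cmp_closed [simp]:
  "X \<in> Ob C \<Longrightarrow> Y \<in> Ob C \<Longrightarrow> Z \<in> Ob C \<Longrightarrow> f \<in> arr C X Y \<Longrightarrow> g \<in> arr C Y Z \<Longrightarrow>
    cmp C X Y Z g f \<in> arr C X Z"
  by (rule linear_map_closed[OF cmp_linear_left])

lemmas cat_simps [simp] = ide_arr ide_left ide_right cmp_assoc

lemma cmp_zero_left [simp]:
  assumes "X \<in> Ob C" "Y \<in> Ob C" "Z \<in> Ob C" "f \<in> arr C X Y"
  shows "cmp C X Y Z \<zero>\<^bsub>Hom C Y Z\<^esub> f = \<zero>\<^bsub>Hom C X Z\<^esub>"
  using linear_map_zero[OF cmp_linear_left[OF assms]] hom_module assms by simp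

lemma cmp_zero_right [simp]:
  assumes "X \<in> Ob C" "Y \<in> Ob C" "Z \<in> Ob C" "g \<in> arr C Y Z"
  shows "cmp C X Y Z g \<zero>\<^bsub>Hom C X Y\<^esub> = \<zero>\<^bsub>Hom C X Z\<^esub>"
  using linear_map_zero[OF cmp_linear_right[OF assms]] hom_module assms by simp

lemma cmp_bilinear [simp]:
  assumes "X \<in> Ob C" "Y \<in> Ob C" "Z \<in> Ob C" "f \<in> arr C X Y" "g \<in> arr C Y Z"
  shows "g' \<in> arr C Y Z \<Longrightarrow>
      cmp C X Y Z (g \<oplus>\<^bsub>Hom C Y Z\<^esub> g') f = cmp C X Y Z g f \<oplus>\<^bsub>Hom C X Z\<^esub> cmp C X Y Z g' f"
    and "g' \<in> arr C Y Z \<Longrightarrow>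
      cmp C X Y Z (g \<ominus>\<^bsub>Hom C Y Z\<^esub> g') f = cmp C X Y Z g f \<ominus>\<^bsub>Hom C X Z\<^esub> cmp C X Y Z g' f"
    and "f' \<in> arr C X Y \<Longrightarrow>
      cmp C X Y Z g (f \<oplus>\<^bsub>Hom C X Y\<^esub> f') = cmp C X Y Z g f \<oplus>\<^bsub>Hom C X Z\<^esub> cmp C X Y Z g f'"
    and "f' \<in> arr C X Y \<Longrightarrow>
      cmp C X Y Z g (f \<ominus>\<^bsub>Hom C X Y\<^esub> f') = cmp C X Y Z g f \<ominus>\<^bsub>Hom C X Z\<^esub> cmp C X Y Z g f'"
    and "k \<in> carrier K \<Longrightarrow>
      cmp C X Y Z (k \<odot>\<^bsub>Hom C Y Z\<^esub> g) f = k \<odot>\<^bsub>Hom C X Z\<^esub> cmp C X Y Z g f"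
    and "k \<in> carrier K \<Longrightarrow>
      cmp C X Y Z g (k \<odot>\<^bsub>Hom C X Y\<^esub> f) = k \<odot>\<^bsub>Hom C X Z\<^esub> cmp C X Y Z g f"
proof -
  note l = cmp_linear_left[OF assms(1-4)] and r = cmp_linear_right[OF assms(1-3,5)]
  note m = hom_module[OF assms(1,2)] hom_module[OF assms(2,3)] hom_module[OF assms(1,3)]
  show "g' \<in> arr C Y Z \<Longrightarrow>
      cmp C X Y Z (g \<oplus>\<^bsub>Hom C Y Z\<^esub> g') f = cmp C X Y Z g f \<oplus>\<^bsub>Hom C X Z\<^esub> cmp C X Y Z g' f"
    using linear_map_add[OF l] assms by blast
  show "g' \<in> arr C Y Z \<Longrightarrow>
      cmp C X Y Z (g \<ominus>\<^bsub>Hom C Y Z\<^esub> g') f = cmp C X Y Z g f \<ominus>\<^bsub>Hom C X Z\<^esub> cmp C X Y Z g' f"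
    using linear_map_minus[OF l m(2,3)] assms by blast
  show "f' \<in> arr C X Y \<Longrightarrow>
      cmp C X Y Z g (f \<oplus>\<^bsub>Hom C X Y\<^esub> f') = cmp C X Y Z g f \<oplus>\<^bsub>Hom C X Z\<^esub> cmp C X Y Z g f'"
    using linear_map_add[OF r] assms by blast
  show "f' \<in> arr C X Y \<Longrightarrow>
      cmp C X Y Z g (f \<ominus>\<^bsub>Hom C X Y\<^esub> f') = cmp C X Y Z g f \<ominus>\<^bsub>Hom C X Z\<^esub> cmp C X Y Z g f'"
    using linear_map_minus[OF r m(1,3)] assms by blast
  show "k \<in> carrier K \<Longrightarrow>
      cmp C X Y Z (k \<odot>\<^bsub>Hom C Y Z\<^esub> g) f = k \<odot>\<^bsub>Hom C X Z\<^esub> cmp C X Y Z g f"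
    using linear_map_smult[OF l] assms by blast
  show "k \<in> carrier K \<Longrightarrow>
      cmp C X Y Z g (k \<odot>\<^bsub>Hom C X Y\<^esub> f) = k \<odot>\<^bsub>Hom C X Z\<^esub> cmp C X Y Z g f"
    using linear_map_smult[OF r] assms by blast
qed

lemma factoringI:
  "P \<in> \<P> \<Longrightarrow> a \<in> arr C X P \<Longrightarrow> b \<in> arr C P Y \<Longrightarrow> cmp C X P Y b a \<in> factoring C \<P> X Y"
  unfolding factoring_def by blast

text \<open>A sum of maps factoring through \<open>P\<close> and \<open>P'\<close> factors through a
  biproduct of the two, hence \<open>sums\<close> asks for one biproduct inside the class.\<close>

lemma factoring_additive_subgroup:
  assumes ob: "X \<in> Ob C" "Y \<in> Ob C" and ne: "\<P> \<noteq> {}" and P: "\<P> \<subseteq> Ob C"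
    and sums: "\<And>P P'. P \<in> \<P> \<Longrightarrow> P' \<in> \<P> \<Longrightarrow> \<exists>S\<in>\<P>. \<exists>i j p q. biproduct C P P' S i j p q"
  shows "additive_subgroup (factoring C \<P> X Y) (Hom C X Y)"
proof (rule additive_subgroupI)
  interpret M: module K "Hom C X Y" using ob by (rule hom_module)
  have sub: "factoring C \<P> X Y \<subseteq> arr C X Y"
    using P ob by (auto simp: factoring_def subset_iff)
  show "subgroup (factoring C \<P> X Y) (add_monoid (Hom C X Y))"
  proof (rule group.subgroupI)
    show "Group.group (add_monoid (Hom C X Y))" by (rule M.a_group)
    show "factoring C \<P> X Y \<subseteq> carrier (add_monoid (Hom C X Y))" using sub by simp
    obtain P where PP: "P \<in> \<P>" using ne by blast
    then have "cmp C X P Y \<zero>\<^bsub>Hom C P Y\<^esub> \<zero>\<^bsub>Hom C X P\<^esub> \<in> factoring C \<P> X Y"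
      using P ob by (intro factoringI) auto
    then show "factoring C \<P> X Y \<noteq> {}" by blast
  next
    fix f assume "f \<in> factoring C \<P> X Y"
    then obtain R a b where R: "R \<in> \<P>" "a \<in> arr C X R" "b \<in> arr C R Y" "f = cmp C X R Y b a"
      unfolding factoring_def by blast
    have RO: "R \<in> Ob C" using R P by blast
    \<comment> \<open>Bilinearity is at hand for subtraction, so the negative is written as zero
      minus \<open>b\<close>.\<close>
    have "cmp C X R Y (\<zero>\<^bsub>Hom C R Y\<^esub> \<ominus>\<^bsub>Hom C R Y\<^esub> b) a = \<zero>\<^bsub>Hom C X Y\<^esub> \<ominus>\<^bsub>Hom C X Y\<^esub> f"
      using R RO ob by simp
    also have "\<dots> = \<ominus>\<^bsub>Hom C X Y\<^esub> f"
      using R RO ob by (simp add: M.M.minus_eq)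
    also have "\<dots> = inv\<^bsub>add_monoid (Hom C X Y)\<^esub> f" by (simp add: a_inv_def)
    finally show "inv\<^bsub>add_monoid (Hom C X Y)\<^esub> f \<in> factoring C \<P> X Y"
      using factoringI[OF R(1,2), of "\<zero>\<^bsub>Hom C R Y\<^esub> \<ominus>\<^bsub>Hom C R Y\<^esub> b" Y] R RO ob by simp
  next
    fix f g assume "f \<in> factoring C \<P> X Y" "g \<in> factoring C \<P> X Y"
    then obtain R a b S c d where R: "R \<in> \<P>" "a \<in> arr C X R" "b \<in> arr C R Y" "f = cmp C X R Y b a"
      and S: "S \<in> \<P>" "c \<in> arr C X S" "d \<in> arr C S Y" "g = cmp C X S Y d c"
      unfolding factoring_def by blast
    obtain T i j p q where T: "T \<in> \<P>" and bp: "biproduct C R S T i j p q"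
      using sums[OF R(1) S(1)] by blast
    have O: "R \<in> Ob C" "S \<in> Ob C" "T \<in> Ob C" using R S T P by auto
    \<comment> \<open>The column with entries \<open>a\<close> and \<open>c\<close> into the
      biproduct, and next the row with entries \<open>b\<close> and \<open>d\<close> out of it;
      their composite is the sum of \<open>f\<close> and \<open>g\<close>.\<close>
    let ?u = "cmp C X R T i a \<oplus>\<^bsub>Hom C X T\<^esub> cmp C X S T j c"
    let ?v = "cmp C T R Y b p \<oplus>\<^bsub>Hom C T Y\<^esub> cmp C T S Y d q"
    have b: "i \<in> arr C R T" "j \<in> arr C S T" "p \<in> arr C T R" "q \<in> arr C T S"
      "cmp C R T R p i = ide C R" "cmp C S T S q j = ide C S"
      "cmp C S T R p j = \<zero>\<^bsub>Hom C S R\<^esub>" "cmp C R T S q i = \<zero>\<^bsub>Hom C R S\<^esub>"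
      using bp by (auto simp: biproduct_def)
    have "cmp C X T R p (cmp C X R T i a) = a" "cmp C X T S q (cmp C X S T j c) = c"
      "cmp C X T R p (cmp C X S T j c) = \<zero>\<^bsub>Hom C X R\<^esub>"
      "cmp C X T S q (cmp C X R T i a) = \<zero>\<^bsub>Hom C X S\<^esub>"
      using O ob R(2) S(2) b cmp_assoc[of X R T R a i p] cmp_assoc[of X S T R c j p]
        cmp_assoc[of X R T S a i q] cmp_assoc[of X S T S c j q] by auto
    then have pu: "cmp C X T R p ?u = a" and qu: "cmp C X T S q ?u = c"
      using O ob R(2) S(2) b by simp_all
    have "cmp C X T Y ?v ?u = cmp C X T Y (cmp C T R Y b p) ?u \<oplus>\<^bsub>Hom C X Y\<^esub> cmp C X T Y (cmp C T S Y d q) ?u"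
      using O ob R(2,3) S(2,3) b by (intro cmp_bilinear(1)) auto
    also have "cmp C X T Y (cmp C T R Y b p) ?u = f"
      using cmp_assoc[of X T R Y ?u p b] pu O ob R S b by simp
    also have "cmp C X T Y (cmp C T S Y d q) ?u = g"
      using cmp_assoc[of X T S Y ?u q d] qu O ob R S b by simp
    finally have "cmp C X T Y ?v ?u = f \<oplus>\<^bsub>Hom C X Y\<^esub> g" .
    moreover have "cmp C X T Y ?v ?u \<in> factoring C \<P> X Y"
      using O ob R S b by (intro factoringI T) auto
    ultimately show "f \<otimes>\<^bsub>add_monoid (Hom C X Y)\<^esub> g \<in> factoring C \<P> X Y" by simp
  qed
qed

end

text \<open>Maps through \<open>\<P>\<close> absorb composition on either side and scalars
  automatically; additivity has to be supplied. The locale is entered with the projective-injectives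
  of \<open>F\<close>, with those of the subcategory and, inside a quotient, with
  \<open>add_closure\<close>.\<close>

locale factor_category = linear_category K C
  for K :: "('k,'r) ring_scheme" and C :: "('k,'o,'m,'z) lincat_scheme" +
  fixes \<P> :: "'o set"
  assumes factor_objects: "\<P> \<subseteq> Ob C"
    and factor_subgroup:
      "X \<in> Ob C \<Longrightarrow> Y \<in> Ob C \<Longrightarrow> additive_subgroup (factoring C \<P> X Y) (Hom C X Y)"
begin

lemma factoring_smult:
  assumes "X \<in> Ob C" "Y \<in> Ob C" "k \<in> carrier K" "f \<in> factoring C \<P> X Y"
  shows "k \<odot>\<^bsub>Hom C X Y\<^esub> f \<in> factoring C \<P> X Y"
proof -
  obtain R a b where R: "R \<in> \<P>" "a \<in> arr C X R" "b \<in> arr C R Y" "f = cmp C X R Y b a"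
    using assms unfolding factoring_def by blast
  have RO: "R \<in> Ob C" using R factor_objects by blast
  have "cmp C X R Y (k \<odot>\<^bsub>Hom C R Y\<^esub> b) a = k \<odot>\<^bsub>Hom C X Y\<^esub> f" using R RO assms by simp
  then show ?thesis using factoringI[OF R(1,2), of "k \<odot>\<^bsub>Hom C R Y\<^esub> b" Y] R RO assms by simp
qed

lemma submodule: "X \<in> Ob C \<Longrightarrow> Y \<in> Ob C \<Longrightarrow> submodule_quotient K (Hom C X Y) (factoring C \<P> X Y)"
  by (intro submodule_quotient.intro hom_module factor_subgroup factoring_smult)

lemma factoring_cmp_left:
  assumes "X \<in> Ob C" "Y \<in> Ob C" "Z \<in> Ob C" "f \<in> factoring C \<P> X Y" "g \<in> arr C Y Z"
  shows "cmp C X Y Z g f \<in> factoring C \<P> X Z"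
proof -
  obtain R a b where R: "R \<in> \<P>" "a \<in> arr C X R" "b \<in> arr C R Y" "f = cmp C X R Y b a"
    using assms unfolding factoring_def by blast
  have RO: "R \<in> Ob C" using R factor_objects by blast
  have "cmp C X Y Z g f = cmp C X R Z (cmp C R Y Z g b) a" using R RO assms by simp
  then show ?thesis using factoringI[OF R(1,2), of "cmp C R Y Z g b" Z] R RO assms by simp
qed

lemma factoring_cmp_right:
  assumes "X \<in> Ob C" "Y \<in> Ob C" "Z \<in> Ob C" "f \<in> arr C X Y" "g \<in> factoring C \<P> Y Z"
  shows "cmp C X Y Z g f \<in> factoring C \<P> X Z"
proof -
  obtain R a b where R: "R \<in> \<P>" "a \<in> arr C Y R" "b \<in> arr C R Z" "g = cmp C Y R Z b a"
    using assms unfolding factoring_def by blast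
  have RO: "R \<in> Ob C" using R factor_objects by blast
  have "cmp C X Y Z g f = cmp C X R Z b (cmp C X Y R a f)" using R RO assms by simp
  then show ?thesis using factoringI[OF R(1) _ R(3), of "cmp C X Y R a f" X] R RO assms by simp
qed

lemma quot_eq_iff:
  "X \<in> Ob C \<Longrightarrow> Y \<in> Ob C \<Longrightarrow> f \<in> arr C X Y \<Longrightarrow> g \<in> arr C X Y \<Longrightarrow>
    quot_arr C \<P> X Y f = quot_arr C \<P> X Y g \<longleftrightarrow> f \<ominus>\<^bsub>Hom C X Y\<^esub> g \<in> factoring C \<P> X Y"
  unfolding quot_arr_def by (rule submodule_quotient.coset_eq_iff[OF submodule])

lemma quot_eq_zero_iff:
  "X \<in> Ob C \<Longrightarrow> Y \<in> Ob C \<Longrightarrow> f \<in> arr C X Y \<Longrightarrow>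
    quot_arr C \<P> X Y f = quot_arr C \<P> X Y \<zero>\<^bsub>Hom C X Y\<^esub> \<longleftrightarrow> f \<in> factoring C \<P> X Y"
  by (simp add: quot_eq_iff)

lemma quot_self: "X \<in> Ob C \<Longrightarrow> Y \<in> Ob C \<Longrightarrow> f \<in> arr C X Y \<Longrightarrow> f \<in> quot_arr C \<P> X Y f"
  unfolding quot_arr_def by (rule submodule_quotient.coset_self[OF submodule])

lemma quot_memD:
  assumes "X \<in> Ob C" "Y \<in> Ob C" "f \<in> arr C X Y" "g \<in> quot_arr C \<P> X Y f"
  shows "g \<in> arr C X Y" "quot_arr C \<P> X Y g = quot_arr C \<P> X Y f"
  using submodule_quotient.coset_memD[OF submodule[OF assms(1,2)] assms(3)] assms(4)
  unfolding quot_arr_def by auto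

lemma quot_mem_iff:
  assumes "X \<in> Ob C" "Y \<in> Ob C" "f \<in> arr C X Y"
  shows "g \<in> quot_arr C \<P> X Y f \<longleftrightarrow> g \<in> arr C X Y \<and> quot_arr C \<P> X Y g = quot_arr C \<P> X Y f"
  using quot_memD[OF assms] quot_self[OF assms(1,2), of g] by auto

lemma Ob_quot [simp]: "Ob (quot_cat C \<P>) = Ob C"
  by (simp add: quot_cat_def)

lemma ide_quot: "ide (quot_cat C \<P>) X = quot_arr C \<P> X X (ide C X)"
  by (simp add: quot_cat_def)

lemma arr_quot:
  "X \<in> Ob C \<Longrightarrow> Y \<in> Ob C \<Longrightarrow> arr (quot_cat C \<P>) X Y = quot_arr C \<P> X Y ` arr C X Y"
  using submodule_quotient.carrier_quot[OF submodule, of X Y]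
  by (simp add: quot_cat_def quot_arr_def)

lemma zero_quot:
  "X \<in> Ob C \<Longrightarrow> Y \<in> Ob C \<Longrightarrow> \<zero>\<^bsub>Hom (quot_cat C \<P>) X Y\<^esub> = quot_arr C \<P> X Y \<zero>\<^bsub>Hom C X Y\<^esub>"
  using submodule_quotient.zero_quot[OF submodule, of X Y]
  by (simp add: quot_cat_def quot_arr_def)

lemma add_quot:
  "X \<in> Ob C \<Longrightarrow> Y \<in> Ob C \<Longrightarrow> f \<in> arr C X Y \<Longrightarrow> g \<in> arr C X Y \<Longrightarrow>
    quot_arr C \<P> X Y f \<oplus>\<^bsub>Hom (quot_cat C \<P>) X Y\<^esub> quot_arr C \<P> X Y g
      = quot_arr C \<P> X Y (f \<oplus>\<^bsub>Hom C X Y\<^esub> g)"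
  using submodule_quotient.add_quot[OF submodule, of X Y f g]
  by (simp add: quot_cat_def quot_arr_def)

lemma smult_quot:
  "X \<in> Ob C \<Longrightarrow> Y \<in> Ob C \<Longrightarrow> k \<in> carrier K \<Longrightarrow> f \<in> arr C X Y \<Longrightarrow>
    k \<odot>\<^bsub>Hom (quot_cat C \<P>) X Y\<^esub> quot_arr C \<P> X Y f = quot_arr C \<P> X Y (k \<odot>\<^bsub>Hom C X Y\<^esub> f)"
  using submodule_quotient.smult_quot[OF submodule, of X Y k f]
  by (simp add: quot_cat_def quot_arr_def)

text \<open>One factor is changed at a time: the error terms are \<open>g'\<close> after
  \<open>f' - f\<close> and \<open>g' - g\<close> after \<open>f\<close>, both in the ideal.\<close>

lemma quot_cmp_cong:
  assumes "X \<in> Ob C" "Y \<in> Ob C" "Z \<in> Ob C"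
    and "f \<in> arr C X Y" "f' \<in> arr C X Y" "quot_arr C \<P> X Y f' = quot_arr C \<P> X Y f"
    and "g \<in> arr C Y Z" "g' \<in> arr C Y Z" "quot_arr C \<P> Y Z g' = quot_arr C \<P> Y Z g"
  shows "quot_arr C \<P> X Z (cmp C X Y Z g' f') = quot_arr C \<P> X Z (cmp C X Y Z g f)"
proof -
  have "cmp C X Y Z g' (f' \<ominus>\<^bsub>Hom C X Y\<^esub> f) \<in> factoring C \<P> X Z"
    by (rule factoring_cmp_left) (use assms quot_eq_iff[of X Y f' f] in simp_all)
  then have 1: "quot_arr C \<P> X Z (cmp C X Y Z g' f') = quot_arr C \<P> X Z (cmp C X Y Z g' f)"
    using assms by (simp add: quot_eq_iff)
  have "cmp C X Y Z (g' \<ominus>\<^bsub>Hom C Y Z\<^esub> g) f \<in> factoring C \<P> X Z"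
    by (rule factoring_cmp_right) (use assms quot_eq_iff[of Y Z g' g] in simp_all)
  then have "quot_arr C \<P> X Z (cmp C X Y Z g' f) = quot_arr C \<P> X Z (cmp C X Y Z g f)"
    using assms by (simp add: quot_eq_iff)
  with 1 show ?thesis by simp
qed

lemma cmp_quot:
  assumes "X \<in> Ob C" "Y \<in> Ob C" "Z \<in> Ob C" "f \<in> arr C X Y" "g \<in> arr C Y Z"
  shows "cmp (quot_cat C \<P>) X Y Z (quot_arr C \<P> Y Z g) (quot_arr C \<P> X Y f)
    = quot_arr C \<P> X Z (cmp C X Y Z g f)"
proof -
  have eq: "quot_arr C \<P> X Z (cmp C X Y Z g' f') = quot_arr C \<P> X Z (cmp C X Y Z g f)"
    if "g' \<in> quot_arr C \<P> Y Z g" "f' \<in> quot_arr C \<P> X Y f" for g' f'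
    using quot_memD[OF assms(2,3,5) that(1)] quot_memD[OF assms(1,2,4) that(2)] assms
    by (intro quot_cmp_cong)
  have "(\<Union>g'\<in>quot_arr C \<P> Y Z g. \<Union>f'\<in>quot_arr C \<P> X Y f. quot_arr C \<P> X Z (cmp C X Y Z g' f'))
    = quot_arr C \<P> X Z (cmp C X Y Z g f)"
    by (intro UN_constant_eq[OF quot_self[OF assms(2,3,5)]] UN_constant_eq[OF quot_self[OF assms(1,2,4)]] ballI eq)
  then show ?thesis by (simp add: quot_cat_def)
qed

lemma quot_arrE:
  assumes "X \<in> Ob C" "Y \<in> Ob C" "G \<in> arr (quot_cat C \<P>) X Y"
  obtains g where "g \<in> arr C X Y" "G = quot_arr C \<P> X Y g"
  using assms arr_quot by auto

lemma quot_arrI: "X \<in> Ob C \<Longrightarrow> Y \<in> Ob C \<Longrightarrow> f \<in> arr C X Y \<Longrightarrow>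
    quot_arr C \<P> X Y f \<in> arr (quot_cat C \<P>) X Y"
  by (simp add: arr_quot)

lemma hom_module_quot:
  assumes "X \<in> Ob C" "Y \<in> Ob C" shows "module K (Hom (quot_cat C \<P>) X Y)"
  using submodule_quotient.module_quot[OF submodule[OF assms]] by (simp add: quot_cat_def)

lemma linear_category_quot: "linear_category K (quot_cat C \<P>)"
  by (rule linear_category.intro)
    (auto simp: field_K hom_module_quot linear_map_def arr_quot cmp_quot add_quot smult_quot ide_quot)

lemma biproduct_quot:
  assumes "biproduct C X Y S i j p q"
  shows "biproduct (quot_cat C \<P>) X Y S (quot_arr C \<P> X S i) (quot_arr C \<P> Y S j)
    (quot_arr C \<P> S X p) (quot_arr C \<P> S Y q)"
  using assms by (simp add: biproduct_def quot_arrI cmp_quot ide_quot zero_quot add_quot)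

text \<open>Two squares commuting modulo the ideal are pasted along their common side
  \<open>u'\<close>. The statement is about representatives because it is applied to maps of
  conflations.\<close>

lemma quot_paste:
  assumes "X \<in> Ob C" "Y \<in> Ob C" "X' \<in> Ob C" "Y' \<in> Ob C" "X'' \<in> Ob C" "Y'' \<in> Ob C"
    and "u \<in> arr C X Y" "u' \<in> arr C X' Y'" "u'' \<in> arr C X'' Y''" "a \<in> arr C X X'" "a' \<in> arr C X' X''"
    and "b \<in> arr C Y Y'" "b' \<in> arr C Y' Y''"
    and sq: "quot_arr C \<P> X Y' (cmp C X Y Y' b u) = quot_arr C \<P> X Y' (cmp C X X' Y' u' a)"
    and sq': "quot_arr C \<P> X' Y'' (cmp C X' Y' Y'' b' u') = quot_arr C \<P> X' Y'' (cmp C X' X'' Y'' u'' a')"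
  shows "quot_arr C \<P> X Y'' (cmp C X Y Y'' (cmp C Y Y' Y'' b' b) u)
    = quot_arr C \<P> X Y'' (cmp C X X'' Y'' u'' (cmp C X X' X'' a' a))"
proof -
  have "quot_arr C \<P> X Y'' (cmp C X Y' Y'' b' (cmp C X Y Y' b u))
    = quot_arr C \<P> X Y'' (cmp C X Y' Y'' b' (cmp C X X' Y' u' a))"
    by (rule quot_cmp_cong) (use assms in simp_all)
  moreover have "quot_arr C \<P> X Y'' (cmp C X X' Y'' (cmp C X' Y' Y'' b' u') a)
    = quot_arr C \<P> X Y'' (cmp C X X' Y'' (cmp C X' X'' Y'' u'' a') a)"
    by (rule quot_cmp_cong[OF _ _ _ _ _ refl _ _ sq']) (use assms in simp_all)
  ultimately show ?thesis using assms by simp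
qed

text \<open>Transporting \<open>f\<close> to \<open>X'\<close> and \<open>Y'\<close> and back
  changes it only by the ideal when \<open>X\<close> and \<open>Y\<close> are retracts modulo the
  ideal; this undoes the detour in \<open>retract_fill\<close>.\<close>

lemma quot_retract:
  assumes "X \<in> Ob C" "Y \<in> Ob C" "X' \<in> Ob C" "Y' \<in> Ob C" "f \<in> arr C X Y"
    and "a \<in> arr C X X'" "a' \<in> arr C X' X" "b \<in> arr C Y Y'" "b' \<in> arr C Y' Y"
    and r: "quot_arr C \<P> X X (cmp C X X' X a' a) = quot_arr C \<P> X X (ide C X)"
    and s: "quot_arr C \<P> Y Y (cmp C Y Y' Y b' b) = quot_arr C \<P> Y Y (ide C Y)"
  shows "quot_arr C \<P> X Y (cmp C X Y' Y b' (cmp C X X' Y' (cmp C X' Y Y' b (cmp C X' X Y f a')) a))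
    = quot_arr C \<P> X Y f"
proof -
  have "quot_arr C \<P> X Y (cmp C X X Y f (cmp C X X' X a' a)) = quot_arr C \<P> X Y (cmp C X X Y f (ide C X))"
    by (rule quot_cmp_cong) (use assms in simp_all)
  moreover have "quot_arr C \<P> X Y (cmp C X Y Y (cmp C Y Y' Y b' b) (cmp C X X Y f (cmp C X X' X a' a)))
    = quot_arr C \<P> X Y (cmp C X Y Y (ide C Y) (cmp C X X Y f (cmp C X X' X a' a)))"
    by (rule quot_cmp_cong) (use assms in simp_all)
  ultimately show ?thesis using assms by simp
qed

end

text \<open>The arrows of a quotient ignore the set of objects and further fields of the record, so
  full subcategories share them with the ambient category.\<close>

lemma factoring_cong: "Hom D = Hom C \<Longrightarrow> cmp D = cmp C \<Longrightarrow> factoring D \<P> = factoring C \<P>"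
  by (simp add: factoring_def fun_eq_iff)

lemma quot_arr_cong: "Hom D = Hom C \<Longrightarrow> cmp D = cmp C \<Longrightarrow> quot_arr D \<P> = quot_arr C \<P>"
  by (simp add: quot_arr_def factoring_cong[of D C] fun_eq_iff)

lemma quot_cat_cong:
  assumes "Hom D = Hom C" "cmp D = cmp C" "ide D = ide C"
  shows "Hom (quot_cat D \<P>) = Hom (quot_cat C \<P>)" "cmp (quot_cat D \<P>) = cmp (quot_cat C \<P>)"
    "ide (quot_cat D \<P>) = ide (quot_cat C \<P>)"
  using assms factoring_cong[of D C] quot_arr_cong[of D C] by (simp_all add: quot_cat_def)

lemma biproduct_cong:
  "Ob D = Ob C \<Longrightarrow> Hom D = Hom C \<Longrightarrow> cmp D = cmp C \<Longrightarrow> ide D = ide C \<Longrightarrow>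
    biproduct D X Y S i j p q = biproduct C X Y S i j p q"
  by (simp add: biproduct_def)

section \<open>Exact sequences in extriangulated categories\<close>

context extriangulated
begin

lemma ext_group: "Z \<in> Ob E \<Longrightarrow> A \<in> Ob E \<Longrightarrow> abelian_group (Ext E Z A)"
  by (rule module_abelian_group[OF ext_module])

lemma ext_map_closed [simp]:
  "\<lbrakk>Z \<in> Ob E; A \<in> Ob E; Z' \<in> Ob E; A' \<in> Ob E; c \<in> arr E Z' Z; a \<in> arr E A A'; \<delta> \<in> carrier (Ext E Z A)\<rbrakk>
    \<Longrightarrow> ext_map E Z A Z' A' c a \<delta> \<in> carrier (Ext E Z' A')"
  by (rule linear_map_closed[OF ext_map_linear])

lemma ext_map_comp [simp]:
  "\<lbrakk>Z \<in> Ob E; A \<in> Ob E; Z' \<in> Ob E; A' \<in> Ob E; Z'' \<in> Ob E; A'' \<in> Ob E;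
    c \<in> arr E Z' Z; a \<in> arr E A A'; c' \<in> arr E Z'' Z'; a' \<in> arr E A' A''; \<delta> \<in> carrier (Ext E Z A)\<rbrakk>
    \<Longrightarrow> ext_map E Z' A' Z'' A'' c' a' (ext_map E Z A Z' A' c a \<delta>) =
        ext_map E Z A Z'' A'' (cmp E Z'' Z' Z c c') (cmp E A A' A'' a' a) \<delta>"
  by (rule ext_map_cmp[symmetric])

lemma ext_zero_closed [simp]: "\<lbrakk>Z \<in> Ob E; A \<in> Ob E\<rbrakk> \<Longrightarrow> \<zero>\<^bsub>Ext E Z A\<^esub> \<in> carrier (Ext E Z A)"
  by (rule abelian_group.axioms(1)[OF ext_group, THEN abelian_monoid.zero_closed])

lemma ext_add_zero [simp]:
  assumes "Z \<in> Ob E" "A \<in> Ob E"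
  shows "\<zero>\<^bsub>Ext E Z A\<^esub> \<oplus>\<^bsub>Ext E Z A\<^esub> \<zero>\<^bsub>Ext E Z A\<^esub> = \<zero>\<^bsub>Ext E Z A\<^esub>"
proof -
  interpret abelian_group "Ext E Z A" using assms by (intro ext_group)
  show ?thesis by simp
qed

declare ext_map_ide [simp]

lemma ext_map_zero [simp]:
  "\<lbrakk>Z \<in> Ob E; A \<in> Ob E; Z' \<in> Ob E; A' \<in> Ob E; c \<in> arr E Z' Z; a \<in> arr E A A'\<rbrakk>
    \<Longrightarrow> ext_map E Z A Z' A' c a \<zero>\<^bsub>Ext E Z A\<^esub> = \<zero>\<^bsub>Ext E Z' A'\<^esub>"
  by (rule linear_map_zero[OF ext_map_linear ext_module ext_module])

lemma ext_map_contra_zero [simp]: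
  "\<lbrakk>Z \<in> Ob E; A \<in> Ob E; Z' \<in> Ob E; A' \<in> Ob E; a \<in> arr E A A'; \<delta> \<in> carrier (Ext E Z A)\<rbrakk>
    \<Longrightarrow> ext_map E Z A Z' A' \<zero>\<^bsub>Hom E Z' Z\<^esub> a \<delta> = \<zero>\<^bsub>Ext E Z' A'\<^esub>"
  by (rule linear_map_zero[OF ext_map_linear_contra hom_module ext_module])

lemma ext_map_co_zero [simp]:
  "\<lbrakk>Z \<in> Ob E; A \<in> Ob E; Z' \<in> Ob E; A' \<in> Ob E; c \<in> arr E Z' Z; \<delta> \<in> carrier (Ext E Z A)\<rbrakk>
    \<Longrightarrow> ext_map E Z A Z' A' c \<zero>\<^bsub>Hom E A A'\<^esub> \<delta> = \<zero>\<^bsub>Ext E Z' A'\<^esub>"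
  by (rule linear_map_zero[OF ext_map_linear_co hom_module ext_module])

lemma ext_map_contra_add:
  "\<lbrakk>Z \<in> Ob E; A \<in> Ob E; Z' \<in> Ob E; A' \<in> Ob E; c \<in> arr E Z' Z; c' \<in> arr E Z' Z; a \<in> arr E A A';
    \<delta> \<in> carrier (Ext E Z A)\<rbrakk>
    \<Longrightarrow> ext_map E Z A Z' A' (c \<oplus>\<^bsub>Hom E Z' Z\<^esub> c') a \<delta>
      = ext_map E Z A Z' A' c a \<delta> \<oplus>\<^bsub>Ext E Z' A'\<^esub> ext_map E Z A Z' A' c' a \<delta>"
  by (rule linear_map_add[OF ext_map_linear_contra])

lemma ext_map_co_add:
  "\<lbrakk>Z \<in> Ob E; A \<in> Ob E; Z' \<in> Ob E; A' \<in> Ob E; c \<in> arr E Z' Z; a \<in> arr E A A'; a' \<in> arr E A A';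
    \<delta> \<in> carrier (Ext E Z A)\<rbrakk>
    \<Longrightarrow> ext_map E Z A Z' A' c (a \<oplus>\<^bsub>Hom E A A'\<^esub> a') \<delta>
      = ext_map E Z A Z' A' c a \<delta> \<oplus>\<^bsub>Ext E Z' A'\<^esub> ext_map E Z A Z' A' c a' \<delta>"
  by (rule linear_map_add[OF ext_map_linear_co])

lemma ext_map_contra_eq_iff:
  assumes "Z \<in> Ob E" "A \<in> Ob E" "Z' \<in> Ob E" "A' \<in> Ob E" "c \<in> arr E Z' Z" "c' \<in> arr E Z' Z"
    "a \<in> arr E A A'" "\<delta> \<in> carrier (Ext E Z A)"
  shows "ext_map E Z A Z' A' c a \<delta> = ext_map E Z A Z' A' c' a \<delta> \<longleftrightarrow>
    ext_map E Z A Z' A' (c \<ominus>\<^bsub>Hom E Z' Z\<^esub> c') a \<delta> = \<zero>\<^bsub>Ext E Z' A'\<^esub>"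
proof -
  interpret abelian_group "Ext E Z' A'" using assms by (intro ext_group)
  have "ext_map E Z A Z' A' (c \<ominus>\<^bsub>Hom E Z' Z\<^esub> c') a \<delta>
    = ext_map E Z A Z' A' c a \<delta> \<ominus>\<^bsub>Ext E Z' A'\<^esub> ext_map E Z A Z' A' c' a \<delta>"
    using assms by (intro linear_map_minus[OF ext_map_linear_contra hom_module ext_module])
  then show ?thesis using minus_zero_iff assms by simp
qed

lemma ext_map_co_eq_iff:
  assumes "Z \<in> Ob E" "A \<in> Ob E" "Z' \<in> Ob E" "A' \<in> Ob E" "c \<in> arr E Z' Z" "a \<in> arr E A A'"
    "a' \<in> arr E A A'" "\<delta> \<in> carrier (Ext E Z A)"
  shows "ext_map E Z A Z' A' c a \<delta> = ext_map E Z A Z' A' c a' \<delta> \<longleftrightarrow>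
    ext_map E Z A Z' A' c (a \<ominus>\<^bsub>Hom E A A'\<^esub> a') \<delta> = \<zero>\<^bsub>Ext E Z' A'\<^esub>"
proof -
  interpret abelian_group "Ext E Z' A'" using assms by (intro ext_group)
  have "ext_map E Z A Z' A' c (a \<ominus>\<^bsub>Hom E A A'\<^esub> a') \<delta>
    = ext_map E Z A Z' A' c a \<delta> \<ominus>\<^bsub>Ext E Z' A'\<^esub> ext_map E Z A Z' A' c a' \<delta>"
    using assms by (intro linear_map_minus[OF ext_map_linear_co hom_module ext_module])
  then show ?thesis using minus_zero_iff assms by simp
qed

text \<open>The middle object and the two arrows are not typed in \<open>conflations\<close>, but
  every member of a realisation is equivalent to a genuine sequence, and that equivalence records
  the typing.\<close>

lemma conflation_arr:
  assumes "(A,B,Z,x,y,\<delta>) \<in> conflations E"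
  shows "A \<in> Ob E" "B \<in> Ob E" "Z \<in> Ob E" "x \<in> arr E A B" "y \<in> arr E B Z" "\<delta> \<in> carrier (Ext E Z A)"
proof -
  show 1: "A \<in> Ob E" "Z \<in> Ob E" "\<delta> \<in> carrier (Ext E Z A)" using assms by (auto simp: conflations_def)
  obtain B' x' y' where "rlz E Z A \<delta> = {s. equiv_seq E A Z (B',x',y') s}"
    using rlz_class[OF 1(2,1,3)] by blast
  then have "equiv_seq E A Z (B',x',y') (B,x,y)" using assms by (auto simp: conflations_def)
  then show "B \<in> Ob E" "x \<in> arr E A B" "y \<in> arr E B Z" by (auto simp: equiv_seq_def iso_arr_def)
qed

lemma conflation_exists:
  assumes "Z \<in> Ob E" "A \<in> Ob E" "\<delta> \<in> carrier (Ext E Z A)"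
  obtains B x y where "(A,B,Z,x,y,\<delta>) \<in> conflations E"
proof -
  obtain B x y where B: "B \<in> Ob E" "x \<in> arr E A B" "y \<in> arr E B Z"
    and r: "rlz E Z A \<delta> = {s. equiv_seq E A Z (B,x,y) s}"
    using rlz_class[OF assms] by blast
  have "iso_arr E B B (ide E B)" unfolding iso_arr_def using B by force
  then have "equiv_seq E A Z (B,x,y) (B,x,y)"
    using B assms by (auto simp: equiv_seq_def intro!: exI[of _ "ide E B"])
  then have "(A,B,Z,x,y,\<delta>) \<in> conflations E" using r assms by (auto simp: conflations_def)
  then show thesis by (rule that)
qed

text \<open>The split sequence with zero cokernel. It lets (ET3) and sums of conflations act on
  identities.\<close>

lemma conflation_ide_left:
  assumes "A \<in> Ob E" "zero_object E N"
  shows "(A,A,N,ide E A,\<zero>\<^bsub>Hom E A N\<^esub>,\<zero>\<^bsub>Ext E N A\<^esub>) \<in> conflations E"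
proof (rule rlz_zero)
  have N: "N \<in> Ob E" "arr E N N = {\<zero>\<^bsub>Hom E N N\<^esub>}" using assms by (auto simp: zero_object_def)
  have "ide E N = \<zero>\<^bsub>Hom E N N\<^esub>" using N ide_arr[OF N(1)] by simp
  then show "biproduct E A N A (ide E A) \<zero>\<^bsub>Hom E N A\<^esub> (ide E A) \<zero>\<^bsub>Hom E A N\<^esub>"
    using N(1) assms by (simp add: biproduct_def)
qed

lemma conflation_ide_right:
  assumes "A \<in> Ob E" "zero_object E N"
  shows "(N,A,A,\<zero>\<^bsub>Hom E N A\<^esub>,ide E A,\<zero>\<^bsub>Ext E A N\<^esub>) \<in> conflations E"
proof (rule rlz_zero)
  have N: "N \<in> Ob E" "arr E N N = {\<zero>\<^bsub>Hom E N N\<^esub>}" using assms by (auto simp: zero_object_def)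
  have "ide E N = \<zero>\<^bsub>Hom E N N\<^esub>" using N ide_arr[OF N(1)] by simp
  then show "biproduct E N A A \<zero>\<^bsub>Hom E N A\<^esub> (ide E A) \<zero>\<^bsub>Hom E A N\<^esub> (ide E A)"
    using N(1) assms by (simp add: biproduct_def)
qed

section \<open>Exactness of a conflation in both arguments of \<open>Ext\<close>\<close>

context
  fixes A B Z x y \<delta>
  assumes cf: "(A,B,Z,x,y,\<delta>) \<in> conflations E"
begin

lemmas cf_arr = conflation_arr[OF cf]

text \<open>(ET3) completes the square formed by \<open>x\<close> and the identity of
  \<open>B\<close> to a morphism into the split conflation with zero cokernel; compatibility with
  extensions equates the push-out of \<open>\<delta>\<close> with a pull-back of zero.\<close>

lemma push_inflation: "push E Z A B x \<delta> = \<zero>\<^bsub>Ext E Z B\<^esub>"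
proof -
  obtain N where N: "zero_object E N" using ex_zero_object by blast
  then have NO: "N \<in> Ob E" by (simp add: zero_object_def)
  obtain c where c: "confl_morphism E (A,B,Z,x,y,\<delta>)
      (B,B,N,ide E B,\<zero>\<^bsub>Hom E B N\<^esub>,\<zero>\<^bsub>Ext E N B\<^esub>) x (ide E B) c"
    using ET3[OF cf conflation_ide_left[OF cf_arr(2) N], of x "ide E B"] cf_arr by auto
  then show ?thesis using cf_arr NO by auto
qed

lemma pull_deflation: "pull E Z B A y \<delta> = \<zero>\<^bsub>Ext E B A\<^esub>"
proof -
  obtain N where N: "zero_object E N" using ex_zero_object by blast
  then have NO: "N \<in> Ob E" by (simp add: zero_object_def)
  obtain a where a: "confl_morphism E (N,B,B,\<zero>\<^bsub>Hom E N B\<^esub>,ide E B,\<zero>\<^bsub>Ext E B N\<^esub>)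
      (A,B,Z,x,y,\<delta>) a (ide E B) y"
    using ET3_op[OF conflation_ide_right[OF cf_arr(2) N] cf, of "ide E B" y] cf_arr by auto
  then show ?thesis using cf_arr NO by auto
qed

text \<open>Since the pull-back of \<open>\<delta>\<close> along \<open>c\<close> vanishes, the
  identity of \<open>A\<close> and \<open>c\<close> belong to a morphism from the split conflation;
  its middle map, restricted to the summand \<open>M\<close>, is the lift.\<close>

lemma deflation_lift:
  assumes "M \<in> Ob E" "c \<in> arr E M Z" "pull E Z M A c \<delta> = \<zero>\<^bsub>Ext E M A\<^esub>"
  obtains b where "b \<in> arr E M B" "cmp E M B Z y b = c"
proof -
  obtain S i j p q where S: "biproduct E A M S i j p q" using ex_biproduct cf_arr assms by blast
  then have t: "S \<in> Ob E" "j \<in> arr E M S" "q \<in> arr E S M" "cmp E M S M q j = ide E M"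
    by (auto simp: biproduct_def)
  obtain b where b: "confl_morphism E (A,S,M,i,q,\<zero>\<^bsub>Ext E M A\<^esub>) (A,B,Z,x,y,\<delta>) (ide E A) b c"
    using rlz_morphism[OF rlz_zero[OF S] cf, of "ide E A" c] cf_arr assms by auto
  then have b': "b \<in> arr E S B" "cmp E S B Z y b = cmp E S M Z c q" by auto
  have "cmp E M B Z y (cmp E M S B b j) = c"
    using cmp_assoc[of M S B Z j b y] b' t cf_arr assms by simp
  then show thesis using that[of "cmp E M S B b j"] b' t cf_arr assms by simp
qed

lemma inflation_extend:
  assumes "M \<in> Ob E" "a \<in> arr E A M" "push E Z A M a \<delta> = \<zero>\<^bsub>Ext E Z M\<^esub>"
  obtains b where "b \<in> arr E B M" "cmp E A B M b x = a"
proof -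
  obtain S i j p q where S: "biproduct E M Z S i j p q" using ex_biproduct cf_arr assms by blast
  then have t: "S \<in> Ob E" "i \<in> arr E M S" "p \<in> arr E S M" "cmp E M S M p i = ide E M"
    by (auto simp: biproduct_def)
  obtain b where b: "confl_morphism E (A,B,Z,x,y,\<delta>) (M,S,Z,i,q,\<zero>\<^bsub>Ext E Z M\<^esub>) a b (ide E Z)"
    using rlz_morphism[OF cf rlz_zero[OF S], of a "ide E Z"] cf_arr assms by auto
  then have b': "b \<in> arr E B S" "cmp E A B S b x = cmp E A M S i a" by auto
  have "cmp E A B M (cmp E B S M p b) x = a"
    using cmp_assoc[of A M S M a i p] b' t cf_arr assms by simp
  then show thesis using that[of "cmp E B S M p b"] b' t cf_arr assms by simp
qed

text \<open>Realise \<open>\<epsilon>\<close> itself. Its push-out along \<open>x\<close> vanishes,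
  so \<open>x\<close> extends over the middle term, and (ET3) yields a third map \<open>c\<close>
  whose compatibility with extensions is the claim.\<close>

lemma ext_from_pull:
  assumes "M \<in> Ob E" "\<epsilon> \<in> carrier (Ext E M A)" "push E M A B x \<epsilon> = \<zero>\<^bsub>Ext E M B\<^esub>"
  obtains c where "c \<in> arr E M Z" "\<epsilon> = pull E Z M A c \<delta>"
proof -
  obtain R f e where cf': "(A,R,M,f,e,\<epsilon>) \<in> conflations E"
    using conflation_exists[OF assms(1) cf_arr(1) assms(2)] .
  note t = conflation_arr[OF cf']
  obtain g where g: "g \<in> arr E R B" "cmp E A R B g f = x"
    using extriangulated.inflation_extend[OF extriangulated_axioms cf' cf_arr(2,4) assms(3)] .
  obtain c where "confl_morphism E (A,R,M,f,e,\<epsilon>) (A,B,Z,x,y,\<delta>) (ide E A) g c"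
    using ET3[OF cf' cf, of "ide E A" g] g t cf_arr by auto
  then show thesis using that t by auto
qed

lemma ext_from_push:
  assumes "M \<in> Ob E" "\<epsilon> \<in> carrier (Ext E Z M)" "pull E Z B M y \<epsilon> = \<zero>\<^bsub>Ext E B M\<^esub>"
  obtains a where "a \<in> arr E A M" "\<epsilon> = push E Z A M a \<delta>"
proof -
  obtain R f e where cf': "(M,R,Z,f,e,\<epsilon>) \<in> conflations E"
    using conflation_exists[OF cf_arr(3) assms(1) assms(2)] .
  note t = conflation_arr[OF cf']
  obtain g where g: "g \<in> arr E B R" "cmp E B R Z e g = y"
    using extriangulated.deflation_lift[OF extriangulated_axioms cf' cf_arr(2,5) assms(3)] .
  obtain a where "confl_morphism E (A,B,Z,x,y,\<delta>) (M,R,Z,f,e,\<epsilon>) a g (ide E Z)"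
    using ET3_op[OF cf cf', of g "ide E Z"] g t cf_arr by auto
  then show thesis using that t by auto
qed

text \<open>The map \<open>(f, x) : A \<rightarrow> X \<oplus> B\<close> is the composite of the split inflation
  \<open>(f, 1) : A \<rightarrow> X \<oplus> A\<close> with \<open>1 \<oplus> x : X \<oplus> A \<rightarrow> X \<oplus> B\<close>, so (ET4) applies.\<close>

lemma inflation_pair:
  assumes X: "X \<in> Ob E" and f: "f \<in> arr E A X" and T: "biproduct E X B T i j p q"
  shows "\<exists>G h' \<epsilon>. (A, T, G, cmp E A X T i f \<oplus>\<^bsub>Hom E A T\<^esub> cmp E A B T j x, h', \<epsilon>) \<in> conflations E"
proof -
  obtain S i' j' p' q' where S: "biproduct E X A S i' j' p' q'" using ex_biproduct X cf_arr by blast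
  have s: "S \<in> Ob E" "i' \<in> arr E X S" "j' \<in> arr E A S" "p' \<in> arr E S X" "q' \<in> arr E S A"
     "cmp E X S X p' i' = ide E X" "cmp E A S A q' j' = ide E A"
     "cmp E A S X p' j' = \<zero>\<^bsub>Hom E A X\<^esub>" "cmp E X S A q' i' = \<zero>\<^bsub>Hom E X A\<^esub>"
     "cmp E S X S i' p' \<oplus>\<^bsub>Hom E S S\<^esub> cmp E S A S j' q' = ide E S"
    using S by (simp_all add: biproduct_def)
  have t: "T \<in> Ob E" "i \<in> arr E X T" "j \<in> arr E B T" using T by (auto simp: biproduct_def)
  \<comment> \<open>A shear of the biproduct: \<open>?u\<close> has components \<open>f\<close> and
    the identity, and \<open>?v\<close> is the matching projection, which kills
    \<open>?u\<close>.\<close>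
  let ?u = "cmp E A X S i' f \<oplus>\<^bsub>Hom E A S\<^esub> j'"
  let ?v = "p' \<ominus>\<^bsub>Hom E S X\<^esub> cmp E S A X f q'"
  have u: "cmp E A S X p' (cmp E A X S i' f) = f" "cmp E A S A q' (cmp E A X S i' f) = \<zero>\<^bsub>Hom E A A\<^esub>"
    using s X f cf_arr cmp_assoc[of A X S X f i' p'] cmp_assoc[of A X S A f i' q'] by auto
  have HAX: "abelian_group (Hom E A X)" and HXX: "abelian_group (Hom E X X)"
    and HSS: "abelian_group (Hom E S S)"
    using X s cf_arr by (auto intro: hom_group)
  have "biproduct E A X S ?u i' q' ?v"
    unfolding biproduct_def
  proof (intro conjI)
    show "cmp E A S A q' ?u = ide E A" using s X f cf_arr u by simp
    show "cmp E X S X ?v i' = ide E X" using s X f cf_arr by simp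
    show "cmp E X S A q' i' = \<zero>\<^bsub>Hom E X A\<^esub>" using s by simp
    show "cmp E A S X ?v ?u = \<zero>\<^bsub>Hom E A X\<^esub>" using s X f cf_arr u by simp
    interpret SS: abelian_group "Hom E S S" by (rule HSS)
    let ?w = "cmp E S A S (cmp E A X S i' f) q'"
    have "cmp E S A S ?u q' \<oplus>\<^bsub>Hom E S S\<^esub> cmp E S X S i' ?v
      = (?w \<oplus>\<^bsub>Hom E S S\<^esub> cmp E S A S j' q') \<oplus>\<^bsub>Hom E S S\<^esub> (cmp E S X S i' p' \<ominus>\<^bsub>Hom E S S\<^esub> ?w)"
      using s X f cf_arr by simp
    also have "\<dots> = cmp E S X S i' p' \<oplus>\<^bsub>Hom E S S\<^esub> cmp E S A S j' q'"
    proof -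
      have "cmp E S A S j' q' \<in> arr E S S" "?w \<in> arr E S S" "cmp E S X S i' p' \<in> arr E S S"
        using s X f cf_arr by simp_all
      then show ?thesis by (simp add: SS.minus_eq SS.a_ac SS.r_neg SS.r_neg1 SS.r_neg2)
    qed
    finally show "cmp E S A S ?u q' \<oplus>\<^bsub>Hom E S S\<^esub> cmp E S X S i' ?v = ide E S" using s by simp
  qed (use s X f cf_arr in simp_all)
  from rlz_zero[OF this] have c1: "(A,S,X,?u,?v,\<zero>\<^bsub>Ext E X A\<^esub>) \<in> conflations E" .
  obtain N where N: "zero_object E N" using ex_zero_object by blast
  then have NO: "N \<in> Ob E" by (simp add: zero_object_def)
  obtain R k l m n where R: "biproduct E N Z R k l m n" using ex_biproduct NO cf_arr by blast
  have hs: "sum_arr E X A S X B T p' q' i j (ide E X) x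
    = cmp E S X T i p' \<oplus>\<^bsub>Hom E S T\<^esub> cmp E S B T j (cmp E S A B x q')"
    unfolding sum_arr_def using s X by simp
  obtain v' \<epsilon>' where c2: "(S,T,R,cmp E S X T i p' \<oplus>\<^bsub>Hom E S T\<^esub> cmp E S B T j (cmp E S A B x q'), v', \<epsilon>')
      \<in> conflations E"
    using rlz_sum[OF conflation_ide_left[OF X N] cf S T R] unfolding hs by blast
  have "cmp E A S T (cmp E S X T i p' \<oplus>\<^bsub>Hom E S T\<^esub> cmp E S B T j (cmp E S A B x q')) ?u
    = cmp E A X T i f \<oplus>\<^bsub>Hom E A T\<^esub> cmp E A B T j x"
    using s X f t cf_arr u by simp
  then show ?thesis using ET4[OF c1 c2] by metis
qed

end

section \<open>Vanishing extension groups\<close>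

definition orthogonal :: "'o \<Rightarrow> 'o \<Rightarrow> bool" where
  "orthogonal M N \<longleftrightarrow> (\<forall>\<epsilon>\<in>carrier (Ext E M N). \<epsilon> = \<zero>\<^bsub>Ext E M N\<^esub>)"

lemma orthogonalD: "orthogonal M N \<Longrightarrow> \<epsilon> \<in> carrier (Ext E M N) \<Longrightarrow> \<epsilon> = \<zero>\<^bsub>Ext E M N\<^esub>"
  unfolding orthogonal_def by blast

lemma carrier_ext_zero_iff:
  "M \<in> Ob E \<Longrightarrow> N \<in> Ob E \<Longrightarrow> carrier (Ext E M N) = {\<zero>\<^bsub>Ext E M N\<^esub>} \<longleftrightarrow> orthogonal M N"
  unfolding orthogonal_def using ext_zero_closed by blast

lemma orthogonal_retract_right:
  assumes "M \<in> Ob E" "P \<in> Ob E" "S \<in> Ob E" "s \<in> arr E P S" "r \<in> arr E S P" "cmp E P S P r s = ide E P"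
    "orthogonal M S"
  shows "orthogonal M P"
  unfolding orthogonal_def
proof
  fix \<epsilon> assume e: "\<epsilon> \<in> carrier (Ext E M P)"
  have "push E M P S s \<epsilon> = \<zero>\<^bsub>Ext E M S\<^esub>" using orthogonalD[OF assms(7)] assms e by simp
  then have "push E M S P r (push E M P S s \<epsilon>) = \<zero>\<^bsub>Ext E M P\<^esub>" using assms by simp
  then show "\<epsilon> = \<zero>\<^bsub>Ext E M P\<^esub>" using assms e by simp
qed

lemma orthogonal_retract_left:
  assumes "M \<in> Ob E" "P \<in> Ob E" "S \<in> Ob E" "s \<in> arr E P S" "r \<in> arr E S P" "cmp E P S P r s = ide E P"
    "orthogonal S M"
  shows "orthogonal P M"
  unfolding orthogonal_def
proof
  fix \<epsilon> assume e: "\<epsilon> \<in> carrier (Ext E P M)"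
  have "pull E P S M r \<epsilon> = \<zero>\<^bsub>Ext E S M\<^esub>" using orthogonalD[OF assms(7)] assms e by simp
  then have "pull E S P M s (pull E P S M r \<epsilon>) = \<zero>\<^bsub>Ext E P M\<^esub>" using assms by simp
  then show "\<epsilon> = \<zero>\<^bsub>Ext E P M\<^esub>" using assms e by simp
qed

text \<open>The identity of \<open>S\<close> is a sum of maps through \<open>X\<close> and
  \<open>Y\<close>, and \<open>Ext\<close> is additive in maps.\<close>

lemma orthogonal_biproduct:
  assumes S: "biproduct E X Y S i j p q" and M: "M \<in> Ob E"
  shows "orthogonal M X \<Longrightarrow> orthogonal M Y \<Longrightarrow> orthogonal M S"
    and "orthogonal X M \<Longrightarrow> orthogonal Y M \<Longrightarrow> orthogonal S M"
proof -
  have b: "X \<in> Ob E" "Y \<in> Ob E" "S \<in> Ob E" "i \<in> arr E X S" "j \<in> arr E Y S" "p \<in> arr E S X" "q \<in> arr E S Y"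
    and id: "cmp E S X S i p \<oplus>\<^bsub>Hom E S S\<^esub> cmp E S Y S j q = ide E S"
    using S by (auto simp: biproduct_def)
  show "orthogonal M S" if "orthogonal M X" "orthogonal M Y"
    unfolding orthogonal_def
  proof
    fix \<epsilon> assume e: "\<epsilon> \<in> carrier (Ext E M S)"
    have "push E M S X p \<epsilon> = \<zero>\<^bsub>Ext E M X\<^esub>" "push E M S Y q \<epsilon> = \<zero>\<^bsub>Ext E M Y\<^esub>"
      using that orthogonalD b M e by simp_all
    then have "push E M X S i (push E M S X p \<epsilon>) = \<zero>\<^bsub>Ext E M S\<^esub>"
      "push E M Y S j (push E M S Y q \<epsilon>) = \<zero>\<^bsub>Ext E M S\<^esub>" using b M by simp_all
    then have "push E M S S (cmp E S X S i p \<oplus>\<^bsub>Hom E S S\<^esub> cmp E S Y S j q) \<epsilon> = \<zero>\<^bsub>Ext E M S\<^esub>"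
      using b M e by (simp add: ext_map_co_add)
    then show "\<epsilon> = \<zero>\<^bsub>Ext E M S\<^esub>" unfolding id using b M e by simp
  qed
  show "orthogonal S M" if "orthogonal X M" "orthogonal Y M"
    unfolding orthogonal_def
  proof
    fix \<epsilon> assume e: "\<epsilon> \<in> carrier (Ext E S M)"
    have "pull E S X M i \<epsilon> = \<zero>\<^bsub>Ext E X M\<^esub>" "pull E S Y M j \<epsilon> = \<zero>\<^bsub>Ext E Y M\<^esub>"
      using that orthogonalD b M e by simp_all
    then have "pull E X S M p (pull E S X M i \<epsilon>) = \<zero>\<^bsub>Ext E S M\<^esub>"
      "pull E Y S M q (pull E S Y M j \<epsilon>) = \<zero>\<^bsub>Ext E S M\<^esub>" using b M by simp_all
    then have "pull E S S M (cmp E S X S i p \<oplus>\<^bsub>Hom E S S\<^esub> cmp E S Y S j q) \<epsilon> = \<zero>\<^bsub>Ext E S M\<^esub>"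
      using b M e by (simp add: ext_map_contra_add)
    then show "\<epsilon> = \<zero>\<^bsub>Ext E S M\<^esub>" unfolding id using b M e by simp
  qed
qed

text \<open>A conflation starting in an injective splits: pushing along \<open>x\<close> and then
  along the retraction returns \<open>\<epsilon>\<close>, while the first push already gives
  zero.\<close>

lemma orthogonal_injective:
  assumes P: "injective E P" and M: "M \<in> Ob E"
  shows "orthogonal M P"
  unfolding orthogonal_def
proof
  fix \<epsilon> assume e: "\<epsilon> \<in> carrier (Ext E M P)"
  have PO: "P \<in> Ob E" using P by (simp add: injective_def)
  obtain B x y where c: "(P,B,M,x,y,\<epsilon>) \<in> conflations E" using conflation_exists[OF M PO e] .
  note t = conflation_arr[OF c]
  obtain r where r: "r \<in> arr E B P" "cmp E P B P r x = ide E P"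
    using P c ide_arr[OF PO] unfolding injective_def by blast
  have "push E M B P r (push E M P B x \<epsilon>) = \<zero>\<^bsub>Ext E M P\<^esub>"
    unfolding push_inflation[OF c] using t r by simp
  then show "\<epsilon> = \<zero>\<^bsub>Ext E M P\<^esub>" using t r by simp
qed

lemma orthogonal_projective:
  assumes P: "projective E P" and M: "M \<in> Ob E"
  shows "orthogonal P M"
  unfolding orthogonal_def
proof
  fix \<epsilon> assume e: "\<epsilon> \<in> carrier (Ext E P M)"
  have PO: "P \<in> Ob E" using P by (simp add: projective_def)
  obtain B x y where c: "(M,B,P,x,y,\<epsilon>) \<in> conflations E" using conflation_exists[OF PO M e] .
  note t = conflation_arr[OF c]
  obtain r where r: "r \<in> arr E P B" "cmp E P B P y r = ide E P"
    using P c ide_arr[OF PO] unfolding projective_def by blast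
  have "pull E B P M r (pull E P B M y \<epsilon>) = \<zero>\<^bsub>Ext E P M\<^esub>"
    unfolding pull_deflation[OF c] using t r by simp
  then show "\<epsilon> = \<zero>\<^bsub>Ext E P M\<^esub>" using t r by simp
qed

end

section \<open>Stable categories of full subcategories\<close>

text \<open>The universal extension: when stable maps into the suspension are identified with
  extensions, it belongs to the identity.\<close>

definition susp_ext :: "('k,'o,'m,'e) excat \<Rightarrow> 'o \<Rightarrow> 'e" where
  "susp_ext E X = (case susp_confl E X of (_,_,_,_,_,\<sigma>) \<Rightarrow> \<sigma>)"

text \<open>\<open>E\<close> restricts the objects of \<open>F\<close> and shares hom-spaces and the
  action on extensions, so both instances, \<open>F\<close> itself and the perpendicular
  subcategory, compute inside \<open>F\<close>. The two vanishing assumptions test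
  projective-injectives against objects of \<open>E\<close> alone; against other objects of
  \<open>F\<close> they may fail in the second instance.\<close>

locale stable_subcategory = extriangulated K F
  for K :: "('k,'r) ring_scheme" and F :: "('k,'o,'m,'e) excat" +
  fixes E :: "('k,'o,'m,'e) excat"
  assumes sub_Ob: "Ob E \<subseteq> Ob F" and sub_nonempty: "Ob E \<noteq> {}"
    and sub_Hom: "Hom E = Hom F" and sub_cmp: "cmp E = cmp F" and sub_ide: "ide E = ide F"
    and sub_ext_map: "ext_map E = ext_map F"
    and sub_conflations: "(A,B,Z,x,y,\<delta>) \<in> conflations E \<longleftrightarrow>
      (A,B,Z,x,y,\<delta>) \<in> conflations F \<and> A \<in> Ob E \<and> B \<in> Ob E \<and> Z \<in> Ob E"
    and sub_biproduct: "\<lbrakk>M \<in> Ob E; N \<in> Ob E; biproduct F M N S i j p q\<rbrakk> \<Longrightarrow> S \<in> Ob E"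
    and ext_proj_inj_right: "\<lbrakk>P \<in> proj_inj E; M \<in> Ob E; \<delta> \<in> carrier (Ext F M P)\<rbrakk> \<Longrightarrow> \<delta> = \<zero>\<^bsub>Ext F M P\<^esub>"
    and ext_proj_inj_left: "\<lbrakk>P \<in> proj_inj E; M \<in> Ob E; \<delta> \<in> carrier (Ext F P M)\<rbrakk> \<Longrightarrow> \<delta> = \<zero>\<^bsub>Ext F P M\<^esub>"
    and sub_enough: "A \<in> Ob E \<Longrightarrow> \<exists>P Z x y \<delta>. (A,P,Z,x,y,\<delta>) \<in> conflations E \<and> injective E P"
    and sub_injective: "injective E P \<Longrightarrow> projective E P"
begin

abbreviation quo :: "'o \<Rightarrow> 'o \<Rightarrow> 'm \<Rightarrow> 'm set" where
  "quo \<equiv> quot_arr F (proj_inj E)"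

lemma ob [simp]: "X \<in> Ob E \<Longrightarrow> X \<in> Ob F"
  using sub_Ob by blast

lemma proj_inj_ob: "P \<in> proj_inj E \<Longrightarrow> P \<in> Ob E"
  by (simp add: proj_inj_def projective_def)

lemma sub_conflation_arr:
  assumes "(A,B,Z,x,y,\<delta>) \<in> conflations E"
  shows "(A,B,Z,x,y,\<delta>) \<in> conflations F" "A \<in> Ob E" "B \<in> Ob E" "Z \<in> Ob E" "x \<in> arr F A B" "y \<in> arr F B Z"
    "\<delta> \<in> carrier (Ext F Z A)"
  using assms conflation_arr[of A B Z x y \<delta>] unfolding sub_conflations by simp_all

lemma sub_injective_iff: "injective E I \<longleftrightarrow> I \<in> Ob E \<and>
     (\<forall>A B Z x y \<delta>. (A,B,Z,x,y,\<delta>) \<in> conflations E \<longrightarrow> (\<forall>a\<in>arr F A I. \<exists>b\<in>arr F B I. cmp F A B I b x = a))"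
  by (simp add: injective_def sub_Hom sub_cmp split_paired_Ball_Sigma case_prod_beta Ball_def)

lemma proj_injI: "injective E P \<Longrightarrow> P \<in> proj_inj E"
  by (simp add: proj_inj_def sub_injective)

lemma proj_inj_biproduct:
  assumes "P \<in> proj_inj E" "Q \<in> proj_inj E" "biproduct F P Q S i j p q"
  shows "S \<in> proj_inj E"
proof (rule proj_injI)
  have o: "P \<in> Ob E" "Q \<in> Ob E" using assms proj_inj_ob by auto
  have b: "i \<in> arr F P S" "j \<in> arr F Q S" "p \<in> arr F S P" "q \<in> arr F S Q"
    "cmp F S P S i p \<oplus>\<^bsub>Hom F S S\<^esub> cmp F S Q S j q = ide F S" "S \<in> Ob F"
    using assms(3) by (auto simp: biproduct_def)
  have inj: "injective E P" "injective E Q" using assms by (auto simp: proj_inj_def)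
  show "injective E S" unfolding sub_injective_iff
  proof (intro conjI allI impI ballI)
    show "S \<in> Ob E" using sub_biproduct o assms by blast
    fix A B Z x y \<delta> a assume c: "(A,B,Z,x,y,\<delta>) \<in> conflations E" and a: "a \<in> arr F A S"
    note t = sub_conflation_arr[OF c]
    obtain d where d: "d \<in> arr F B P" "cmp F A B P d x = cmp F A S P p a"
      using inj(1) c a b t o unfolding sub_injective_iff by (meson cmp_closed ob)
    obtain e where e: "e \<in> arr F B Q" "cmp F A B Q e x = cmp F A S Q q a"
      using inj(2) c a b t o unfolding sub_injective_iff by (meson cmp_closed ob)
    have "cmp F A S S (cmp F S P S i p \<oplus>\<^bsub>Hom F S S\<^esub> cmp F S Q S j q) a = a"
      unfolding b(5) using a b t by simp
    then have "cmp F A B S (cmp F B P S i d \<oplus>\<^bsub>Hom F B S\<^esub> cmp F B Q S j e) x = a"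
      using a b(1-4,6) t o d e by simp
    then show "\<exists>b\<in>arr F B S. cmp F A B S b x = a"
      using b o d e t by (intro bexI[of _ "cmp F B P S i d \<oplus>\<^bsub>Hom F B S\<^esub> cmp F B Q S j e"]) auto
  qed
qed

text \<open>The ideal is divided out on all objects of \<open>F\<close>, not just on those of
  \<open>E\<close>; quotients for different \<open>E\<close> then live on the same hom-spaces and
  can be compared.\<close>

sublocale stab: factor_category K F "proj_inj E"
proof (intro factor_category.intro factor_category_axioms.intro)
  show "linear_category K F" by (rule linear_category_axioms)
  show "proj_inj E \<subseteq> Ob F" using proj_inj_ob by auto
  fix X Y assume "X \<in> Ob F" "Y \<in> Ob F"
  then show "additive_subgroup (factoring F (proj_inj E) X Y) (Hom F X Y)"
  proof (rule factoring_additive_subgroup)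
    show "proj_inj E \<noteq> {}" using sub_nonempty sub_enough proj_injI by blast
    show "proj_inj E \<subseteq> Ob F" using proj_inj_ob by auto
    fix P Q assume "P \<in> proj_inj E" "Q \<in> proj_inj E"
    then show "\<exists>S\<in>proj_inj E. \<exists>i j p q. biproduct F P Q S i j p q"
      using ex_biproduct[of P Q] proj_inj_biproduct[of P Q] proj_inj_ob ob by blast
  qed
qed

text \<open>Pushing along a map through \<open>P\<close> passes through \<open>Ext F Z P\<close>,
  which vanishes because \<open>Z\<close> lies in \<open>E\<close>. Thus extensions of objects of
  \<open>E\<close> only see classes of maps.\<close>

lemma ext_map_factoring_co:
  assumes "Z \<in> Ob E" "A \<in> Ob F" "A' \<in> Ob F" "\<delta> \<in> carrier (Ext F Z A)"
    "a \<in> factoring F (proj_inj E) A A'"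
  shows "push F Z A A' a \<delta> = \<zero>\<^bsub>Ext F Z A'\<^esub>"
proof -
  obtain P s t where P: "P \<in> proj_inj E" "s \<in> arr F A P" "t \<in> arr F P A'" "a = cmp F A P A' t s"
    using assms unfolding factoring_def by blast
  have PO: "P \<in> Ob F" using P proj_inj_ob by simp
  have "push F Z A P s \<delta> = \<zero>\<^bsub>Ext F Z P\<^esub>"
    using ext_proj_inj_right[OF P(1) assms(1)] P PO assms by simp
  then have "push F Z P A' t (push F Z A P s \<delta>) = \<zero>\<^bsub>Ext F Z A'\<^esub>" using P PO assms by simp
  then show ?thesis using P PO assms by simp
qed

lemma ext_map_factoring_contra:
  assumes "Z \<in> Ob F" "A \<in> Ob E" "Z' \<in> Ob F" "\<delta> \<in> carrier (Ext F Z A)"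
    "c \<in> factoring F (proj_inj E) Z' Z"
  shows "pull F Z Z' A c \<delta> = \<zero>\<^bsub>Ext F Z' A\<^esub>"
proof -
  obtain P s t where P: "P \<in> proj_inj E" "s \<in> arr F Z' P" "t \<in> arr F P Z" "c = cmp F Z' P Z t s"
    using assms unfolding factoring_def by blast
  have PO: "P \<in> Ob F" using P proj_inj_ob by simp
  have "pull F Z P A t \<delta> = \<zero>\<^bsub>Ext F P A\<^esub>"
    using ext_proj_inj_left[OF P(1) assms(2)] P PO assms by simp
  then have "pull F P Z' A s (pull F Z P A t \<delta>) = \<zero>\<^bsub>Ext F Z' A\<^esub>" using P PO assms by simp
  then show ?thesis using P PO assms by simp
qed

lemma push_cong:
  assumes "Z \<in> Ob E" "A \<in> Ob F" "A' \<in> Ob F" "\<delta> \<in> carrier (Ext F Z A)"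
    "a \<in> arr F A A'" "a' \<in> arr F A A'" "quo A A' a = quo A A' a'"
  shows "push F Z A A' a \<delta> = push F Z A A' a' \<delta>"
proof -
  have "a \<ominus>\<^bsub>Hom F A A'\<^esub> a' \<in> factoring F (proj_inj E) A A'"
    using stab.quot_eq_iff assms by blast
  from ext_map_factoring_co[OF assms(1-4) this] show ?thesis
    using ext_map_co_eq_iff assms ob ide_arr by blast
qed

lemma pull_cong:
  assumes "Z \<in> Ob F" "A \<in> Ob E" "Z' \<in> Ob F" "\<delta> \<in> carrier (Ext F Z A)"
    "c \<in> arr F Z' Z" "c' \<in> arr F Z' Z" "quo Z' Z c = quo Z' Z c'"
  shows "pull F Z Z' A c \<delta> = pull F Z Z' A c' \<delta>"
proof -
  have "c \<ominus>\<^bsub>Hom F Z' Z\<^esub> c' \<in> factoring F (proj_inj E) Z' Z"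
    using stab.quot_eq_iff assms by blast
  from ext_map_factoring_contra[OF assms(1-4) this] show ?thesis
    using ext_map_contra_eq_iff assms ob ide_arr by blast
qed

subsection \<open>Objects representing extensions\<close>

text \<open>The Yoneda description of a suspension: pulling back \<open>\<sigma>\<close> identifies
  maps into \<open>S\<close> modulo the ideal with extensions by \<open>Y\<close>. The kernel
  condition records the inclusion into the ideal; the reverse one is
  \<open>ext_map_factoring_contra\<close>.\<close>

definition represents :: "'o \<Rightarrow> 'o \<Rightarrow> 'e \<Rightarrow> bool" where
  "represents Y S \<sigma> \<longleftrightarrow> Y \<in> Ob E \<and> S \<in> Ob E \<and> \<sigma> \<in> carrier (Ext F S Y) \<and>
     (\<forall>M\<in>Ob E. (\<forall>\<epsilon>\<in>carrier (Ext F M Y). \<exists>k\<in>arr F M S. pull F S M Y k \<sigma> = \<epsilon>) \<and>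
        (\<forall>k\<in>arr F M S. pull F S M Y k \<sigma> = \<zero>\<^bsub>Ext F M Y\<^esub> \<longrightarrow> k \<in> factoring F (proj_inj E) M S))"

lemma representsD:
  assumes "represents Y S \<sigma>"
  shows "Y \<in> Ob E" "S \<in> Ob E" "\<sigma> \<in> carrier (Ext F S Y)"
  using assms unfolding represents_def by auto

lemma represents_ex:
  assumes "represents Y S \<sigma>" "M \<in> Ob E" "\<epsilon> \<in> carrier (Ext F M Y)"
  obtains k where "k \<in> arr F M S" "pull F S M Y k \<sigma> = \<epsilon>"
  using assms unfolding represents_def by blast

lemma represents_zero_iff:
  assumes "represents Y S \<sigma>" "M \<in> Ob E" "k \<in> arr F M S"
  shows "pull F S M Y k \<sigma> = \<zero>\<^bsub>Ext F M Y\<^esub> \<longleftrightarrow> k \<in> factoring F (proj_inj E) M S"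
  using assms ext_map_factoring_contra[of S Y M \<sigma> k] unfolding represents_def by auto

lemma represents_eq_iff:
  assumes "represents Y S \<sigma>" "M \<in> Ob E" "k \<in> arr F M S" "k' \<in> arr F M S"
  shows "pull F S M Y k \<sigma> = pull F S M Y k' \<sigma> \<longleftrightarrow> quo M S k = quo M S k'"
  using represents_zero_iff[OF assms(1,2), of "k \<ominus>\<^bsub>Hom F M S\<^esub> k'"] representsD[OF assms(1)] assms
    ext_map_contra_eq_iff[of S Y M Y k k' "ide F Y" \<sigma>] stab.quot_eq_iff[of M S k k'] by simp

text \<open>The long exact sequence of the conflation: \<open>Ext F M P\<close> vanishes, so every
  extension is a pull-back of \<open>\<sigma>\<close>, and a map along which \<open>\<sigma>\<close>
  becomes zero lifts to \<open>P\<close>.\<close>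

lemma conflation_represents:
  assumes c: "(Y,P,S,i,p,\<sigma>) \<in> conflations E" and P: "P \<in> proj_inj E"
  shows "represents Y S \<sigma>"
  unfolding represents_def
proof (intro conjI ballI impI)
  note t = sub_conflation_arr[OF c]
  show "Y \<in> Ob E" "S \<in> Ob E" "\<sigma> \<in> carrier (Ext F S Y)" using t by auto
  fix M assume M: "M \<in> Ob E"
  show "\<exists>k\<in>arr F M S. pull F S M Y k \<sigma> = \<epsilon>" if e: "\<epsilon> \<in> carrier (Ext F M Y)" for \<epsilon>
  proof -
    have "push F M Y P i \<epsilon> = \<zero>\<^bsub>Ext F M P\<^esub>"
      using ext_proj_inj_right[OF P M] e t M by simp
    from ext_from_pull[OF t(1) ob[OF M] e this] show ?thesis by metis
  qed
  show "k \<in> factoring F (proj_inj E) M S"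
    if k: "k \<in> arr F M S" and z: "pull F S M Y k \<sigma> = \<zero>\<^bsub>Ext F M Y\<^esub>" for k
    using deflation_lift[OF t(1) ob[OF M] k z] factoringI[OF P, of _ M p S] t by metis
qed

lemma susp_conflation:
  assumes "X \<in> Ob E"
  obtains I i p where "susp_confl E X = (X,I,stable_susp E X,i,p,susp_ext E X)"
    "(X,I,stable_susp E X,i,p,susp_ext E X) \<in> conflations E" "injective E I"
proof -
  have "\<exists>t. t \<in> conflations E \<and> (\<exists>I S i p \<sigma>. t = (X,I,S,i,p,\<sigma>) \<and> injective E I)"
    using sub_enough[OF assms] by blast
  then have "susp_confl E X \<in> conflations E \<and> (\<exists>I S i p \<sigma>. susp_confl E X = (X,I,S,i,p,\<sigma>) \<and> injective E I)"
    unfolding susp_confl_def by (rule someI_ex)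
  then show thesis using that by (auto simp: stable_susp_def susp_ext_def)
qed

lemma represents_susp: "X \<in> Ob E \<Longrightarrow> represents X (stable_susp E X) (susp_ext E X)"
  by (metis susp_conflation conflation_represents proj_injI)

lemma susp_ob [simp]: "X \<in> Ob E \<Longrightarrow> stable_susp E X \<in> Ob E"
  using represents_susp representsD by blast

lemma susp_ext_closed [simp]: "X \<in> Ob E \<Longrightarrow> susp_ext E X \<in> carrier (Ext F (stable_susp E X) X)"
  using represents_susp representsD by blast

text \<open>The middle map is free: realisation supplies it as soon as the outer maps agree on
  extensions. This removes \<open>b\<close> from everything defined with
  \<open>susp_confl\<close>.\<close>

lemma susp_morphism:
  assumes "(X,Y,Z,f,g,\<delta>) \<in> conflations E" "X' \<in> Ob E" "a \<in> arr F X X'" "h \<in> arr F Z (stable_susp E X')"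
  shows "(\<exists>b. confl_morphism E (X,Y,Z,f,g,\<delta>) (susp_confl E X') a b h) \<longleftrightarrow>
    push F Z X X' a \<delta> = pull F (stable_susp E X') Z X' h (susp_ext E X')"
proof -
  obtain I i p where s: "susp_confl E X' = (X',I,stable_susp E X',i,p,susp_ext E X')"
    and c: "(X',I,stable_susp E X',i,p,susp_ext E X') \<in> conflations E"
    by (rule susp_conflation[OF assms(2)])
  note t = sub_conflation_arr[OF assms(1)]
  show ?thesis
    unfolding s using rlz_morphism[OF t(1) sub_conflation_arr(1)[OF c] assms(3,4)]
    by (auto simp: sub_Hom sub_cmp sub_ide sub_ext_map)
qed

lemma quot_arr_sub: "quot_arr E \<P> = quot_arr F \<P>"
  using quot_arr_cong[of E F] sub_Hom sub_cmp by simp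

lemma susp_arr_ex:
  assumes "X \<in> Ob E" "Y \<in> Ob E" "f \<in> arr F X Y"
  obtains s where "s \<in> arr F (stable_susp E X) (stable_susp E Y)"
    "pull F (stable_susp E Y) (stable_susp E X) Y s (susp_ext E Y)
      = push F (stable_susp E X) X Y f (susp_ext E X)"
  by (rule represents_ex[OF represents_susp[OF assms(2)] susp_ob[OF assms(1)],
    of "push F (stable_susp E X) X Y f (susp_ext E X)"]) (use assms in simp_all)

text \<open>The choice ranges over representatives of the class and over all fillings. Each
  candidate solves the same equation of extensions, because the push-out ignores the representative
  of \<open>f\<close>, and the representing property determines the solution modulo the
  ideal.\<close>

lemma stable_susp_arr_eq:
  assumes X: "X \<in> Ob E" and Y: "Y \<in> Ob E" and f: "f \<in> arr F X Y"
    and s: "s \<in> arr F (stable_susp E X) (stable_susp E Y)"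
    and eq: "pull F (stable_susp E Y) (stable_susp E X) Y s (susp_ext E Y)
      = push F (stable_susp E X) X Y f (susp_ext E X)"
  shows "stable_susp_arr E X Y (quo X Y f) = quo (stable_susp E X) (stable_susp E Y) s"
  unfolding stable_susp_arr_def quot_arr_sub
proof (rule some_equality)
  obtain I i p where sc: "susp_confl E X = (X,I,stable_susp E X,i,p,susp_ext E X)"
    and c: "(X,I,stable_susp E X,i,p,susp_ext E X) \<in> conflations E"
    by (rule susp_conflation[OF X])
  have "\<exists>b. confl_morphism E (susp_confl E X) (susp_confl E Y) f b s"
    unfolding sc using susp_morphism[OF c Y f s] eq by simp
  then show "\<exists>f\<in>quo X Y f. \<exists>b s'. confl_morphism E (susp_confl E X) (susp_confl E Y) f b s' \<and>
      quo (stable_susp E X) (stable_susp E Y) s = quo (stable_susp E X) (stable_susp E Y) s'"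
    using stab.quot_self X Y f ob by blast
  fix G assume "\<exists>f\<in>quo X Y f. \<exists>b s. confl_morphism E (susp_confl E X) (susp_confl E Y) f b s \<and>
      G = quo (stable_susp E X) (stable_susp E Y) s"
  then obtain f' b s' where f': "f' \<in> quo X Y f"
    and m: "confl_morphism E (susp_confl E X) (susp_confl E Y) f' b s'"
    and G: "G = quo (stable_susp E X) (stable_susp E Y) s'" by blast
  have ff: "f' \<in> arr F X Y" "quo X Y f' = quo X Y f"
    using stab.quot_memD[OF _ _ f f'] X Y by auto
  obtain J j r where sc': "susp_confl E Y = (Y,J,stable_susp E Y,j,r,susp_ext E Y)"
    by (rule susp_conflation[OF Y])
  have s': "s' \<in> arr F (stable_susp E X) (stable_susp E Y)"
    using m unfolding sc sc' confl_morphism.simps sub_Hom by blast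
  have "push F (stable_susp E X) X Y f' (susp_ext E X)
    = pull F (stable_susp E Y) (stable_susp E X) Y s' (susp_ext E Y)"
    using susp_morphism[OF c Y ff(1) s'] m unfolding sc by blast
  moreover have "push F (stable_susp E X) X Y f' (susp_ext E X) = push F (stable_susp E X) X Y f (susp_ext E X)"
    by (rule push_cong) (use X Y f ff in simp_all)
  ultimately have "pull F (stable_susp E Y) (stable_susp E X) Y s' (susp_ext E Y)
    = pull F (stable_susp E Y) (stable_susp E X) Y s (susp_ext E Y)" using eq by simp
  then show "G = quo (stable_susp E X) (stable_susp E Y) s"
    unfolding G using represents_eq_iff[OF represents_susp[OF Y] susp_ob[OF X] s' s] by simp
qed

lemma Ob_stable [simp]: "Ob (stable_cat E) = Ob E"
  by (simp add: stable_cat_def quot_cat_def Let_def)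

lemma stable_cat_simps [simp]:
  "Hom (stable_cat E) = Hom (quot_cat F (proj_inj E))"
  "cmp (stable_cat E) = cmp (quot_cat F (proj_inj E))"
  "ide (stable_cat E) = ide (quot_cat F (proj_inj E))"
  "susp (stable_cat E) = stable_susp E"
  "susp_arr (stable_cat E) = stable_susp_arr E"
  using quot_cat_cong[OF sub_Hom sub_cmp sub_ide] by (simp_all add: stable_cat_def Let_def)

text \<open>Under the identification of maps into a suspension with extensions, the third square of a
  morphism of triangles becomes the compatibility with extensions required of a morphism of
  conflations.\<close>

lemma susp_square_iff:
  assumes X: "X \<in> Ob E" and X': "X' \<in> Ob E" and Z: "Z \<in> Ob E" and Z': "Z' \<in> Ob E"
    and a: "a \<in> arr F X X'" and c: "c \<in> arr F Z Z'"
    and w: "w \<in> arr F Z (stable_susp E X)" and w': "w' \<in> arr F Z' (stable_susp E X')"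
  shows "cmp (quot_cat F (proj_inj E)) Z (stable_susp E X) (stable_susp E X')
        (stable_susp_arr E X X' (quo X X' a)) (quo Z (stable_susp E X) w)
      = cmp (quot_cat F (proj_inj E)) Z Z' (stable_susp E X') (quo Z' (stable_susp E X') w') (quo Z Z' c)
    \<longleftrightarrow> push F Z X X' a (pull F (stable_susp E X) Z X w (susp_ext E X))
      = pull F Z' Z X' c (pull F (stable_susp E X') Z' X' w' (susp_ext E X'))"
proof -
  obtain s where s: "s \<in> arr F (stable_susp E X) (stable_susp E X')"
    "pull F (stable_susp E X') (stable_susp E X) X' s (susp_ext E X')
      = push F (stable_susp E X) X X' a (susp_ext E X)"
    by (rule susp_arr_ex[OF X X' a])
  have "pull F (stable_susp E X) Z X' w (pull F (stable_susp E X') (stable_susp E X) X' s (susp_ext E X'))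
    = pull F (stable_susp E X) Z X' w (push F (stable_susp E X) X X' a (susp_ext E X))"
    using s by simp
  then have "pull F (stable_susp E X') Z X' (cmp F Z (stable_susp E X) (stable_susp E X') s w) (susp_ext E X')
    = push F Z X X' a (pull F (stable_susp E X) Z X w (susp_ext E X))"
    using X X' Z a w s(1) by simp
  moreover have "pull F (stable_susp E X') Z X' (cmp F Z Z' (stable_susp E X') w' c) (susp_ext E X')
    = pull F Z' Z X' c (pull F (stable_susp E X') Z' X' w' (susp_ext E X'))"
    using X X' Z Z' c w' by simp
  moreover have sw: "cmp F Z (stable_susp E X) (stable_susp E X') s w \<in> arr F Z (stable_susp E X')"
    "cmp F Z Z' (stable_susp E X') w' c \<in> arr F Z (stable_susp E X')"
    using X X' Z Z' c w w' s(1) by simp_all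
  moreover have "cmp (quot_cat F (proj_inj E)) Z (stable_susp E X) (stable_susp E X')
      (quo (stable_susp E X) (stable_susp E X') s) (quo Z (stable_susp E X) w)
      = quo Z (stable_susp E X') (cmp F Z (stable_susp E X) (stable_susp E X') s w)"
    using X X' Z w s(1) by (intro stab.cmp_quot) simp_all
  moreover have "cmp (quot_cat F (proj_inj E)) Z Z' (stable_susp E X') (quo Z' (stable_susp E X') w') (quo Z Z' c)
      = quo Z (stable_susp E X') (cmp F Z Z' (stable_susp E X') w' c)"
    using X' Z Z' w' c by (intro stab.cmp_quot) simp_all
  ultimately show ?thesis
    unfolding stable_susp_arr_eq[OF X X' a s]
    using represents_eq_iff[OF represents_susp[OF X'] Z sw] by metis
qed

end

subsection \<open>Distinguished triangles\<close>

text \<open>The first two maps of a distinguished triangle of the stable category, together with the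
  extension corresponding to the third one, form a retract of a conflation up to maps factoring
  through projective-injectives. This suffices to transport exactness from conflations.\<close>

context stable_subcategory
begin

definition conflation_retract :: "'o \<Rightarrow> 'o \<Rightarrow> 'o \<Rightarrow> 'm \<Rightarrow> 'm \<Rightarrow> 'e \<Rightarrow> bool" where
  "conflation_retract X Y Z u v \<delta> \<longleftrightarrow>
     X \<in> Ob E \<and> Y \<in> Ob E \<and> Z \<in> Ob E \<and> u \<in> arr F X Y \<and> v \<in> arr F Y Z \<and> \<delta> \<in> carrier (Ext F Z X) \<and>
     (\<exists>X' Y' Z' f g \<delta>' a b c a' b' c'. (X',Y',Z',f,g,\<delta>') \<in> conflations E \<and>
        a \<in> arr F X X' \<and> b \<in> arr F Y Y' \<and> c \<in> arr F Z Z' \<and>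
        a' \<in> arr F X' X \<and> b' \<in> arr F Y' Y \<and> c' \<in> arr F Z' Z \<and>
        quo X Y' (cmp F X Y Y' b u) = quo X Y' (cmp F X X' Y' f a) \<and>
        quo Y Z' (cmp F Y Z Z' c v) = quo Y Z' (cmp F Y Y' Z' g b) \<and>
        push F Z X X' a \<delta> = pull F Z' Z X' c \<delta>' \<and>
        quo X' Y (cmp F X' Y' Y b' f) = quo X' Y (cmp F X' X Y u a') \<and>
        quo Y' Z (cmp F Y' Z' Z c' g) = quo Y' Z (cmp F Y' Y Z v b') \<and>
        push F Z' X' X a' \<delta>' = pull F Z Z' X c' \<delta> \<and>
        quo X X (cmp F X X' X a' a) = quo X X (ide F X) \<and>
        quo Z Z (cmp F Z Z' Z c' c) = quo Z Z (ide F Z))"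

lemma conflation_is_retract:
  assumes cf: "(X,Y,Z,u,v,\<delta>) \<in> conflations E"
  shows "conflation_retract X Y Z u v \<delta>"
proof -
  note t = sub_conflation_arr[OF cf]
  note i = t(2-4)[THEN ob, THEN ide_arr]
  show ?thesis
    unfolding conflation_retract_def
    by (intro conjI t exI, rule cf, (rule i)+) (use t in simp_all)
qed

context
  fixes X Y Z u v \<delta>
  assumes ret: "conflation_retract X Y Z u v \<delta>"
begin

lemma retract_arr: "X \<in> Ob E" "Y \<in> Ob E" "Z \<in> Ob E" "u \<in> arr F X Y" "v \<in> arr F Y Z" "\<delta> \<in> carrier (Ext F Z X)"
  using ret unfolding conflation_retract_def by auto

text \<open>The pattern for this and the following transports: carry the data to a genuine
  conflation along \<open>a\<close>, \<open>b\<close>, \<open>c\<close>, use exactness there, and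
  return along the primed maps. A retract identity at an end term shows that the round trip changes
  nothing.\<close>

lemma retract_lift:
  assumes M: "M \<in> Ob E" and k: "k \<in> arr F M Z" and z: "pull F Z M X k \<delta> = \<zero>\<^bsub>Ext F M X\<^esub>"
  obtains m where "m \<in> arr F M Y" "quo M Z k = quo M Z (cmp F M Y Z v m)"
proof -
  obtain X' Y' Z' f g \<delta>' a b c a' b' c' where cf: "(X',Y',Z',f,g,\<delta>') \<in> conflations E"
    and s: "a \<in> arr F X X'" "c \<in> arr F Z Z'" "b' \<in> arr F Y' Y" "c' \<in> arr F Z' Z"
    and e: "push F Z X X' a \<delta> = pull F Z' Z X' c \<delta>'"
      "quo Y' Z (cmp F Y' Z' Z c' g) = quo Y' Z (cmp F Y' Y Z v b')"
      "quo Z Z (cmp F Z Z' Z c' c) = quo Z Z (ide F Z)"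
    using ret unfolding conflation_retract_def by blast
  note r = retract_arr and t = sub_conflation_arr[OF cf]
  have "pull F Z M X' k (pull F Z' Z X' c \<delta>') = push F M X X' a (pull F Z M X k \<delta>)"
    unfolding e(1)[symmetric] using r s t M k by simp
  then have "pull F Z' M X' (cmp F M Z Z' c k) \<delta>' = \<zero>\<^bsub>Ext F M X'\<^esub>"
    unfolding z using r s t M k by simp
  then obtain m where m: "m \<in> arr F M Y'" "cmp F M Y' Z' g m = cmp F M Z Z' c k"
    using deflation_lift[OF t(1) ob[OF M], of "cmp F M Z Z' c k"] r s t M k by (metis cmp_closed ob)
  have "quo M Z (cmp F M Z Z (cmp F Z Z' Z c' c) k) = quo M Z (cmp F M Z Z (ide F Z) k)"
    by (rule stab.quot_cmp_cong) (use r s t e k M in simp_all)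
  then have "quo M Z k = quo M Z (cmp F M Z' Z c' (cmp F M Y' Z' g m))"
    unfolding m using r s t k M by simp
  also have "\<dots> = quo M Z (cmp F M Y' Z (cmp F Y' Z' Z c' g) m)"
    using r s t m(1) M by simp
  also have "\<dots> = quo M Z (cmp F M Y' Z (cmp F Y' Y Z v b') m)"
    by (rule stab.quot_cmp_cong) (use r s t e m(1) M in simp_all)
  also have "\<dots> = quo M Z (cmp F M Y Z v (cmp F M Y' Y b' m))"
    using r s t m(1) M by simp
  finally show thesis using that[of "cmp F M Y' Y b' m"] r s t m(1) M by simp
qed

lemma retract_ext_pull:
  assumes M: "M \<in> Ob E" and eps: "\<epsilon> \<in> carrier (Ext F M X)" and z: "push F M X Y u \<epsilon> = \<zero>\<^bsub>Ext F M Y\<^esub>"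
  obtains k where "k \<in> arr F M Z" "pull F Z M X k \<delta> = \<epsilon>"
proof -
  obtain X' Y' Z' f g \<delta>' a b c a' b' c' where cf: "(X',Y',Z',f,g,\<delta>') \<in> conflations E"
    and s: "a \<in> arr F X X'" "b \<in> arr F Y Y'" "a' \<in> arr F X' X" "c' \<in> arr F Z' Z"
    and e: "quo X Y' (cmp F X Y Y' b u) = quo X Y' (cmp F X X' Y' f a)"
      "push F Z' X' X a' \<delta>' = pull F Z Z' X c' \<delta>"
      "quo X X (cmp F X X' X a' a) = quo X X (ide F X)"
    using ret unfolding conflation_retract_def by blast
  note r = retract_arr and t = sub_conflation_arr[OF cf]
  have "push F M X Y' (cmp F X Y Y' b u) \<epsilon> = push F M X Y' (cmp F X X' Y' f a) \<epsilon>"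
    by (rule push_cong) (use r s t e eps M in simp_all)
  moreover have "push F M Y Y' b (push F M X Y u \<epsilon>) = \<zero>\<^bsub>Ext F M Y'\<^esub>"
    unfolding z using r s t M by simp
  ultimately have "push F M X' Y' f (push F M X X' a \<epsilon>) = \<zero>\<^bsub>Ext F M Y'\<^esub>"
    using r s t eps M by simp
  then obtain k where k: "k \<in> arr F M Z'" "push F M X X' a \<epsilon> = pull F Z' M X' k \<delta>'"
    using ext_from_pull[OF t(1) ob[OF M], of "push F M X X' a \<epsilon>"] r s t eps M
    by (metis ext_map_closed ob ide_arr)
  have "push F M X X (cmp F X X' X a' a) \<epsilon> = push F M X X (ide F X) \<epsilon>"
    by (rule push_cong) (use r s t e eps M in simp_all)
  then have "\<epsilon> = push F M X' X a' (push F M X X' a \<epsilon>)" using r s t eps M by simp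
  also have "\<dots> = pull F Z' M X k (push F Z' X' X a' \<delta>')"
    unfolding k(2) using r s t k(1) M by simp
  also have "\<dots> = pull F Z M X (cmp F M Z' Z c' k) \<delta>"
    unfolding e(2) using r s t k(1) M by simp
  finally show thesis using that[of "cmp F M Z' Z c' k"] r s t k(1) M by simp
qed

text \<open>The round trip through \<open>X'\<close> rewrites \<open>\<delta>\<close> as a pull-back
  of the push-out of \<open>\<delta>'\<close> along \<open>a'\<close>; the square for
  \<open>u\<close> then exposes the inflation \<open>f\<close>, which kills
  \<open>\<delta>'\<close>.\<close>

lemma retract_push_zero: "push F Z X Y u \<delta> = \<zero>\<^bsub>Ext F Z Y\<^esub>"
proof -
  obtain X' Y' Z' f g \<delta>' a b c a' b' c' where cf: "(X',Y',Z',f,g,\<delta>') \<in> conflations E"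
    and s: "a \<in> arr F X X'" "c \<in> arr F Z Z'" "a' \<in> arr F X' X" "b' \<in> arr F Y' Y"
    and e: "push F Z X X' a \<delta> = pull F Z' Z X' c \<delta>'"
      "quo X' Y (cmp F X' Y' Y b' f) = quo X' Y (cmp F X' X Y u a')"
      "quo X X (cmp F X X' X a' a) = quo X X (ide F X)"
    using ret unfolding conflation_retract_def by blast
  note r = retract_arr and t = sub_conflation_arr[OF cf]
  have "push F Z X X (cmp F X X' X a' a) \<delta> = push F Z X X (ide F X) \<delta>"
    by (rule push_cong) (use r s t e in simp_all)
  then have "\<delta> = push F Z X' X a' (push F Z X X' a \<delta>)" using r s t by simp
  also have "\<dots> = pull F Z' Z X c (push F Z' X' X a' \<delta>')"
    unfolding e(1) using r s t by simp
  finally have "push F Z X Y u \<delta> = push F Z X Y u (pull F Z' Z X c (push F Z' X' X a' \<delta>'))" by simp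
  also have "\<dots> = pull F Z' Z Y c (push F Z' X' Y (cmp F X' X Y u a') \<delta>')"
    using r s t by simp
  also have "push F Z' X' Y (cmp F X' X Y u a') \<delta>' = push F Z' X' Y (cmp F X' Y' Y b' f) \<delta>'"
    by (rule push_cong) (use r s t e in simp_all)
  also have "\<dots> = push F Z' Y' Y b' (push F Z' X' Y' f \<delta>')" using r s t by simp
  also have "\<dots> = \<zero>\<^bsub>Ext F Z' Y\<^esub>" using push_inflation[OF t(1)] r s t by simp
  finally show ?thesis using r s t by simp
qed

lemma retract_ext_push:
  assumes M: "M \<in> Ob E" and eps: "\<epsilon> \<in> carrier (Ext F Z M)" and z: "pull F Z Y M v \<epsilon> = \<zero>\<^bsub>Ext F Y M\<^esub>"
  obtains k where "k \<in> arr F X M" "\<epsilon> = push F Z X M k \<delta>"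
proof -
  obtain X' Y' Z' f g \<delta>' a b c a' b' c' where cf: "(X',Y',Z',f,g,\<delta>') \<in> conflations E"
    and s: "a \<in> arr F X X'" "c \<in> arr F Z Z'" "b' \<in> arr F Y' Y" "c' \<in> arr F Z' Z"
    and e: "push F Z X X' a \<delta> = pull F Z' Z X' c \<delta>'"
      "quo Y' Z (cmp F Y' Z' Z c' g) = quo Y' Z (cmp F Y' Y Z v b')"
      "quo Z Z (cmp F Z Z' Z c' c) = quo Z Z (ide F Z)"
    using ret unfolding conflation_retract_def by blast
  note r = retract_arr and t = sub_conflation_arr[OF cf]
  have "pull F Z Y' M (cmp F Y' Z' Z c' g) \<epsilon> = pull F Z Y' M (cmp F Y' Y Z v b') \<epsilon>"
    by (rule pull_cong) (use r s t e eps M in simp_all)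
  moreover have "pull F Y Y' M b' (pull F Z Y M v \<epsilon>) = \<zero>\<^bsub>Ext F Y' M\<^esub>"
    unfolding z using r s t M by simp
  ultimately have "pull F Z' Y' M g (pull F Z Z' M c' \<epsilon>) = \<zero>\<^bsub>Ext F Y' M\<^esub>"
    using r s t eps M by simp
  then obtain k where k: "k \<in> arr F X' M" "pull F Z Z' M c' \<epsilon> = push F Z' X' M k \<delta>'"
    using ext_from_push[OF t(1) ob[OF M], of "pull F Z Z' M c' \<epsilon>"] r s t eps M
    by (metis ext_map_closed ob ide_arr)
  have "pull F Z Z M (cmp F Z Z' Z c' c) \<epsilon> = pull F Z Z M (ide F Z) \<epsilon>"
    by (rule pull_cong) (use r s t e eps M in simp_all)
  then have "\<epsilon> = pull F Z' Z M c (pull F Z Z' M c' \<epsilon>)" using r s t eps M by simp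
  also have "\<dots> = push F Z X' M k (pull F Z' Z X' c \<delta>')"
    unfolding k(2) using r s t k(1) M by simp
  also have "\<dots> = push F Z X M (cmp F X X' M k a) \<delta>"
    unfolding e(1)[symmetric] using r s t k(1) M by simp
  finally show thesis using that[of "cmp F X X' M k a"] r s t k(1) M by simp
qed

end

text \<open>Realisation fills morphisms of conflations, so the outer maps are conjugated into the
  two conflations, filled there, and the middle map is conjugated back. The squares survive modulo
  the ideal.\<close>

lemma retract_fill:
  assumes ret1: "conflation_retract X1 Y1 Z1 u1 v1 \<delta>1" and ret2: "conflation_retract X2 Y2 Z2 u2 v2 \<delta>2"
    and p: "p \<in> arr F X1 X2" and r: "r \<in> arr F Z1 Z2"
    and pr: "push F Z1 X1 X2 p \<delta>1 = pull F Z2 Z1 X2 r \<delta>2"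
  obtains q where "q \<in> arr F Y1 Y2"
    "quo X1 Y2 (cmp F X1 Y1 Y2 q u1) = quo X1 Y2 (cmp F X1 X2 Y2 u2 p)"
    "quo Y1 Z2 (cmp F Y1 Y2 Z2 v2 q) = quo Y1 Z2 (cmp F Y1 Z1 Z2 r v1)"
proof -
  obtain X1' Y1' Z1' f1 g1 \<delta>1' a1 b1 c1 a1' b1' c1' where cf1: "(X1',Y1',Z1',f1,g1,\<delta>1') \<in> conflations E"
    and s1: "a1 \<in> arr F X1 X1'" "b1 \<in> arr F Y1 Y1'" "c1 \<in> arr F Z1 Z1'" "a1' \<in> arr F X1' X1" "c1' \<in> arr F Z1' Z1"
    and e1: "quo X1 Y1' (cmp F X1 Y1 Y1' b1 u1) = quo X1 Y1' (cmp F X1 X1' Y1' f1 a1)"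
      "quo Y1 Z1' (cmp F Y1 Z1 Z1' c1 v1) = quo Y1 Z1' (cmp F Y1 Y1' Z1' g1 b1)"
      "push F Z1' X1' X1 a1' \<delta>1' = pull F Z1 Z1' X1 c1' \<delta>1"
      "quo X1 X1 (cmp F X1 X1' X1 a1' a1) = quo X1 X1 (ide F X1)"
      "quo Z1 Z1 (cmp F Z1 Z1' Z1 c1' c1) = quo Z1 Z1 (ide F Z1)"
    using ret1 unfolding conflation_retract_def by blast
  obtain X2' Y2' Z2' f2 g2 \<delta>2' a2 b2 c2 a2' b2' c2' where cf2: "(X2',Y2',Z2',f2,g2,\<delta>2') \<in> conflations E"
    and s2: "a2 \<in> arr F X2 X2'" "c2 \<in> arr F Z2 Z2'" "a2' \<in> arr F X2' X2" "b2' \<in> arr F Y2' Y2" "c2' \<in> arr F Z2' Z2"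
    and e2: "push F Z2 X2 X2' a2 \<delta>2 = pull F Z2' Z2 X2' c2 \<delta>2'"
      "quo X2' Y2 (cmp F X2' Y2' Y2 b2' f2) = quo X2' Y2 (cmp F X2' X2 Y2 u2 a2')"
      "quo Y2' Z2 (cmp F Y2' Z2' Z2 c2' g2) = quo Y2' Z2 (cmp F Y2' Y2 Z2 v2 b2')"
      "quo X2 X2 (cmp F X2 X2' X2 a2' a2) = quo X2 X2 (ide F X2)"
      "quo Z2 Z2 (cmp F Z2 Z2' Z2 c2' c2) = quo Z2 Z2 (ide F Z2)"
    using ret2 unfolding conflation_retract_def by blast
  note r1 = retract_arr[OF ret1] and r2 = retract_arr[OF ret2]
    and t1 = sub_conflation_arr[OF cf1] and t2 = sub_conflation_arr[OF cf2]
  \<comment> \<open>From the first conflation back to its retract, across by \<open>p\<close> or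
    \<open>r\<close>, and on to the second conflation.\<close>
  let ?p = "cmp F X1' X2 X2' a2 (cmp F X1' X1 X2 p a1')"
  let ?r = "cmp F Z1' Z2 Z2' c2 (cmp F Z1' Z1 Z2 r c1')"
  have pc: "?p \<in> arr F X1' X2'" "?r \<in> arr F Z1' Z2'" using r1 r2 t1 t2 s1 s2 p r by simp_all
  have "push F Z1' X1' X2' ?p \<delta>1' = push F Z1' X1 X2' (cmp F X1 X2 X2' a2 p) (push F Z1' X1' X1 a1' \<delta>1')"
    using r1 r2 t1 t2 s1 s2 p by simp
  also have "\<dots> = push F Z1' X2 X2' a2 (pull F Z1 Z1' X2 c1' (push F Z1 X1 X2 p \<delta>1))"
    unfolding e1(3) using r1 r2 t1 t2 s1 s2 p by simp
  also have "\<dots> = pull F Z2 Z1' X2' (cmp F Z1' Z1 Z2 r c1') (push F Z2 X2 X2' a2 \<delta>2)"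
    unfolding pr using r1 r2 t1 t2 s1 s2 r by simp
  also have "\<dots> = pull F Z2' Z1' X2' ?r \<delta>2'"
    unfolding e2(1) using r1 r2 t1 t2 s1 s2 r by simp
  finally have "push F Z1' X1' X2' ?p \<delta>1' = pull F Z2' Z1' X2' ?r \<delta>2'" .
  from rlz_morphism[OF t1(1) t2(1) pc this] obtain q where q: "q \<in> arr F Y1' Y2'"
    "cmp F X1' Y1' Y2' q f1 = cmp F X1' X2' Y2' f2 ?p"
    "cmp F Y1' Z1' Z2' ?r g1 = cmp F Y1' Y2' Z2' g2 q"
    by (auto simp del: cat_simps)
  let ?q = "cmp F Y1 Y2' Y2 b2' (cmp F Y1 Y1' Y2' q b1)"
  have "quo X1 Y2' (cmp F X1 Y1 Y2' (cmp F Y1 Y1' Y2' q b1) u1)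
    = quo X1 Y2' (cmp F X1 X2' Y2' f2 (cmp F X1 X1' X2' ?p a1))"
    by (rule stab.quot_paste[OF _ _ _ _ _ _ _ _ _ _ _ _ _ e1(1)])
      (use r1 r2 t1 t2 s1 s2 pc q in \<open>simp_all del: cmp_assoc\<close>)
  then have "quo X1 Y2 (cmp F X1 Y1 Y2 ?q u1)
    = quo X1 Y2 (cmp F X1 X2 Y2 u2 (cmp F X1 X2' X2 a2' (cmp F X1 X1' X2' ?p a1)))"
    by (rule stab.quot_paste[OF _ _ _ _ _ _ _ _ _ _ _ _ _ _ e2(2), rotated -1])
      (use r1 r2 t1 t2 s1 s2 pc q in \<open>simp_all del: cmp_assoc\<close>)
  \<comment> \<open>The detour \<open>a2' ?p a1\<close> equals \<open>p\<close> modulo the ideal by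
    the retract identities at \<open>X1\<close> and \<open>X2\<close>.\<close>
  also have "\<dots> = quo X1 Y2 (cmp F X1 X2 Y2 u2 p)"
    by (rule stab.quot_cmp_cong[OF _ _ _ _ _ stab.quot_retract[OF _ _ _ _ _ _ _ _ _ e1(4) e2(4)]])
      (use r1 r2 t1 t2 s1 s2 p pc in \<open>simp_all del: cmp_assoc\<close>)
  finally have 1: "quo X1 Y2 (cmp F X1 Y1 Y2 ?q u1) = quo X1 Y2 (cmp F X1 X2 Y2 u2 p)" .
  have "quo Y1 Z2' (cmp F Y1 Z1 Z2' (cmp F Z1 Z1' Z2' ?r c1) v1)
    = quo Y1 Z2' (cmp F Y1 Y2' Z2' g2 (cmp F Y1 Y1' Y2' q b1))"
    by (rule stab.quot_paste[OF _ _ _ _ _ _ _ _ _ _ _ _ _ e1(2)])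
      (use r1 r2 t1 t2 s1 s2 pc q in \<open>simp_all del: cmp_assoc\<close>)
  then have "quo Y1 Z2 (cmp F Y1 Z1 Z2 (cmp F Z1 Z2' Z2 c2' (cmp F Z1 Z1' Z2' ?r c1)) v1)
    = quo Y1 Z2 (cmp F Y1 Y2 Z2 v2 ?q)"
    by (rule stab.quot_paste[OF _ _ _ _ _ _ _ _ _ _ _ _ _ _ e2(3), rotated -1])
      (use r1 r2 t1 t2 s1 s2 pc q in \<open>simp_all del: cmp_assoc\<close>)
  moreover have "quo Y1 Z2 (cmp F Y1 Z1 Z2 (cmp F Z1 Z2' Z2 c2' (cmp F Z1 Z1' Z2' ?r c1)) v1)
    = quo Y1 Z2 (cmp F Y1 Z1 Z2 r v1)"
    by (rule stab.quot_cmp_cong[OF _ _ _ _ _ refl _ _ stab.quot_retract[OF _ _ _ _ _ _ _ _ _ e1(5) e2(5)]])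
      (use r1 r2 t1 t2 s1 s2 r pc in \<open>simp_all del: cmp_assoc\<close>)
  ultimately have 2: "quo Y1 Z2 (cmp F Y1 Y2 Z2 v2 ?q) = quo Y1 Z2 (cmp F Y1 Z1 Z2 r v1)" by simp
  show thesis using that[OF _ 1 2] r1 r2 t1 t2 s1 s2 q(1) by simp
qed

text \<open>Everything is unpacked to arrows of \<open>F\<close>: the three isomorphisms with
  inverses modulo the ideal, and the third square as an equation of extensions. Both inverse
  identities are kept at each object, since the isomorphism has to be rebuilt in the
  reduction.\<close>

lemma stable_distE:
  assumes "(X,Y,Z,U,V,W) \<in> dist (stable_cat E)"
  obtains u v w X' Y' Z' f g h \<delta> a b c a' b' c' where
    "X \<in> Ob E" "Y \<in> Ob E" "Z \<in> Ob E" "u \<in> arr F X Y" "v \<in> arr F Y Z" "w \<in> arr F Z (stable_susp E X)"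
    "U = quo X Y u" "V = quo Y Z v" "W = quo Z (stable_susp E X) w"
    "(X',Y',Z',f,g,\<delta>) \<in> conflations E" "h \<in> arr F Z' (stable_susp E X')"
    "pull F (stable_susp E X') Z' X' h (susp_ext E X') = \<delta>"
    "a \<in> arr F X X'" "b \<in> arr F Y Y'" "c \<in> arr F Z Z'"
    "a' \<in> arr F X' X" "b' \<in> arr F Y' Y" "c' \<in> arr F Z' Z"
    "quo X Y' (cmp F X Y Y' b u) = quo X Y' (cmp F X X' Y' f a)"
    "quo Y Z' (cmp F Y Z Z' c v) = quo Y Z' (cmp F Y Y' Z' g b)"
    "push F Z X X' a (pull F (stable_susp E X) Z X w (susp_ext E X)) = pull F Z' Z X' c \<delta>"
    "quo X X (cmp F X X' X a' a) = quo X X (ide F X)"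
    "quo X' X' (cmp F X' X X' a a') = quo X' X' (ide F X')"
    "quo Y Y (cmp F Y Y' Y b' b) = quo Y Y (ide F Y)"
    "quo Y' Y' (cmp F Y' Y Y' b b') = quo Y' Y' (ide F Y')"
    "quo Z Z (cmp F Z Z' Z c' c) = quo Z Z (ide F Z)"
    "quo Z' Z' (cmp F Z' Z Z' c c') = quo Z' Z' (ide F Z')"
proof -
  let ?Q = "quot_cat E (proj_inj E)" and ?R = "quot_cat F (proj_inj E)"
  have Q: "Ob ?Q = Ob E" "Hom ?Q = Hom ?R" "cmp ?Q = cmp ?R" "ide ?Q = ide ?R"
    using quot_cat_cong[OF sub_Hom sub_cmp sub_ide] by (simp_all add: quot_cat_def)
  have "(X,Y,Z,U,V,W) \<in> triangle_iso_closure ?Q (stable_susp E) (stable_susp_arr E) (stable_standard E)"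
    using assms by (simp add: stable_cat_def Let_def)
  then obtain t' where tri: "is_triangle ?Q (stable_susp E) (X,Y,Z,U,V,W)" and t': "t' \<in> stable_standard E"
    and iso: "triangle_iso ?Q (stable_susp E) (stable_susp_arr E) (X,Y,Z,U,V,W) t'"
    unfolding triangle_iso_closure_def by blast
  obtain X' Y' Z' f g h \<delta> where t'eq: "t' = (X', Y', Z', quo X' Y' f, quo Y' Z' g, quo Z' (stable_susp E X') h)"
    and cf: "(X',Y',Z',f,g,\<delta>) \<in> conflations E"
    and "\<exists>b. confl_morphism E (X',Y',Z',f,g,\<delta>) (susp_confl E X') (ide E X') b h"
    using t' unfolding stable_standard_def quot_arr_sub by blast
  then obtain d where m: "confl_morphism E (X',Y',Z',f,g,\<delta>) (susp_confl E X') (ide F X') d h"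
    unfolding sub_ide by blast
  note t = sub_conflation_arr[OF cf]
  obtain I i p where sc: "susp_confl E X' = (X',I,stable_susp E X',i,p,susp_ext E X')"
    by (rule susp_conflation[OF t(2)])
  have h: "h \<in> arr F Z' (stable_susp E X')"
    using m unfolding sc confl_morphism.simps sub_Hom by blast
  have "push F Z' X' X' (ide F X') \<delta> = pull F (stable_susp E X') Z' X' h (susp_ext E X')"
    using susp_morphism[OF cf t(2) _ h, of "ide F X'"] m t by auto
  then have hd: "pull F (stable_susp E X') Z' X' h (susp_ext E X') = \<delta>" using t by simp
  have O: "X \<in> Ob E" "Y \<in> Ob E" "Z \<in> Ob E" using tri Q by auto
  have UVW: "U \<in> arr ?R X Y" "V \<in> arr ?R Y Z" "W \<in> arr ?R Z (stable_susp E X)" using tri Q by auto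
  obtain u where u: "u \<in> arr F X Y" "U = quo X Y u" using stab.quot_arrE[OF _ _ UVW(1)] O by auto
  obtain v where v: "v \<in> arr F Y Z" "V = quo Y Z v" using stab.quot_arrE[OF _ _ UVW(2)] O by auto
  obtain w where w: "w \<in> arr F Z (stable_susp E X)" "W = quo Z (stable_susp E X) w"
    using stab.quot_arrE[OF _ _ UVW(3)] O by auto
  obtain A B C where tm: "triangle_morphism ?Q (stable_susp E) (stable_susp_arr E) (X,Y,Z,U,V,W) t' A B C"
    and isos: "iso_arr ?Q X X' A" "iso_arr ?Q Y Y' B" "iso_arr ?Q Z Z' C"
    using iso unfolding t'eq triangle_iso.simps by blast
  have lift: "\<exists>m m'. m \<in> arr F M M' \<and> m' \<in> arr F M' M \<and> G = quo M M' m \<and>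
      quo M M (cmp F M M' M m' m) = quo M M (ide F M) \<and> quo M' M' (cmp F M' M M' m m') = quo M' M' (ide F M')"
    if G: "iso_arr ?Q M M' G" and M: "M \<in> Ob E" "M' \<in> Ob E" for M M' G
  proof -
    obtain H where H: "G \<in> arr ?R M M'" "H \<in> arr ?R M' M" "cmp ?R M M' M H G = ide ?R M"
       "cmp ?R M' M M' G H = ide ?R M'"
      using G unfolding iso_arr_def Q by blast
    obtain m where m: "m \<in> arr F M M'" "G = quo M M' m" using stab.quot_arrE[OF _ _ H(1)] M by auto
    obtain m' where m': "m' \<in> arr F M' M" "H = quo M' M m'" using stab.quot_arrE[OF _ _ H(2)] M by auto
    show ?thesis using H(3,4) m m' M by (auto simp: stab.cmp_quot stab.ide_quot)
  qed
  obtain a a' where a: "a \<in> arr F X X'" "a' \<in> arr F X' X" "A = quo X X' a"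
    "quo X X (cmp F X X' X a' a) = quo X X (ide F X)" "quo X' X' (cmp F X' X X' a a') = quo X' X' (ide F X')"
    using lift[OF isos(1)] O t by blast
  obtain b b' where b: "b \<in> arr F Y Y'" "b' \<in> arr F Y' Y" "B = quo Y Y' b"
    "quo Y Y (cmp F Y Y' Y b' b) = quo Y Y (ide F Y)" "quo Y' Y' (cmp F Y' Y Y' b b') = quo Y' Y' (ide F Y')"
    using lift[OF isos(2)] O t by blast
  obtain c c' where c: "c \<in> arr F Z Z'" "c' \<in> arr F Z' Z" "C = quo Z Z' c"
    "quo Z Z (cmp F Z Z' Z c' c) = quo Z Z (ide F Z)" "quo Z' Z' (cmp F Z' Z Z' c c') = quo Z' Z' (ide F Z')"
    using lift[OF isos(3)] O t by blast
  have sq: "cmp ?R X Y Y' B U = cmp ?R X X' Y' (quo X' Y' f) A" "cmp ?R Y Z Z' C V = cmp ?R Y Y' Z' (quo Y' Z' g) B"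
    "cmp ?R Z (stable_susp E X) (stable_susp E X') (stable_susp_arr E X X' A) W
      = cmp ?R Z Z' (stable_susp E X') (quo Z' (stable_susp E X') h) C"
    using tm unfolding t'eq triangle_morphism.simps Q by blast+
  have 1: "quo X Y' (cmp F X Y Y' b u) = quo X Y' (cmp F X X' Y' f a)"
    using sq(1) O t u(1) a(1) b(1) unfolding u(2) a(3) b(3) by (simp add: stab.cmp_quot)
  have 2: "quo Y Z' (cmp F Y Z Z' c v) = quo Y Z' (cmp F Y Y' Z' g b)"
    using sq(2) O t v(1) c(1) b(1) unfolding v(2) c(3) b(3) by (simp add: stab.cmp_quot)
  have 3: "push F Z X X' a (pull F (stable_susp E X) Z X w (susp_ext E X)) = pull F Z' Z X' c \<delta>"
    using sq(3) unfolding w(2) a(3) c(3) susp_square_iff[OF O(1) t(2) O(3) t(4) a(1) c(1) w(1) h] hd .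
  show thesis
    by (rule that[OF O u(1) v(1) w(1) u(2) v(2) w(2) cf h hd a(1) b(1) c(1) a(2) b(2) c(2) 1 2 3 a(4,5) b(4,5) c(4,5)])
qed

lemma stable_dist_retract:
  assumes "(X,Y,Z,U,V,W) \<in> dist (stable_cat E)"
  obtains u v w where "u \<in> arr F X Y" "v \<in> arr F Y Z" "w \<in> arr F Z (stable_susp E X)"
    "U = quo X Y u" "V = quo Y Z v" "W = quo Z (stable_susp E X) w"
    "conflation_retract X Y Z u v (pull F (stable_susp E X) Z X w (susp_ext E X))"
proof -
  obtain u v w X' Y' Z' f g h \<delta> a b c a' b' c' where
    O: "X \<in> Ob E" "Y \<in> Ob E" "Z \<in> Ob E" and uvw: "u \<in> arr F X Y" "v \<in> arr F Y Z" "w \<in> arr F Z (stable_susp E X)"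
    "U = quo X Y u" "V = quo Y Z v" "W = quo Z (stable_susp E X) w" and
    cf: "(X',Y',Z',f,g,\<delta>) \<in> conflations E" and
    s: "a \<in> arr F X X'" "b \<in> arr F Y Y'" "c \<in> arr F Z Z'"
    "a' \<in> arr F X' X" "b' \<in> arr F Y' Y" "c' \<in> arr F Z' Z" and
    e: "quo X Y' (cmp F X Y Y' b u) = quo X Y' (cmp F X X' Y' f a)"
    "quo Y Z' (cmp F Y Z Z' c v) = quo Y Z' (cmp F Y Y' Z' g b)"
    "push F Z X X' a (pull F (stable_susp E X) Z X w (susp_ext E X)) = pull F Z' Z X' c \<delta>"
    "quo X X (cmp F X X' X a' a) = quo X X (ide F X)"
    "quo X' X' (cmp F X' X X' a a') = quo X' X' (ide F X')"
    "quo Y Y (cmp F Y Y' Y b' b) = quo Y Y (ide F Y)"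
    "quo Y' Y' (cmp F Y' Y Y' b b') = quo Y' Y' (ide F Y')"
    "quo Z Z (cmp F Z Z' Z c' c) = quo Z Z (ide F Z)"
    "quo Z' Z' (cmp F Z' Z Z' c c') = quo Z' Z' (ide F Z')"
    using stable_distE[OF assms] by metis
  note t = sub_conflation_arr[OF cf]
  let ?\<delta> = "pull F (stable_susp E X) Z X w (susp_ext E X)"
  have dc: "?\<delta> \<in> carrier (Ext F Z X)" using O uvw by simp
  \<comment> \<open>The isomorphism of triangles provides squares in one direction; composing with
    inverses on both sides gives the squares back.\<close>
  have inv_square: "quo M' N (cmp F M' N' N n' m') = quo M' N (cmp F M' M N m l')"
    if o: "M \<in> Ob F" "M' \<in> Ob F" "N \<in> Ob F" "N' \<in> Ob F"
      and a: "m \<in> arr F M N" "m' \<in> arr F M' N'" "l \<in> arr F M M'" "l' \<in> arr F M' M" "n \<in> arr F N N'" "n' \<in> arr F N' N"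
      and q: "quo M N' (cmp F M N N' n m) = quo M N' (cmp F M M' N' m' l)"
        "quo M' M' (cmp F M' M M' l l') = quo M' M' (ide F M')" "quo N N (cmp F N N' N n' n) = quo N N (ide F N)"
    for M M' N N' m m' l l' n n'
  proof -
    have "quo M' N (cmp F M' M N (cmp F M N' N n' (cmp F M N N' n m)) l')
       = quo M' N (cmp F M' M N (cmp F M N' N n' (cmp F M M' N' m' l)) l')"
      by (intro stab.quot_cmp_cong[OF _ _ _ _ _ refl] stab.quot_cmp_cong q) (use o a q in simp_all)
    moreover have "quo M' N (cmp F M' M' N (cmp F M' N' N n' m') (cmp F M' M M' l l'))
       = quo M' N (cmp F M' M' N (cmp F M' N' N n' m') (ide F M'))"
      by (intro stab.quot_cmp_cong q) (use o a q in simp_all)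
    moreover have "quo M' N (cmp F M' N N (cmp F N N' N n' n) (cmp F M' M N m l'))
       = quo M' N (cmp F M' N N (ide F N) (cmp F M' M N m l'))"
      by (intro stab.quot_cmp_cong q) (use o a q in simp_all)
    ultimately show ?thesis using o a by simp
  qed
  have 1: "quo X' Y (cmp F X' Y' Y b' f) = quo X' Y (cmp F X' X Y u a')"
    by (rule inv_square[of X X' Y Y' u f a a' b b']) (use O t s uvw e in simp_all)
  have 2: "quo Y' Z (cmp F Y' Z' Z c' g) = quo Y' Z (cmp F Y' Y Z v b')"
    by (rule inv_square[of Y Y' Z Z' v g b b' c c']) (use O t s uvw e in simp_all)
  \<comment> \<open>The same for extensions: \<open>\<delta>\<close> is recovered by pulling back
    along \<open>c\<close> and then \<open>c'\<close>, and the first pull-back is known from the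
    third square.\<close>
  have "pull F Z' Z' X' (cmp F Z' Z Z' c c') \<delta> = pull F Z' Z' X' (ide F Z') \<delta>"
    by (rule pull_cong) (use O t s e in simp_all)
  then have "\<delta> = pull F Z Z' X' c' (pull F Z' Z X' c \<delta>)" using O t s by simp
  also have "\<dots> = pull F Z Z' X' c' (push F Z X X' a ?\<delta>)" using e(3) by simp
  finally have "push F Z' X' X a' \<delta> = push F Z' X' X a' (pull F Z Z' X' c' (push F Z X X' a ?\<delta>))"
    by simp
  also have "\<dots> = pull F Z Z' X c' (push F Z X X (cmp F X X' X a' a) ?\<delta>)"
    using O t s uvw(1-3) by simp
  also have "push F Z X X (cmp F X X' X a' a) ?\<delta> = push F Z X X (ide F X) ?\<delta>"
    by (rule push_cong) (use O t s e dc in \<open>simp_all del: ext_map_comp\<close>)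
  finally have 3: "push F Z' X' X a' \<delta> = pull F Z Z' X c' ?\<delta>" using O uvw(1-3) by simp
  have "conflation_retract X Y Z u v ?\<delta>"
    unfolding conflation_retract_def using O uvw(1,2) dc cf s e(1,2,3,4,8) 1 2 3 by blast
  then show thesis using that uvw by blast
qed

lemma stable_dist_conflation:
  assumes cf: "(X,Y,Z,f,g,\<delta>) \<in> conflations E" and h: "h \<in> arr F Z (stable_susp E X)"
    and hd: "pull F (stable_susp E X) Z X h (susp_ext E X) = \<delta>"
  shows "(X,Y,Z,quo X Y f,quo Y Z g,quo Z (stable_susp E X) h) \<in> dist (stable_cat E)"
proof -
  let ?Q = "quot_cat E (proj_inj E)" and ?R = "quot_cat F (proj_inj E)"
  let ?t = "(X,Y,Z,quo X Y f,quo Y Z g,quo Z (stable_susp E X) h)"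
  have Q: "Ob ?Q = Ob E" "Hom ?Q = Hom ?R" "cmp ?Q = cmp ?R" "ide ?Q = ide ?R"
    using quot_cat_cong[OF sub_Hom sub_cmp sub_ide] by (simp_all add: quot_cat_def)
  note t = sub_conflation_arr[OF cf]
  interpret R: linear_category K ?R by (rule stab.linear_category_quot)
  have "push F Z X X (ide F X) \<delta> = pull F (stable_susp E X) Z X h (susp_ext E X)" using hd t by simp
  then have "\<exists>b. confl_morphism E (X,Y,Z,f,g,\<delta>) (susp_confl E X) (ide E X) b h"
    unfolding sub_ide using susp_morphism[OF cf t(2) _ h, of "ide F X"] t by auto
  then have st: "?t \<in> stable_standard E"
    unfolding stable_standard_def quot_arr_sub using cf by blast
  have tri: "is_triangle ?Q (stable_susp E) ?t"
    using Q t h by (simp add: stab.quot_arrI)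
  have id: "iso_arr ?Q M M (ide ?R M)" if "M \<in> Ob E" for M
    unfolding iso_arr_def Q using that by (auto intro!: bexI[of _ "ide ?R M"])
  \<comment> \<open>The triangle enters the closure under isomorphism through its identity morphism,
    whose third square involves the suspension of an identity.\<close>
  have ia: "stable_susp_arr E X X (ide ?R X) = quo (stable_susp E X) (stable_susp E X) (ide F (stable_susp E X))"
    unfolding stab.ide_quot by (rule stable_susp_arr_eq) (use t in simp_all)
  have qa: "quo X Y f \<in> arr ?R X Y" "quo Y Z g \<in> arr ?R Y Z" "quo Z (stable_susp E X) h \<in> arr ?R Z (stable_susp E X)"
    using t h by (simp_all add: stab.quot_arrI)
  have "triangle_morphism ?Q (stable_susp E) (stable_susp_arr E) ?t ?t (ide ?R X) (ide ?R Y) (ide ?R Z)"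
    unfolding triangle_morphism.simps Q ia stab.ide_quot[symmetric] using t qa by simp
  then have "triangle_iso ?Q (stable_susp E) (stable_susp_arr E) ?t ?t"
    unfolding triangle_iso.simps using id t by blast
  then have "?t \<in> triangle_iso_closure ?Q (stable_susp E) (stable_susp_arr E) (stable_standard E)"
    unfolding triangle_iso_closure_def using st tri by blast
  then show ?thesis by (simp add: stable_cat_def Let_def)
qed

end

lemma (in frobenius_extriangulated) stable_subcategory_self: "stable_subcategory K E E"
proof (intro stable_subcategory.intro stable_subcategory_axioms.intro)
  show "extriangulated K E" by (rule extriangulated_axioms)
  show "Ob E \<noteq> {}" using ex_zero_object by (auto simp: zero_object_def)
  show "\<And>A B Z x y \<delta>. ((A,B,Z,x,y,\<delta>) \<in> conflations E) \<longleftrightarrow>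
      (A,B,Z,x,y,\<delta>) \<in> conflations E \<and> A \<in> Ob E \<and> B \<in> Ob E \<and> Z \<in> Ob E"
    using conflation_arr by blast
  show "\<And>M N S i j p q. M \<in> Ob E \<Longrightarrow> N \<in> Ob E \<Longrightarrow> biproduct E M N S i j p q \<Longrightarrow> S \<in> Ob E"
    by (simp add: biproduct_def)
  show "\<And>P M \<delta>. P \<in> proj_inj E \<Longrightarrow> M \<in> Ob E \<Longrightarrow> \<delta> \<in> carrier (Ext E M P) \<Longrightarrow> \<delta> = \<zero>\<^bsub>Ext E M P\<^esub>"
    using orthogonal_injective orthogonalD by (auto simp: proj_inj_def)
  show "\<And>P M \<delta>. P \<in> proj_inj E \<Longrightarrow> M \<in> Ob E \<Longrightarrow> \<delta> \<in> carrier (Ext E P M) \<Longrightarrow> \<delta> = \<zero>\<^bsub>Ext E P M\<^esub>"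
    using orthogonal_projective orthogonalD by (auto simp: proj_inj_def)
  show "\<And>A. A \<in> Ob E \<Longrightarrow> \<exists>P Z x y \<delta>. (A,P,Z,x,y,\<delta>) \<in> conflations E \<and> injective E P"
    by (rule enough_injectives)
  show "\<And>P. injective E P \<Longrightarrow> projective E P" by (simp add: projective_iff_injective)
qed simp_all

section \<open>The reduction of a stably 2-Calabi--Yau category\<close>

locale calabi_yau_reduction = frobenius_extriangulated K F
  for K :: "('k,'r) ring_scheme" and F :: "('k,'o,'m,'e) excat" +
  fixes \<X> :: "'o set"
  assumes calabi_yau: "stably_two_calabi_yau K F"
    and X_ob: "\<X> \<subseteq> Ob F"
    and X_rigid: "rigid F \<X>"
    and X_finite: "functorially_finite F \<X>"

sublocale calabi_yau_reduction \<subseteq> S: stable_subcategory K F F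
  by (rule stable_subcategory_self)

context calabi_yau_reduction
begin

declare S.ob [simp del]

text \<open>\<open>ext1\<close> consists of stable maps into a suspension, so the representing
  property turns its vanishing into that of the extensions of \<open>F\<close>. The duality can then
  be read as a statement about \<open>Ext F\<close>.\<close>

lemma carrier_ext1_iff:
  assumes M: "M \<in> Ob F" and N: "N \<in> Ob F"
  shows "carrier (ext1 (stable_cat F) M N) = {\<zero>\<^bsub>ext1 (stable_cat F) M N\<^esub>} \<longleftrightarrow> orthogonal M N"
proof -
  let ?S = "stable_susp F N" and ?\<sigma> = "susp_ext F N"
  have s: "?S \<in> Ob F" "?\<sigma> \<in> carrier (Ext F ?S N)" using N by auto
  have c: "carrier (ext1 (stable_cat F) M N) = S.quo M ?S ` arr F M ?S"
    and z: "\<zero>\<^bsub>ext1 (stable_cat F) M N\<^esub> = S.quo M ?S \<zero>\<^bsub>Hom F M ?S\<^esub>"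
    using M s by (simp_all add: ext1_def S.stab.arr_quot S.stab.zero_quot)
  have "pull F ?S M N \<zero>\<^bsub>Hom F M ?S\<^esub> ?\<sigma> = \<zero>\<^bsub>Ext F M N\<^esub>" using M N s by simp
  then have k: "S.quo M ?S k = S.quo M ?S \<zero>\<^bsub>Hom F M ?S\<^esub> \<longleftrightarrow> pull F ?S M N k ?\<sigma> = \<zero>\<^bsub>Ext F M N\<^esub>"
    if "k \<in> arr F M ?S" for k
    using S.represents_eq_iff[OF S.represents_susp[OF N] M that, of "\<zero>\<^bsub>Hom F M ?S\<^esub>"] M s by simp
  have "orthogonal M N \<longleftrightarrow> (\<forall>k\<in>arr F M ?S. pull F ?S M N k ?\<sigma> = \<zero>\<^bsub>Ext F M N\<^esub>)"
  proof
    assume "orthogonal M N"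
    then show "\<forall>k\<in>arr F M ?S. pull F ?S M N k ?\<sigma> = \<zero>\<^bsub>Ext F M N\<^esub>"
      using orthogonalD M N s by simp
  next
    assume "\<forall>k\<in>arr F M ?S. pull F ?S M N k ?\<sigma> = \<zero>\<^bsub>Ext F M N\<^esub>"
    then show "orthogonal M N"
      unfolding orthogonal_def using S.represents_ex[OF S.represents_susp[OF N] M] by metis
  qed
  also have "\<dots> \<longleftrightarrow> (\<forall>k\<in>arr F M ?S. S.quo M ?S k = S.quo M ?S \<zero>\<^bsub>Hom F M ?S\<^esub>)" using k by blast
  also have "\<dots> \<longleftrightarrow> S.quo M ?S ` arr F M ?S = {S.quo M ?S \<zero>\<^bsub>Hom F M ?S\<^esub>}"
    using hom_closed(1)[OF M s(1)] by blast
  finally show ?thesis unfolding c z by blast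
qed

text \<open>If \<open>Ext(N, M)\<close> vanishes, then its dual has only one element, hence so has \<open>Ext(M, N)\<close>.\<close>

lemma orthogonal_sym:
  assumes M: "M \<in> Ob F" and N: "N \<in> Ob F" and "orthogonal N M"
  shows "orthogonal M N"
proof -
  let ?T = "stable_cat F"
  let ?A = "ext1 ?T M N" and ?B = "ext1 ?T N M"
  obtain \<phi> where "bij_betw (\<phi> M N) (carrier ?A) (carrier (dual_module K ?B))"
    using calabi_yau M N unfolding stably_two_calabi_yau_def two_calabi_yau_def by (auto simp: S.Ob_stable)
  then have inj: "inj_on (\<phi> M N) (carrier ?A)" and im: "\<phi> M N ` carrier ?A = carrier (dual_module K ?B)"
    by (auto simp: bij_betw_def)
  have B: "carrier ?B = {\<zero>\<^bsub>?B\<^esub>}" using carrier_ext1_iff[OF N M] assms by simp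
  interpret mB: module K ?B using M N by (simp add: ext1_def S.stab.hom_module_quot)
  interpret R: linear_category K "quot_cat F (proj_inj F)" by (rule S.stab.linear_category_quot)
  have dual_zero: "\<psi> = (\<lambda>x\<in>carrier ?B. \<zero>\<^bsub>K\<^esub>)" if "\<psi> \<in> carrier (dual_module K ?B)" for \<psi>
  proof -
    have ext: "\<psi> \<in> extensional (carrier ?B)" and lin: "linear_map K ?B (self_module K) \<psi>"
      using that by (auto simp: dual_module_def)
    have "\<psi> \<zero>\<^bsub>?B\<^esub> \<in> carrier K"
      using linear_map_closed[OF lin, of "\<zero>\<^bsub>?B\<^esub>"] by (simp add: self_module_def)
    then have "\<psi> \<zero>\<^bsub>?B\<^esub> = \<zero>\<^bsub>K\<^esub>"
      using linear_map_smult[OF lin, of "\<zero>\<^bsub>K\<^esub>" "\<zero>\<^bsub>?B\<^esub>"] by (simp add: self_module_def)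
    then show ?thesis
      using ext B by (intro extensionalityI[OF ext restrict_extensional]) auto
  qed
  have "x = y" if "x \<in> carrier ?A" "y \<in> carrier ?A" for x y
  proof (rule inj_onD[OF inj _ that])
    have "\<phi> M N x \<in> carrier (dual_module K ?B)" "\<phi> M N y \<in> carrier (dual_module K ?B)"
      unfolding im[symmetric] using that by (auto intro: imageI)
    then show "\<phi> M N x = \<phi> M N y" by (metis dual_zero)
  qed
  moreover have "\<zero>\<^bsub>?A\<^esub> \<in> carrier ?A" using M N by (simp add: ext1_def)
  ultimately have "carrier ?A = {\<zero>\<^bsub>?A\<^esub>}" by blast
  then show ?thesis using carrier_ext1_iff[OF M N] by simp
qed

section \<open>The perpendicular subcategory and its relative projective-injectives\<close>

abbreviation \<U> :: "'o set" where "\<U> \<equiv> ext_perp F \<X>"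

abbreviation FU :: "('k,'o,'m,'e) excat" where "FU \<equiv> ext_subcat F \<U>"

text \<open>Phrased by vanishing extensions in \<open>F\<close> rather than by lifting properties,
  so that it passes to sums and summands formed in the stable category. It turns out to be the class
  of projective-injectives of \<open>FU\<close>.\<close>

definition relative_proj_inj :: "'o set" where
  "relative_proj_inj = {P \<in> \<U>. \<forall>M\<in>\<U>. orthogonal M P \<and> orthogonal P M}"

abbreviation addX :: "'o set" where "addX \<equiv> add_closure (stable_cat F) \<X>"

lemma perp_iff: "M \<in> \<U> \<longleftrightarrow> M \<in> Ob F \<and> (\<forall>X\<in>\<X>. orthogonal X M)"
  unfolding ext_perp_def using carrier_ext_zero_iff X_ob by blast

lemma perp_ob [simp]: "M \<in> \<U> \<Longrightarrow> M \<in> Ob F"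
  by (simp add: perp_iff)

lemma perp_iff_left: "M \<in> \<U> \<longleftrightarrow> M \<in> Ob F \<and> (\<forall>X\<in>\<X>. orthogonal M X)"
  unfolding perp_iff using orthogonal_sym X_ob by blast

text \<open>The two sides of the equivalence use opposite orders: \<open>\<U>\<close> tests
  extensions of objects of \<open>\<X>\<close>, the reduction tests extensions by them. Symmetry of
  vanishing reconciles them.\<close>

lemma ext1_perp_eq: "ext1_perp (stable_cat F) \<X> = \<U>"
proof -
  have "(\<forall>X\<in>\<X>. carrier (ext1 (stable_cat F) M X) = {\<zero>\<^bsub>ext1 (stable_cat F) M X\<^esub>}) \<longleftrightarrow>
      (\<forall>X\<in>\<X>. orthogonal M X)" if M: "M \<in> Ob F" for M
    by (rule ball_cong[OF refl carrier_ext1_iff[OF M]]) (use X_ob in blast)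
  then have "M \<in> ext1_perp (stable_cat F) \<X> \<longleftrightarrow> M \<in> Ob F \<and> (\<forall>X\<in>\<X>. orthogonal M X)" for M
    unfolding ext1_perp_def mem_Collect_eq S.Ob_stable by (rule conj_cong[OF refl])
  then show ?thesis unfolding set_eq_iff perp_iff_left by (rule allI)
qed

lemma relative_ob [simp]: "P \<in> relative_proj_inj \<Longrightarrow> P \<in> Ob F"
  by (simp add: relative_proj_inj_def)

lemma relative_perp: "P \<in> relative_proj_inj \<Longrightarrow> P \<in> \<U>"
  by (simp add: relative_proj_inj_def)

lemma relative_orthogonal:
  "P \<in> relative_proj_inj \<Longrightarrow> M \<in> \<U> \<Longrightarrow> orthogonal M P" "P \<in> relative_proj_inj \<Longrightarrow> M \<in> \<U> \<Longrightarrow> orthogonal P M"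
  by (simp_all add: relative_proj_inj_def)

lemma X_relative: "X \<in> \<X> \<Longrightarrow> X \<in> relative_proj_inj"
  using X_rigid perp_iff perp_iff_left unfolding relative_proj_inj_def rigid_def by blast

text \<open>Membership in \<open>\<U>\<close> follows from the first vanishing condition: rigidity
  puts \<open>\<X>\<close> into \<open>\<U>\<close>, so vanishing against \<open>\<U>\<close>
  includes vanishing against \<open>\<X>\<close>.\<close>

lemma relativeI:
  assumes "P \<in> Ob F" "\<And>M. M \<in> \<U> \<Longrightarrow> orthogonal M P" "\<And>M. M \<in> \<U> \<Longrightarrow> orthogonal P M"
  shows "P \<in> relative_proj_inj"
proof -
  have "orthogonal X P" if "X \<in> \<X>" for X
    using assms(2) relative_perp X_relative that by blast
  then show ?thesis unfolding relative_proj_inj_def using assms perp_iff by blast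
qed

lemma proj_inj_relative:
  assumes "P \<in> proj_inj F" shows "P \<in> relative_proj_inj"
proof (rule relativeI)
  have P: "injective F P" "projective F P" using assms by (simp_all add: proj_inj_def)
  show "P \<in> Ob F" using P(1) by (simp add: injective_def)
  show "orthogonal M P" "orthogonal P M" if "M \<in> \<U>" for M
    using orthogonal_injective[OF P(1)] orthogonal_projective[OF P(2)] that by simp_all
qed

text \<open>Every map into or out of \<open>I\<close> factors through \<open>I\<close>
  itself.\<close>

lemma zero_object_proj_inj:
  assumes "I \<in> proj_inj F" shows "zero_object (stable_cat F) I"
proof -
  have I: "I \<in> Ob F" using assms by (rule S.proj_inj_ob)
  have into: "S.quo M I ` arr F M I = {S.quo M I \<zero>\<^bsub>Hom F M I\<^esub>}" if M: "M \<in> Ob F" for M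
  proof -
    have "S.quo M I f = S.quo M I \<zero>\<^bsub>Hom F M I\<^esub>" if f: "f \<in> arr F M I" for f
      using factoringI[OF assms f ide_arr[OF I]] M I f by (simp add: S.stab.quot_eq_zero_iff)
    then show ?thesis using hom_closed(1)[OF M I] by blast
  qed
  have out: "S.quo I M ` arr F I M = {S.quo I M \<zero>\<^bsub>Hom F I M\<^esub>}" if M: "M \<in> Ob F" for M
  proof -
    have "S.quo I M f = S.quo I M \<zero>\<^bsub>Hom F I M\<^esub>" if f: "f \<in> arr F I M" for f
      using factoringI[OF assms ide_arr[OF I] f] M I f by (simp add: S.stab.quot_eq_zero_iff)
    then show ?thesis using hom_closed(1)[OF I M] by blast
  qed
  show ?thesis
    unfolding zero_object_def S.Ob_stable S.stable_cat_simps
  proof (intro conjI ballI I)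
    fix M assume M: "M \<in> Ob F"
    show "arr (quot_cat F (proj_inj F)) M I = {\<zero>\<^bsub>Hom (quot_cat F (proj_inj F)) M I\<^esub>}"
      unfolding S.stab.arr_quot[OF M I] S.stab.zero_quot[OF M I] by (rule into[OF M])
    show "arr (quot_cat F (proj_inj F)) I M = {\<zero>\<^bsub>Hom (quot_cat F (proj_inj F)) I M\<^esub>}"
      unfolding S.stab.arr_quot[OF I M] S.stab.zero_quot[OF I M] by (rule out[OF M])
  qed
qed

lemma biproduct_stable:
  "biproduct F X Y S i j p q \<Longrightarrow>
    biproduct (stable_cat F) X Y S (S.quo X S i) (S.quo Y S j) (S.quo S X p) (S.quo S Y q)"
  using S.stab.biproduct_quot[of X Y S i j p q]
  by (subst biproduct_cong[of "stable_cat F" "quot_cat F (proj_inj F)"]) simp_all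

text \<open>The closure is taken in the stable category, so lifted sums and summands satisfy their
  identities only modulo maps through projective-injectives of \<open>F\<close>. Extensions do not
  notice this error. For a stable zero object the identity itself is such a map, and all its
  extensions vanish.\<close>

lemma addX_relative: "P \<in> addX \<Longrightarrow> P \<in> relative_proj_inj"
proof (induction rule: add_closure.induct)
  case (base X)
  then show ?case by (simp add: X_relative)
next
  case (zero Z)
  then have Z: "Z \<in> Ob F" and z: "arr (quot_cat F (proj_inj F)) Z Z = {\<zero>\<^bsub>Hom (quot_cat F (proj_inj F)) Z Z\<^esub>}"
    by (auto simp: zero_object_def)
  have "S.quo Z Z (ide F Z) = S.quo Z Z \<zero>\<^bsub>Hom F Z Z\<^esub>"
    using z S.stab.quot_arrI[OF Z Z ide_arr[OF Z]] Z by (simp add: S.stab.zero_quot)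
  then have id: "ide F Z \<in> factoring F (proj_inj F) Z Z"
    using S.stab.quot_eq_zero_iff[OF Z Z] Z by simp
  show ?case
  proof (rule relativeI[OF Z])
    fix M assume M: "M \<in> \<U>"
    show "orthogonal M Z" "orthogonal Z M"
      unfolding orthogonal_def using S.ext_map_factoring_co[OF perp_ob[OF M] Z Z _ id]
        S.ext_map_factoring_contra[OF Z perp_ob[OF M] Z _ id] Z M by auto
  qed
next
  case (sum X Y S i j p q)
  have XY: "X \<in> Ob F" "Y \<in> Ob F" using sum.IH by simp_all
  have b: "S \<in> Ob F" "i \<in> arr (quot_cat F (proj_inj F)) X S" "j \<in> arr (quot_cat F (proj_inj F)) Y S"
    "p \<in> arr (quot_cat F (proj_inj F)) S X" "q \<in> arr (quot_cat F (proj_inj F)) S Y"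
    "cmp (quot_cat F (proj_inj F)) S X S i p \<oplus>\<^bsub>Hom (quot_cat F (proj_inj F)) S S\<^esub>
     cmp (quot_cat F (proj_inj F)) S Y S j q = ide (quot_cat F (proj_inj F)) S"
    using sum.hyps(3) by (auto simp: biproduct_def)
  obtain i' where i: "i' \<in> arr F X S" "i = S.quo X S i'" by (rule S.stab.quot_arrE[OF XY(1) b(1,2)])
  obtain j' where j: "j' \<in> arr F Y S" "j = S.quo Y S j'" by (rule S.stab.quot_arrE[OF XY(2) b(1,3)])
  obtain p' where p: "p' \<in> arr F S X" "p = S.quo S X p'" by (rule S.stab.quot_arrE[OF b(1) XY(1) b(4)])
  obtain q' where q: "q' \<in> arr F S Y" "q = S.quo S Y q'" by (rule S.stab.quot_arrE[OF b(1) XY(2) b(5)])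
  let ?s = "cmp F S X S i' p' \<oplus>\<^bsub>Hom F S S\<^esub> cmp F S Y S j' q'"
  have s: "S.quo S S ?s = S.quo S S (ide F S)"
    using b(6) b(1) XY i j p q by (simp add: S.stab.cmp_quot S.stab.add_quot S.stab.ide_quot)
  have sc: "?s \<in> arr F S S" using b(1) XY i j p q by simp
  show ?case
  proof (rule relativeI[OF b(1)])
    fix M assume M: "M \<in> \<U>"
    note o1 = relative_orthogonal[OF sum.IH(1) M] and o2 = relative_orthogonal[OF sum.IH(2) M]
    show "orthogonal M S"
      unfolding orthogonal_def
    proof
      fix \<epsilon> assume e: "\<epsilon> \<in> carrier (Ext F M S)"
      have "push F M S X p' \<epsilon> = \<zero>\<^bsub>Ext F M X\<^esub>" "push F M S Y q' \<epsilon> = \<zero>\<^bsub>Ext F M Y\<^esub>"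
        using orthogonalD[OF o1(1)] orthogonalD[OF o2(1)] b(1) XY M e p q by simp_all
      then have "push F M X S i' (push F M S X p' \<epsilon>) = \<zero>\<^bsub>Ext F M S\<^esub>"
        "push F M Y S j' (push F M S Y q' \<epsilon>) = \<zero>\<^bsub>Ext F M S\<^esub>" using b(1) XY M i j by simp_all
      then have "push F M S S ?s \<epsilon> = \<zero>\<^bsub>Ext F M S\<^esub>"
        using b(1) XY M e i j p q by (simp add: ext_map_co_add)
      moreover have "push F M S S ?s \<epsilon> = push F M S S (ide F S) \<epsilon>"
        by (rule S.push_cong) (use s sc b(1) M e in simp_all)
      ultimately show "\<epsilon> = \<zero>\<^bsub>Ext F M S\<^esub>" using b(1) M e by simp
    qed
    show "orthogonal S M"
      unfolding orthogonal_def
    proof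
      fix \<epsilon> assume e: "\<epsilon> \<in> carrier (Ext F S M)"
      have "pull F S X M i' \<epsilon> = \<zero>\<^bsub>Ext F X M\<^esub>" "pull F S Y M j' \<epsilon> = \<zero>\<^bsub>Ext F Y M\<^esub>"
        using orthogonalD[OF o1(2)] orthogonalD[OF o2(2)] b(1) XY M e i j by simp_all
      then have "pull F X S M p' (pull F S X M i' \<epsilon>) = \<zero>\<^bsub>Ext F S M\<^esub>"
        "pull F Y S M q' (pull F S Y M j' \<epsilon>) = \<zero>\<^bsub>Ext F S M\<^esub>" using b(1) XY M p q by simp_all
      then have "pull F S S M ?s \<epsilon> = \<zero>\<^bsub>Ext F S M\<^esub>"
        using b(1) XY M e i j p q by (simp add: ext_map_contra_add)
      moreover have "pull F S S M ?s \<epsilon> = pull F S S M (ide F S) \<epsilon>"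
        by (rule S.pull_cong) (use s sc b(1) M e in simp_all)
      ultimately show "\<epsilon> = \<zero>\<^bsub>Ext F S M\<^esub>" using b(1) M e by simp
    qed
  qed
next
  case (summand S X Y i j p q)
  have S: "S \<in> Ob F" using summand.IH by simp
  have b: "X \<in> Ob F" "i \<in> arr (quot_cat F (proj_inj F)) X S" "p \<in> arr (quot_cat F (proj_inj F)) S X"
    "cmp (quot_cat F (proj_inj F)) X S X p i = ide (quot_cat F (proj_inj F)) X"
    using summand.hyps(2) by (auto simp: biproduct_def)
  obtain i' where i: "i' \<in> arr F X S" "i = S.quo X S i'" by (rule S.stab.quot_arrE[OF b(1) S b(2)])
  obtain p' where p: "p' \<in> arr F S X" "p = S.quo S X p'" by (rule S.stab.quot_arrE[OF S b(1) b(3)])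
  have pi: "S.quo X X (cmp F X S X p' i') = S.quo X X (ide F X)"
    using b(4) S b(1) i p by (simp add: S.stab.cmp_quot S.stab.ide_quot)
  show ?case
  proof (rule relativeI[OF b(1)])
    fix M assume M: "M \<in> \<U>"
    note o = relative_orthogonal[OF summand.IH M]
    show "orthogonal M X"
      unfolding orthogonal_def
    proof
      fix \<epsilon> assume e: "\<epsilon> \<in> carrier (Ext F M X)"
      have "push F M X S i' \<epsilon> = \<zero>\<^bsub>Ext F M S\<^esub>" using orthogonalD[OF o(1)] b(1) S M e i by simp
      then have "push F M S X p' (push F M X S i' \<epsilon>) = \<zero>\<^bsub>Ext F M X\<^esub>" using b(1) S M p by simp
      then have "push F M X X (cmp F X S X p' i') \<epsilon> = \<zero>\<^bsub>Ext F M X\<^esub>" using b(1) S M e i p by simp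
      moreover have "push F M X X (cmp F X S X p' i') \<epsilon> = push F M X X (ide F X) \<epsilon>"
        by (rule S.push_cong) (use pi b(1) S i p M e in simp_all)
      ultimately show "\<epsilon> = \<zero>\<^bsub>Ext F M X\<^esub>" using b(1) M e by simp
    qed
    show "orthogonal X M"
      unfolding orthogonal_def
    proof
      fix \<epsilon> assume e: "\<epsilon> \<in> carrier (Ext F X M)"
      have "pull F X S M p' \<epsilon> = \<zero>\<^bsub>Ext F S M\<^esub>" using orthogonalD[OF o(2)] b(1) S M e p by simp
      then have "pull F S X M i' (pull F X S M p' \<epsilon>) = \<zero>\<^bsub>Ext F X M\<^esub>" using b(1) S M i by simp
      then have "pull F X X M (cmp F X S X p' i') \<epsilon> = \<zero>\<^bsub>Ext F X M\<^esub>" using b(1) S M e i p by simp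
      moreover have "pull F X X M (cmp F X S X p' i') \<epsilon> = pull F X X M (ide F X) \<epsilon>"
        by (rule S.pull_cong) (use pi b(1) S i p M e in simp_all)
      ultimately show "\<epsilon> = \<zero>\<^bsub>Ext F X M\<^esub>" using b(1) M e by simp
    qed
  qed
qed

text \<open>An extension of \<open>Z\<close> by \<open>X\<close> dies on \<open>P\<close>, hence is
  a push-out of \<open>\<delta>\<close> along some \<open>k\<close>; factoring \<open>k\<close>
  through \<open>u\<close> makes it zero because the push-out along \<open>u\<close> is. Retracts
  and stable factorisations are allowed since the lemma serves both conflations and the triangles
  fixed in the reduction.\<close>

lemma perp_of_retract:
  assumes r: "S.conflation_retract Y P Z u v \<delta>" and P: "P \<in> \<U>"
    and approx: "\<And>X g. X \<in> \<X> \<Longrightarrow> g \<in> arr F Y X \<Longrightarrow> \<exists>h\<in>arr F P X. S.quo Y X (cmp F Y P X h u) = S.quo Y X g"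
  shows "Z \<in> \<U>"
  unfolding perp_iff_left orthogonal_def
proof (intro conjI ballI)
  note t = S.retract_arr[OF r]
  show "Z \<in> Ob F" using t by simp
  fix X \<epsilon> assume X: "X \<in> \<X>" and e: "\<epsilon> \<in> carrier (Ext F Z X)"
  have XO: "X \<in> Ob F" using X X_ob by blast
  have "pull F Z P X v \<epsilon> = \<zero>\<^bsub>Ext F P X\<^esub>"
    using orthogonalD[OF relative_orthogonal(1)[OF X_relative[OF X] P]] t XO e by simp
  then obtain k where k: "k \<in> arr F Y X" "\<epsilon> = push F Z Y X k \<delta>"
    by (rule S.retract_ext_push[OF r XO e])
  obtain h where h: "h \<in> arr F P X" "S.quo Y X (cmp F Y P X h u) = S.quo Y X k"
    using approx[OF X k(1)] by blast
  have "\<epsilon> = push F Z Y X (cmp F Y P X h u) \<delta>"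
    unfolding k(2) by (rule S.push_cong) (use t XO k(1) h in simp_all)
  also have "\<dots> = push F Z P X h (push F Z Y P u \<delta>)" using t XO h by simp
  also have "\<dots> = \<zero>\<^bsub>Ext F Z X\<^esub>" unfolding S.retract_push_zero[OF r] using t XO h by simp
  finally show "\<epsilon> = \<zero>\<^bsub>Ext F Z X\<^esub>" .
qed

text \<open>The summand \<open>I\<close> turns the approximation into an inflation and vanishes
  stably, so \<open>P\<close> stays in \<open>addX\<close>. The conflation provides an object of
  \<open>\<U>\<close>, enough injectives in \<open>FU\<close>, and the triangles behind the
  suspension of the reduction.\<close>

lemma approx_conflation:
  assumes Y: "Y \<in> Ob F"
  obtains P Z x y \<delta> where "(Y,P,Z,x,y,\<delta>) \<in> conflations F" "P \<in> addX" "Z \<in> \<U>"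
proof -
  obtain X f where X: "X \<in> \<X>" and f: "f \<in> arr F Y X"
    and fX: "\<And>X' g. X' \<in> \<X> \<Longrightarrow> g \<in> arr F Y X' \<Longrightarrow> \<exists>h\<in>arr F X X'. cmp F Y X X' h f = g"
    using X_finite Y unfolding functorially_finite_def left_approximation_def by blast
  obtain I Z' i p \<sigma> where c: "(Y,I,Z',i,p,\<sigma>) \<in> conflations F" and I: "injective F I"
    using enough_injectives[OF Y] by blast
  have XO: "X \<in> Ob F" and IO: "I \<in> Ob F" using X X_ob I by (auto simp: injective_def)
  have IP: "I \<in> proj_inj F" using I S.proj_injI by blast
  obtain P k l m n where b: "biproduct F X I P k l m n" using ex_biproduct[OF XO IO] by blast
  then have bt: "P \<in> Ob F" "k \<in> arr F X P" "l \<in> arr F I P" "m \<in> arr F P X"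
    "cmp F X P X m k = ide F X" "cmp F I P X m l = \<zero>\<^bsub>Hom F I X\<^esub>"
    by (auto simp: biproduct_def)
  let ?x = "cmp F Y X P k f \<oplus>\<^bsub>Hom F Y P\<^esub> cmp F Y I P l i"
  note t = conflation_arr[OF c]
  obtain Z y \<delta> where cf: "(Y,P,Z,?x,y,\<delta>) \<in> conflations F"
    using inflation_pair[OF c XO f b] by blast
  have PA: "P \<in> addX"
  proof (rule add_closure.sum[OF _ _ biproduct_stable[OF b]])
    show "X \<in> addX" using X XO by (simp add: add_closure.base)
    show "I \<in> addX" using zero_object_proj_inj[OF IP] by (rule add_closure.zero)
  qed
  \<comment> \<open>Projecting to \<open>X\<close> recovers \<open>f\<close>, so whatever factors
    through \<open>f\<close> factors through \<open>?x\<close>.\<close>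
  have mx: "cmp F Y P X m ?x = f"
  proof -
    have "cmp F Y P X m (cmp F Y X P k f) = f" "cmp F Y P X m (cmp F Y I P l i) = \<zero>\<^bsub>Hom F Y X\<^esub>"
      using bt t XO IO f cmp_assoc[of Y X P X f k m] cmp_assoc[of Y I P X i l m] by auto
    then show ?thesis using bt t XO IO f by simp
  qed
  have "Z \<in> \<U>"
  proof (rule perp_of_retract[OF S.conflation_is_retract[OF cf]])
    show "P \<in> \<U>" using PA addX_relative relative_perp by blast
    fix X' g assume X': "X' \<in> \<X>" and g: "g \<in> arr F Y X'"
    obtain h where h: "h \<in> arr F X X'" "cmp F Y X X' h f = g" using fX[OF X' g] by blast
    have "X' \<in> Ob F" using X' X_ob by blast
    then have "cmp F P X X' h m \<in> arr F P X'" "cmp F Y P X' (cmp F P X X' h m) ?x = g"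
      using h bt XO f Y mx t cmp_assoc[of Y P X X' ?x m h] by (simp_all del: cmp_bilinear)
    then show "\<exists>h\<in>arr F P X'. S.quo Y X' (cmp F Y P X' h ?x) = S.quo Y X' g" by auto
  qed
  then show thesis using that cf PA by blast
qed

section \<open>The Frobenius structure on the perpendicular subcategory\<close>

lemma FU_simps [simp]: "Ob FU = \<U>" "Hom FU = Hom F" "cmp FU = cmp F" "ide FU = ide F" "ext_map FU = ext_map F"
  "Ext FU = Ext F"
  by (simp_all add: ext_subcat_def)

lemma FU_conflations:
  "(A,B,Z,x,y,\<delta>) \<in> conflations FU \<longleftrightarrow> (A,B,Z,x,y,\<delta>) \<in> conflations F \<and> A \<in> \<U> \<and> B \<in> \<U> \<and> Z \<in> \<U>"
proof -
  have "rlz FU Z A \<delta> = {(B,x,y). (B,x,y) \<in> rlz F Z A \<delta> \<and> B \<in> \<U>}" by (simp add: ext_subcat_def)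
  then show ?thesis unfolding conflations_def using perp_ob by auto
qed

text \<open>The obstructions to lifting along deflations and extending along inflations lie in
  \<open>Ext F P A\<close> and \<open>Ext F Z P\<close>, which vanish for ends in
  \<open>\<U>\<close>.\<close>

lemma relative_projective:
  assumes P: "P \<in> relative_proj_inj" shows "projective FU P" "injective FU P"
proof -
  have PU: "P \<in> \<U>" "P \<in> Ob F" using P relative_perp by simp_all
  have "\<exists>b\<in>arr F P B. cmp F P B Z y b = k"
    if c: "(A,B,Z,x,y,\<delta>) \<in> conflations FU" and k: "k \<in> arr F P Z" for A B Z x y \<delta> k
  proof -
    have c': "(A,B,Z,x,y,\<delta>) \<in> conflations F" "A \<in> \<U>" using c FU_conflations by auto
    note t = conflation_arr[OF c'(1)]
    have "pull F Z P A k \<delta> = \<zero>\<^bsub>Ext F P A\<^esub>"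
      using orthogonalD[OF relative_orthogonal(2)[OF P c'(2)]] t k PU by simp
    then show ?thesis using deflation_lift[OF c'(1) PU(2) k] by blast
  qed
  then show "projective FU P" unfolding projective_def using PU(1) by fastforce
  have "\<exists>b\<in>arr F B P. cmp F A B P b x = a"
    if c: "(A,B,Z,x,y,\<delta>) \<in> conflations FU" and a: "a \<in> arr F A P" for A B Z x y \<delta> a
  proof -
    have c': "(A,B,Z,x,y,\<delta>) \<in> conflations F" "Z \<in> \<U>" using c FU_conflations by auto
    note t = conflation_arr[OF c'(1)]
    have "push F Z A P a \<delta> = \<zero>\<^bsub>Ext F Z P\<^esub>"
      using orthogonalD[OF relative_orthogonal(1)[OF P c'(2)]] t a PU by simp
    then show ?thesis using inflation_extend[OF c'(1) PU(2) a] by blast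
  qed
  then show "injective FU P" unfolding injective_def using PU(1) by fastforce
qed

text \<open>The approximation conflation of \<open>P\<close> itself stays inside
  \<open>\<U>\<close>, so injectivity extends the identity over its inflation. The retract is a
  genuine one in \<open>F\<close>; it is what later compares the two ideals.\<close>

lemma injective_addX_retract:
  assumes P: "injective FU P"
  obtains Q s r where "Q \<in> addX" "s \<in> arr F P Q" "r \<in> arr F Q P" "cmp F P Q P r s = ide F P"
proof -
  have PU: "P \<in> \<U>" "P \<in> Ob F" using P by (auto simp: injective_def)
  obtain Q Z x y \<delta> where c: "(P,Q,Z,x,y,\<delta>) \<in> conflations F" and Q: "Q \<in> addX" and Z: "Z \<in> \<U>"
    by (rule approx_conflation[OF PU(2)])
  have "(P,Q,Z,x,y,\<delta>) \<in> conflations FU"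
    using FU_conflations c PU(1) Z addX_relative[OF Q] relative_perp by blast
  then have "\<exists>r\<in>arr F Q P. cmp F P Q P r x = ide F P"
    using P ide_arr[OF PU(2)] unfolding injective_def FU_simps by blast
  then show thesis using that Q conflation_arr[OF c] by blast
qed

lemma injective_relative:
  assumes P: "injective FU P" shows "P \<in> relative_proj_inj"
proof -
  have PO: "P \<in> Ob F" using P by (auto simp: injective_def)
  obtain Q s r where Q: "Q \<in> addX" and r: "s \<in> arr F P Q" "r \<in> arr F Q P" "cmp F P Q P r s = ide F P"
    by (rule injective_addX_retract[OF P])
  have QR: "Q \<in> relative_proj_inj" "Q \<in> Ob F" using addX_relative[OF Q] by simp_all
  show ?thesis
    using orthogonal_retract_right[OF _ PO QR(2) r] orthogonal_retract_left[OF _ PO QR(2) r]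
      relative_orthogonal[OF QR(1)] by (intro relativeI[OF PO]) simp_all
qed

lemma proj_inj_FU: "proj_inj FU = relative_proj_inj"
  using relative_projective injective_relative unfolding proj_inj_def by blast

end

sublocale calabi_yau_reduction \<subseteq> J: stable_subcategory K F FU
proof (unfold_locales)
  show "Ob FU \<subseteq> Ob F" using perp_ob by auto
  obtain Z where Z: "Z \<in> Ob F" using ex_zero_object by (auto simp: zero_object_def)
  then show "Ob FU \<noteq> {}" using approx_conflation[OF Z] by (metis FU_simps(1) empty_iff)
  show "\<And>M N S i j p q. M \<in> Ob FU \<Longrightarrow> N \<in> Ob FU \<Longrightarrow> biproduct F M N S i j p q \<Longrightarrow> S \<in> Ob FU"
    unfolding FU_simps perp_iff using orthogonal_biproduct(1) X_ob by (auto simp: biproduct_def)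
  show "\<And>P M \<delta>. P \<in> proj_inj FU \<Longrightarrow> M \<in> Ob FU \<Longrightarrow> \<delta> \<in> carrier (Ext F M P) \<Longrightarrow> \<delta> = \<zero>\<^bsub>Ext F M P\<^esub>"
    unfolding proj_inj_FU FU_simps using relative_orthogonal(1) orthogonalD by blast
  show "\<And>P M \<delta>. P \<in> proj_inj FU \<Longrightarrow> M \<in> Ob FU \<Longrightarrow> \<delta> \<in> carrier (Ext F P M) \<Longrightarrow> \<delta> = \<zero>\<^bsub>Ext F P M\<^esub>"
    unfolding proj_inj_FU FU_simps using relative_orthogonal(2) orthogonalD by blast
  show "\<And>A B Z x y \<delta>. ((A,B,Z,x,y,\<delta>) \<in> conflations FU) \<longleftrightarrow>
      (A,B,Z,x,y,\<delta>) \<in> conflations F \<and> A \<in> Ob FU \<and> B \<in> Ob FU \<and> Z \<in> Ob FU"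
    unfolding FU_simps by (rule FU_conflations)
  \<comment> \<open>The middle term of the approximation conflation is injective in
    \<open>FU\<close> because it lies in \<open>addX\<close>.\<close>
  show "\<And>A. A \<in> Ob FU \<Longrightarrow> \<exists>P Z x y \<delta>. (A,P,Z,x,y,\<delta>) \<in> conflations FU \<and> injective FU P"
    unfolding FU_simps
    by (metis approx_conflation perp_ob FU_conflations addX_relative relative_perp relative_projective(2))
  show "\<And>P. injective FU P \<Longrightarrow> projective FU P" using injective_relative relative_projective(1) by blast
qed simp_all

context calabi_yau_reduction
begin

section \<open>The reduction as an iterated quotient\<close>

abbreviation R :: "('k,'o,'m set) lincat" where "R \<equiv> quot_cat F (proj_inj F)"

abbreviation RA :: "('k,'o,'m set set) lincat" where "RA \<equiv> quot_cat R addX"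

text \<open>Arrows of the reduction are cosets of cosets: stable classes, grouped modulo maps
  through \<open>addX\<close>.\<close>

abbreviation dquo :: "'o \<Rightarrow> 'o \<Rightarrow> 'm \<Rightarrow> 'm set set" where
  "dquo X Y f \<equiv> quot_arr R addX X Y (S.quo X Y f)"

abbreviation iysusp :: "'o \<Rightarrow> 'o" where "iysusp \<equiv> iy_susp (stable_cat F) \<X>"

abbreviation D :: "('k,'o,'m set set) tricat" where "D \<equiv> iy_reduction (stable_cat F) \<X>"

lemma addX_ob: "P \<in> addX \<Longrightarrow> P \<in> Ob F"
  using addX_relative by simp

end

text \<open>Again the quotient is formed on all objects of \<open>F\<close>; the restriction to
  \<open>\<U>\<close> in \<open>iy_cat\<close> changes no hom-space.\<close>

sublocale calabi_yau_reduction \<subseteq> A: factor_category K "quot_cat F (proj_inj F)" "add_closure (stable_cat F) \<X>"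
proof (intro factor_category.intro factor_category_axioms.intro)
  show "linear_category K R" by (rule S.stab.linear_category_quot)
  interpret R: linear_category K R by (rule S.stab.linear_category_quot)
  show sub: "addX \<subseteq> Ob R" using addX_ob by auto
  fix X Y assume "X \<in> Ob R" "Y \<in> Ob R"
  then show "additive_subgroup (factoring R addX X Y) (Hom R X Y)"
  proof (rule R.factoring_additive_subgroup)
    obtain Z where Z: "Z \<in> Ob F" using ex_zero_object by (auto simp: zero_object_def)
    then show "addX \<noteq> {}" using approx_conflation[OF Z] by (metis empty_iff)
    show "addX \<subseteq> Ob R" by (rule sub)
    fix P Q assume P: "P \<in> addX" and Q: "Q \<in> addX"
    obtain U i j p q where b: "biproduct F P Q U i j p q" using ex_biproduct addX_ob P Q by blast
    have "U \<in> addX" by (rule add_closure.sum[OF P Q biproduct_stable[OF b]])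
    then show "\<exists>U\<in>addX. \<exists>i j p q. biproduct R P Q U i j p q"
      using S.stab.biproduct_quot[OF b] by blast
  qed
qed

context calabi_yau_reduction
begin

lemma proj_inj_le: "factoring F (proj_inj F) X Y \<subseteq> factoring F (proj_inj FU) X Y"
  using proj_inj_relative unfolding factoring_def proj_inj_FU by blast

lemma quo_mono:
  assumes "X \<in> Ob F" "Y \<in> Ob F" "f \<in> arr F X Y" "g \<in> arr F X Y" "S.quo X Y f = S.quo X Y g"
  shows "J.quo X Y f = J.quo X Y g"
  using S.stab.quot_eq_iff[OF assms(1-4)] J.stab.quot_eq_iff[OF assms(1-4)] proj_inj_le assms(5) by blast

text \<open>One inclusion is \<open>addX_relative\<close>. For the other, a map through a
  projective-injective \<open>P\<close> of \<open>FU\<close> is rerouted through the object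
  \<open>Q\<close> of \<open>addX\<close> of which \<open>P\<close> is a retract.\<close>

lemma factoring_addX:
  assumes X: "X \<in> Ob F" and Y: "Y \<in> Ob F"
  shows "factoring R addX X Y = S.quo X Y ` factoring F (proj_inj FU) X Y"
proof (intro equalityI subsetI)
  fix G assume "G \<in> factoring R addX X Y"
  then obtain P a b where P: "P \<in> addX" and ab: "a \<in> arr R X P" "b \<in> arr R P Y" "G = cmp R X P Y b a"
    unfolding factoring_def by blast
  have PO: "P \<in> Ob F" using P by (rule addX_ob)
  obtain a' where a: "a' \<in> arr F X P" "a = S.quo X P a'" by (rule S.stab.quot_arrE[OF X PO ab(1)])
  obtain b' where b: "b' \<in> arr F P Y" "b = S.quo P Y b'" by (rule S.stab.quot_arrE[OF PO Y ab(2)])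
  have "G = S.quo X Y (cmp F X P Y b' a')" unfolding ab(3) a(2) b(2) using X Y PO a b by (intro S.stab.cmp_quot)
  moreover have "cmp F X P Y b' a' \<in> factoring F (proj_inj FU) X Y"
    using factoringI[OF _ a(1) b(1)] P addX_relative proj_inj_FU by blast
  ultimately show "G \<in> S.quo X Y ` factoring F (proj_inj FU) X Y" by blast
next
  fix G assume "G \<in> S.quo X Y ` factoring F (proj_inj FU) X Y"
  then obtain P a b where P: "P \<in> proj_inj FU" and a: "a \<in> arr F X P" and b: "b \<in> arr F P Y"
    and G: "G = S.quo X Y (cmp F X P Y b a)"
    unfolding factoring_def by blast
  have "injective FU P" using P by (simp add: proj_inj_def)
  then obtain Q s r where Q: "Q \<in> addX" and r: "s \<in> arr F P Q" "r \<in> arr F Q P" "cmp F P Q P r s = ide F P"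
    by (rule injective_addX_retract)
  have O: "P \<in> Ob F" "Q \<in> Ob F" using P proj_inj_FU addX_ob[OF Q] by simp_all
  have "cmp F P Q Y (cmp F Q P Y b r) s = b" using O r b Y by simp
  then have "cmp F X P Y b a = cmp F X Q Y (cmp F Q P Y b r) (cmp F X P Q s a)"
    using O r a b X Y cmp_assoc[of X P Q Y a s "cmp F Q P Y b r"] by (simp del: cmp_assoc)
  then have "G = cmp R X Q Y (S.quo Q Y (cmp F Q P Y b r)) (S.quo X Q (cmp F X P Q s a))"
    unfolding G using O r a b X Y by (simp add: S.stab.cmp_quot)
  then show "G \<in> factoring R addX X Y"
    using Q O r a b X Y unfolding factoring_def by (blast intro: S.stab.quot_arrI cmp_closed)
qed

text \<open>The third isomorphism theorem: the ideal of \<open>F\<close> lies in that of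
  \<open>FU\<close>, and the image of the larger one is the ideal divided out second.\<close>

lemma dquo_eq_iff:
  assumes X: "X \<in> Ob F" and Y: "Y \<in> Ob F" and f: "f \<in> arr F X Y" and g: "g \<in> arr F X Y"
  shows "dquo X Y f = dquo X Y g \<longleftrightarrow> J.quo X Y f = J.quo X Y g"
proof -
  interpret J: additive_subgroup "factoring F (proj_inj FU) X Y" "Hom F X Y"
    using X Y by (rule J.stab.factor_subgroup)
  have fg: "f \<ominus>\<^bsub>Hom F X Y\<^esub> g \<in> arr F X Y" using X Y f g by simp
  have lin: "linear_map K (Hom F X Y) (Hom R X Y) (S.quo X Y)"
    unfolding linear_map_def using X Y by (auto simp: S.stab.quot_arrI S.stab.add_quot S.stab.smult_quot)
  have d: "S.quo X Y f \<ominus>\<^bsub>Hom R X Y\<^esub> S.quo X Y g = S.quo X Y (f \<ominus>\<^bsub>Hom F X Y\<^esub> g)"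
    using linear_map_minus[OF lin hom_module[OF X Y] S.stab.hom_module_quot[OF X Y] f g] by simp
  have "dquo X Y f = dquo X Y g \<longleftrightarrow> S.quo X Y (f \<ominus>\<^bsub>Hom F X Y\<^esub> g) \<in> S.quo X Y ` factoring F (proj_inj FU) X Y"
    using A.quot_eq_iff[of X Y "S.quo X Y f" "S.quo X Y g"] X Y f g
    by (simp add: S.stab.quot_arrI d factoring_addX)
  also have "\<dots> \<longleftrightarrow> f \<ominus>\<^bsub>Hom F X Y\<^esub> g \<in> factoring F (proj_inj FU) X Y"
  proof
    assume "S.quo X Y (f \<ominus>\<^bsub>Hom F X Y\<^esub> g) \<in> S.quo X Y ` factoring F (proj_inj FU) X Y"
    then obtain h where h: "h \<in> factoring F (proj_inj FU) X Y" "S.quo X Y (f \<ominus>\<^bsub>Hom F X Y\<^esub> g) = S.quo X Y h"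
      by blast
    have hc: "h \<in> arr F X Y" using h(1) J.a_subset by blast
    \<comment> \<open>\<open>f - g\<close> and \<open>h\<close> have the same stable class, so they
      differ by the smaller ideal, which lies in the larger one.\<close>
    have "(f \<ominus>\<^bsub>Hom F X Y\<^esub> g) \<ominus>\<^bsub>Hom F X Y\<^esub> h \<in> factoring F (proj_inj FU) X Y"
      using h(2) S.stab.quot_eq_iff[OF X Y fg hc] proj_inj_le by blast
    then have "((f \<ominus>\<^bsub>Hom F X Y\<^esub> g) \<ominus>\<^bsub>Hom F X Y\<^esub> h) \<oplus>\<^bsub>Hom F X Y\<^esub> h \<in> factoring F (proj_inj FU) X Y"
      using h(1) by (rule J.a_closed)
    then show "f \<ominus>\<^bsub>Hom F X Y\<^esub> g \<in> factoring F (proj_inj FU) X Y" using X Y fg hc by simp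
  qed blast
  also have "\<dots> \<longleftrightarrow> J.quo X Y f = J.quo X Y g" using J.stab.quot_eq_iff[OF X Y f g] by simp
  finally show ?thesis .
qed

text \<open>A coset of the larger ideal is a union of cosets of the smaller one. As sets, arrows on
  the two sides thus correspond by taking images and unions.\<close>

lemma dquo_image:
  assumes X: "X \<in> Ob F" and Y: "Y \<in> Ob F" and f: "f \<in> arr F X Y"
  shows "S.quo X Y ` J.quo X Y f = dquo X Y f"
proof (intro equalityI subsetI)
  have sf: "S.quo X Y f \<in> arr R X Y" using X Y f by (rule S.stab.quot_arrI)
  fix G
  {
    assume "G \<in> S.quo X Y ` J.quo X Y f"
    then obtain g where g: "g \<in> J.quo X Y f" "G = S.quo X Y g" by blast
    have "g \<in> arr F X Y" "J.quo X Y g = J.quo X Y f" using J.stab.quot_memD[OF X Y f g(1)] .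
    then show "G \<in> dquo X Y f"
      using A.quot_mem_iff[of X Y "S.quo X Y f" G] sf dquo_eq_iff[OF X Y _ f] g(2) X Y S.stab.quot_arrI
      by auto
  next
    assume G: "G \<in> dquo X Y f"
    have G': "G \<in> arr R X Y" "quot_arr R addX X Y G = dquo X Y f"
      using A.quot_memD[OF _ _ sf G] X Y by simp_all
    obtain g where g: "g \<in> arr F X Y" "G = S.quo X Y g" by (rule S.stab.quot_arrE[OF X Y G'(1)])
    have "J.quo X Y g = J.quo X Y f" using dquo_eq_iff[OF X Y g(1) f] G'(2) unfolding g(2) by blast
    then show "G \<in> S.quo X Y ` J.quo X Y f"
      using J.stab.quot_self[OF X Y g(1)] g(2) by blast
  }
qed

lemma dquo_Union:
  assumes X: "X \<in> Ob F" and Y: "Y \<in> Ob F" and f: "f \<in> arr F X Y"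
  shows "\<Union> (dquo X Y f) = J.quo X Y f"
proof -
  have "S.quo X Y g \<subseteq> J.quo X Y f" if g: "g \<in> J.quo X Y f" for g
  proof
    fix h assume h: "h \<in> S.quo X Y g"
    note g' = J.stab.quot_memD[OF X Y f g]
    note h' = S.stab.quot_memD[OF X Y g'(1) h]
    have "J.quo X Y h = J.quo X Y f" using quo_mono[OF X Y h'(1) g'(1) h'(2)] g'(2) by simp
    then show "h \<in> J.quo X Y f" using J.stab.quot_self[OF X Y h'(1)] by simp
  qed
  moreover have "g \<in> S.quo X Y g" if g: "g \<in> J.quo X Y f" for g
    using S.stab.quot_self[OF X Y] J.stab.quot_memD[OF X Y f g] by blast
  ultimately show ?thesis unfolding dquo_image[OF X Y f, symmetric] by blast
qed

lemma arr_RA: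
  assumes "X \<in> Ob F" "Y \<in> Ob F"
  shows "arr RA X Y = dquo X Y ` arr F X Y"
  using A.arr_quot[of X Y] S.stab.arr_quot[of X Y] assms by (simp add: image_image)

lemma dquo_arr: "X \<in> Ob F \<Longrightarrow> Y \<in> Ob F \<Longrightarrow> f \<in> arr F X Y \<Longrightarrow> dquo X Y f \<in> arr RA X Y"
  by (simp add: arr_RA)

lemma cmp_dquo:
  "X \<in> Ob F \<Longrightarrow> Y \<in> Ob F \<Longrightarrow> Z \<in> Ob F \<Longrightarrow> f \<in> arr F X Y \<Longrightarrow> g \<in> arr F Y Z \<Longrightarrow>
    cmp RA X Y Z (dquo Y Z g) (dquo X Y f) = dquo X Z (cmp F X Y Z g f)"
  by (simp add: A.cmp_quot S.stab.cmp_quot S.stab.quot_arrI)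

lemma add_dquo:
  "X \<in> Ob F \<Longrightarrow> Y \<in> Ob F \<Longrightarrow> f \<in> arr F X Y \<Longrightarrow> g \<in> arr F X Y \<Longrightarrow>
    dquo X Y f \<oplus>\<^bsub>Hom RA X Y\<^esub> dquo X Y g = dquo X Y (f \<oplus>\<^bsub>Hom F X Y\<^esub> g)"
  by (simp add: A.add_quot S.stab.add_quot S.stab.quot_arrI)

lemma smult_dquo:
  "X \<in> Ob F \<Longrightarrow> Y \<in> Ob F \<Longrightarrow> k \<in> carrier K \<Longrightarrow> f \<in> arr F X Y \<Longrightarrow>
    k \<odot>\<^bsub>Hom RA X Y\<^esub> dquo X Y f = dquo X Y (k \<odot>\<^bsub>Hom F X Y\<^esub> f)"
  by (simp add: A.smult_quot S.stab.smult_quot S.stab.quot_arrI)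

lemma ide_dquo: "ide RA X = dquo X X (ide F X)"
  by (simp add: A.ide_quot S.stab.ide_quot)

lemma iy_cat_eq: "Ob (iy_cat (stable_cat F) \<X>) = \<U>" "Hom (iy_cat (stable_cat F) \<X>) = Hom RA"
  "cmp (iy_cat (stable_cat F) \<X>) = cmp RA" "ide (iy_cat (stable_cat F) \<X>) = ide RA"
  using quot_cat_cong[of "full_subcat (stable_cat F) \<U>" R addX]
  by (simp_all add: iy_cat_def full_subcat_def ext1_perp_eq) (simp add: quot_cat_def)

lemma D_simps [simp]: "Ob D = \<U>" "Hom D = Hom RA" "cmp D = cmp RA" "ide D = ide RA" "susp D = iysusp"
  "susp_arr D = iy_susp_arr (stable_cat F) \<X>"
  by (simp_all add: iy_reduction_def Let_def iy_cat_eq)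

lemma quot_arr_T: "quot_arr (stable_cat F) addX = quot_arr R addX"
  by (rule quot_arr_cong) simp_all

subsection \<open>The suspension of the reduction\<close>

text \<open>Makes the choice in \<open>approx_triangle\<close> meaningful. The approximation
  property against all of \<open>addX\<close>, not only \<open>\<X>\<close>, comes from the
  vanishing of \<open>Ext F Z X\<close> for \<open>Z\<close> in \<open>\<U>\<close>, which extends
  maps over the inflation.\<close>

lemma approx_triangle_ex:
  assumes Y: "Y \<in> \<U>"
  shows "\<exists>t. t \<in> dist (stable_cat F) \<and>
     (\<exists>X Y1 f g h. t = (Y,X,Y1,f,g,h) \<and> left_approximation (stable_cat F) addX Y X f)"
proof -
  have YO: "Y \<in> Ob F" using Y by simp
  obtain P Z x y \<delta> where c: "(Y,P,Z,x,y,\<delta>) \<in> conflations F" and P: "P \<in> addX" and Z: "Z \<in> \<U>"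
    by (rule approx_conflation[OF YO])
  note t = conflation_arr[OF c]
  obtain h where h: "h \<in> arr F Z (stable_susp F Y)" "pull F (stable_susp F Y) Z Y h (susp_ext F Y) = \<delta>"
    by (rule S.represents_ex[OF S.represents_susp[OF YO] t(3,6)])
  have "(Y,P,Z,S.quo Y P x,S.quo P Z y,S.quo Z (stable_susp F Y) h) \<in> dist (stable_cat F)"
    by (rule S.stable_dist_conflation[OF c h])
  moreover have "left_approximation (stable_cat F) addX Y P (S.quo Y P x)"
    unfolding left_approximation_def S.stable_cat_simps
  proof (intro conjI ballI P S.stab.quot_arrI t)
    fix X G assume X: "X \<in> addX" and G: "G \<in> arr R Y X"
    have XO: "X \<in> Ob F" using X by (rule addX_ob)
    obtain g where g: "g \<in> arr F Y X" "G = S.quo Y X g" by (rule S.stab.quot_arrE[OF YO XO G])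
    have "push F Z Y X g \<delta> = \<zero>\<^bsub>Ext F Z X\<^esub>"
      using orthogonalD[OF relative_orthogonal(1)[OF addX_relative[OF X] Z]] t XO g(1) by simp
    then obtain k where k: "k \<in> arr F P X" "cmp F Y P X k x = g" by (rule inflation_extend[OF c XO g(1)])
    have "cmp R Y P X (S.quo P X k) (S.quo Y P x) = G"
      unfolding g(2) k(2)[symmetric] by (rule S.stab.cmp_quot[OF YO t(2) XO t(4) k(1)])
    then show "\<exists>H\<in>arr R P X. cmp R Y P X H (S.quo Y P x) = G"
      using S.stab.quot_arrI[OF t(2) XO k(1)] by blast
  qed
  ultimately show ?thesis by blast
qed

text \<open>The extension belonging to the third map of the fixed triangle, universal for the
  suspension of the reduction. It is chosen so that compatible representatives of all three maps fit
  into one \<open>conflation_retract\<close> with it.\<close>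

definition iy_ext :: "'o \<Rightarrow> 'e" where
  "iy_ext Y = (SOME \<delta>. \<exists>P f g h. approx_triangle (stable_cat F) \<X> Y =
      (Y, P, iysusp Y, S.quo Y P f, S.quo P (iysusp Y) g, S.quo (iysusp Y) (stable_susp F Y) h) \<and>
      P \<in> addX \<and> h \<in> arr F (iysusp Y) (stable_susp F Y) \<and>
      \<delta> = pull F (stable_susp F Y) (iysusp Y) Y h (susp_ext F Y) \<and>
      S.conflation_retract Y P (iysusp Y) f g \<delta> \<and>
      left_approximation (stable_cat F) addX Y P (S.quo Y P f))"

lemma approx_triangleE:
  assumes Y: "Y \<in> \<U>"
  obtains P f g h where "approx_triangle (stable_cat F) \<X> Y =
      (Y, P, iysusp Y, S.quo Y P f, S.quo P (iysusp Y) g, S.quo (iysusp Y) (stable_susp F Y) h)"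
    "P \<in> addX" "h \<in> arr F (iysusp Y) (stable_susp F Y)"
    "iy_ext Y = pull F (stable_susp F Y) (iysusp Y) Y h (susp_ext F Y)"
    "S.conflation_retract Y P (iysusp Y) f g (iy_ext Y)"
    "left_approximation (stable_cat F) addX Y P (S.quo Y P f)"
proof -
  let ?t = "approx_triangle (stable_cat F) \<X> Y"
  have "?t \<in> dist (stable_cat F) \<and>
     (\<exists>X Y1 f g h. ?t = (Y,X,Y1,f,g,h) \<and> left_approximation (stable_cat F) addX Y X f)"
    unfolding approx_triangle_def by (rule someI_ex[OF approx_triangle_ex[OF Y]])
  then obtain P Y1 f g h where t: "?t = (Y,P,Y1,f,g,h)" and d: "(Y,P,Y1,f,g,h) \<in> dist (stable_cat F)"
    and l: "left_approximation (stable_cat F) addX Y P f" by auto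
  have s: "iysusp Y = Y1" unfolding iy_susp_def t by simp
  have P: "P \<in> addX" using l by (simp add: left_approximation_def)
  obtain f' g' h' where fgh: "f' \<in> arr F Y P" "g' \<in> arr F P Y1" "h' \<in> arr F Y1 (stable_susp F Y)"
    "f = S.quo Y P f'" "g = S.quo P Y1 g'" "h = S.quo Y1 (stable_susp F Y) h'"
    "S.conflation_retract Y P Y1 f' g' (pull F (stable_susp F Y) Y1 Y h' (susp_ext F Y))"
    by (rule S.stable_dist_retract[OF d])
  have "\<exists>\<delta> P f g h. ?t =
      (Y, P, iysusp Y, S.quo Y P f, S.quo P (iysusp Y) g, S.quo (iysusp Y) (stable_susp F Y) h) \<and>
      P \<in> addX \<and> h \<in> arr F (iysusp Y) (stable_susp F Y) \<and>
      \<delta> = pull F (stable_susp F Y) (iysusp Y) Y h (susp_ext F Y) \<and>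
      S.conflation_retract Y P (iysusp Y) f g \<delta> \<and>
      left_approximation (stable_cat F) addX Y P (S.quo Y P f)"
    unfolding s using t fgh P l by blast
  from someI_ex[OF this] show thesis unfolding iy_ext_def[symmetric] using that by blast
qed

text \<open>The argument for a conflation with projective-injective middle term, carried out for a
  retract. Lifts agree modulo the ideal of \<open>F\<close>, and \<open>quo_mono\<close> passes to
  the larger ideal of \<open>FU\<close>.\<close>

lemma represents_iy:
  assumes Y: "Y \<in> \<U>"
  shows "J.represents Y (iysusp Y) (iy_ext Y)"
proof -
  obtain P f g h where P: "P \<in> addX" and r: "S.conflation_retract Y P (iysusp Y) f g (iy_ext Y)"
    and l: "left_approximation (stable_cat F) addX Y P (S.quo Y P f)"
    by (rule approx_triangleE[OF Y])
  note t = S.retract_arr[OF r]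
  have PR: "P \<in> relative_proj_inj" using P by (rule addX_relative)
  have Y1: "iysusp Y \<in> \<U>"
  proof (rule perp_of_retract[OF r relative_perp[OF PR]])
    fix X k assume X: "X \<in> \<X>" and k: "k \<in> arr F Y X"
    have XO: "X \<in> Ob F" using X X_ob by blast
    have XA: "X \<in> addX" using X XO by (simp add: add_closure.base)
    have "S.quo Y X k \<in> arr R Y X" using S.stab.quot_arrI[OF t(1) XO k] .
    then obtain H where H: "H \<in> arr R P X" "cmp R Y P X H (S.quo Y P f) = S.quo Y X k"
      using l XA unfolding left_approximation_def S.stable_cat_simps by blast
    obtain h where h: "h \<in> arr F P X" "H = S.quo P X h" by (rule S.stab.quot_arrE[OF t(2) XO H(1)])
    have "S.quo Y X (cmp F Y P X h f) = S.quo Y X k"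
      using H(2) unfolding h(2) S.stab.cmp_quot[OF t(1,2) XO t(4) h(1)] .
    then show "\<exists>h\<in>arr F P X. S.quo Y X (cmp F Y P X h f) = S.quo Y X k" using h(1) by blast
  qed
  show ?thesis
    unfolding J.represents_def FU_simps
  proof (intro conjI ballI impI Y Y1 t)
    fix M assume M: "M \<in> \<U>"
    have MO: "M \<in> Ob F" using M by simp
    show "\<exists>k\<in>arr F M (iysusp Y). pull F (iysusp Y) M Y k (iy_ext Y) = \<epsilon>"
      if e: "\<epsilon> \<in> carrier (Ext F M Y)" for \<epsilon>
    proof -
      have "push F M Y P f \<epsilon> = \<zero>\<^bsub>Ext F M P\<^esub>"
        using orthogonalD[OF relative_orthogonal(1)[OF PR M]] t MO e by simp
      then show ?thesis using S.retract_ext_pull[OF r MO e] by blast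
    qed
    show "k \<in> factoring F (proj_inj FU) M (iysusp Y)"
      if k: "k \<in> arr F M (iysusp Y)" and z: "pull F (iysusp Y) M Y k (iy_ext Y) = \<zero>\<^bsub>Ext F M Y\<^esub>" for k
    proof -
      obtain m where m: "m \<in> arr F M P" "S.quo M (iysusp Y) k = S.quo M (iysusp Y) (cmp F M P (iysusp Y) g m)"
        by (rule S.retract_lift[OF r MO k z])
      have gm: "cmp F M P (iysusp Y) g m \<in> arr F M (iysusp Y)" using MO t m(1) by simp
      have "J.quo M (iysusp Y) k = J.quo M (iysusp Y) (cmp F M P (iysusp Y) g m)"
        by (rule quo_mono[OF MO t(3) k gm m(2)])
      moreover have "cmp F M P (iysusp Y) g m \<in> factoring F (proj_inj FU) M (iysusp Y)"
        using factoringI[OF _ m(1) t(5)] PR proj_inj_FU by blast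
      ultimately show ?thesis
        using J.stab.quot_eq_zero_iff[OF MO t(3)] k gm by metis
    qed
  qed
qed

lemma iysusp_perp [simp]: "Y \<in> \<U> \<Longrightarrow> iysusp Y \<in> \<U>"
  using J.representsD(2)[OF represents_iy] by simp

lemma iy_ext_closed [simp]: "Y \<in> \<U> \<Longrightarrow> iy_ext Y \<in> carrier (Ext F (iysusp Y) Y)"
  using J.representsD(3)[OF represents_iy] by simp

text \<open>Here the candidates are third components of morphisms between the fixed triangles:
  \<open>retract_fill\<close> shows that \<open>c\<close> is one, and the third square determines
  the extension of any candidate, hence its class.\<close>

lemma iy_susp_arr_eq:
  assumes X: "X \<in> \<U>" and Y: "Y \<in> \<U>" and f: "f \<in> arr F X Y" and c: "c \<in> arr F (iysusp X) (iysusp Y)"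
    and eq: "pull F (iysusp Y) (iysusp X) Y c (iy_ext Y) = push F (iysusp X) X Y f (iy_ext X)"
  shows "iy_susp_arr (stable_cat F) \<X> X Y (dquo X Y f) = dquo (iysusp X) (iysusp Y) c"
proof -
  have O: "X \<in> Ob F" "Y \<in> Ob F" "iysusp X \<in> Ob F" "iysusp Y \<in> Ob F" using X Y by simp_all
  obtain P u v w where aX: "approx_triangle (stable_cat F) \<X> X =
      (X, P, iysusp X, S.quo X P u, S.quo P (iysusp X) v, S.quo (iysusp X) (stable_susp F X) w)"
    and wX: "w \<in> arr F (iysusp X) (stable_susp F X)"
    and eX: "iy_ext X = pull F (stable_susp F X) (iysusp X) X w (susp_ext F X)"
    and rX: "S.conflation_retract X P (iysusp X) u v (iy_ext X)"
    by (rule approx_triangleE[OF X])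
  obtain Q u' v' w' where aY: "approx_triangle (stable_cat F) \<X> Y =
      (Y, Q, iysusp Y, S.quo Y Q u', S.quo Q (iysusp Y) v', S.quo (iysusp Y) (stable_susp F Y) w')"
    and wY: "w' \<in> arr F (iysusp Y) (stable_susp F Y)"
    and eY: "iy_ext Y = pull F (stable_susp F Y) (iysusp Y) Y w' (susp_ext F Y)"
    and rY: "S.conflation_retract Y Q (iysusp Y) u' v' (iy_ext Y)"
    by (rule approx_triangleE[OF Y])
  note tX = S.retract_arr[OF rX] and tY = S.retract_arr[OF rY]
  have third: "cmp R (iysusp X) (stable_susp F X) (stable_susp F Y)
        (stable_susp_arr F X Y (S.quo X Y f0)) (S.quo (iysusp X) (stable_susp F X) w)
      = cmp R (iysusp X) (iysusp Y) (stable_susp F Y)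
          (S.quo (iysusp Y) (stable_susp F Y) w') (S.quo (iysusp X) (iysusp Y) c0)
    \<longleftrightarrow> push F (iysusp X) X Y f0 (iy_ext X) = pull F (iysusp Y) (iysusp X) Y c0 (iy_ext Y)"
    if "f0 \<in> arr F X Y" "c0 \<in> arr F (iysusp X) (iysusp Y)" for f0 c0
    unfolding eX eY by (rule S.susp_square_iff[OF O(1,2,3,4) that wX wY])
  show ?thesis
    unfolding iy_susp_arr_def quot_arr_T
  proof (rule some_equality)
    obtain q where q: "q \<in> arr F P Q" "S.quo X Q (cmp F X P Q q u) = S.quo X Q (cmp F X Y Q u' f)"
      "S.quo P (iysusp Y) (cmp F P Q (iysusp Y) v' q) = S.quo P (iysusp Y) (cmp F P (iysusp X) (iysusp Y) c v)"
      by (rule S.retract_fill[OF rX rY f c eq[symmetric]])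
    have "triangle_morphism (stable_cat F) (susp (stable_cat F)) (susp_arr (stable_cat F))
        (approx_triangle (stable_cat F) \<X> X) (approx_triangle (stable_cat F) \<X> Y)
        (S.quo X Y f) (S.quo P Q q) (S.quo (iysusp X) (iysusp Y) c)"
      unfolding aX aY triangle_morphism.simps S.stable_cat_simps third[OF f c]
      using q f c tX tY eq by (simp add: S.stab.quot_arrI S.stab.cmp_quot)
    moreover have "S.quo X Y f \<in> dquo X Y f"
      using A.quot_self[of X Y "S.quo X Y f"] O f by (simp add: S.stab.quot_arrI)
    ultimately show "\<exists>f\<in>dquo X Y f. \<exists>x c'. triangle_morphism (stable_cat F) (susp (stable_cat F))
        (susp_arr (stable_cat F)) (approx_triangle (stable_cat F) \<X> X) (approx_triangle (stable_cat F) \<X> Y) f x c' \<and>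
        dquo (iysusp X) (iysusp Y) c = quot_arr R addX (iysusp X) (iysusp Y) c'" by blast
  next
    fix G assume "\<exists>f\<in>dquo X Y f. \<exists>x c. triangle_morphism (stable_cat F) (susp (stable_cat F))
        (susp_arr (stable_cat F)) (approx_triangle (stable_cat F) \<X> X) (approx_triangle (stable_cat F) \<X> Y) f x c \<and>
        G = quot_arr R addX (iysusp X) (iysusp Y) c"
    then obtain f' x c' where f': "f' \<in> dquo X Y f" and G: "G = quot_arr R addX (iysusp X) (iysusp Y) c'"
      and m: "triangle_morphism (stable_cat F) (susp (stable_cat F))
        (susp_arr (stable_cat F)) (approx_triangle (stable_cat F) \<X> X) (approx_triangle (stable_cat F) \<X> Y) f' x c'"
      by blast
    \<comment> \<open>A representative in the reduction agrees with \<open>f\<close> only modulo the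
      larger ideal. Push-outs of extensions of \<open>iysusp X\<close> are still unaffected, since
      that object lies in \<open>\<U>\<close>.\<close>
    obtain f0 where f0: "f0 \<in> J.quo X Y f" "f' = S.quo X Y f0"
      using f' unfolding dquo_image[OF O(1,2) f, symmetric] by blast
    note f0' = J.stab.quot_memD[OF O(1,2) f f0(1)]
    have "c' \<in> arr R (iysusp X) (iysusp Y)"
      using m unfolding aX aY triangle_morphism.simps S.stable_cat_simps by blast
    then obtain c0 where c0: "c0 \<in> arr F (iysusp X) (iysusp Y)" "c' = S.quo (iysusp X) (iysusp Y) c0"
      by (rule S.stab.quot_arrE[OF O(3,4)])
    have "push F (iysusp X) X Y f0 (iy_ext X) = pull F (iysusp Y) (iysusp X) Y c0 (iy_ext Y)"
      using m third[OF f0'(1) c0(1)]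
      unfolding aX aY triangle_morphism.simps S.stable_cat_simps f0(2) c0(2) by blast
    moreover have "push F (iysusp X) X Y f0 (iy_ext X) = push F (iysusp X) X Y f (iy_ext X)"
      by (rule J.push_cong) (use X Y O f f0' in simp_all)
    ultimately have "pull F (iysusp Y) (iysusp X) Y c0 (iy_ext Y) = pull F (iysusp Y) (iysusp X) Y c (iy_ext Y)"
      using eq by simp
    then have "J.quo (iysusp X) (iysusp Y) c0 = J.quo (iysusp X) (iysusp Y) c"
      using J.represents_eq_iff[OF represents_iy[OF Y] _ c0(1) c] X by simp
    then show "G = dquo (iysusp X) (iysusp Y) c"
      unfolding G c0(2) using dquo_eq_iff[OF O(3,4) c0(1) c] by simp
  qed
qed


subsection \<open>The equivalence\<close>

abbreviation C :: "('k,'o,'m set) tricat" where "C \<equiv> stable_cat FU"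

abbreviation CQ :: "('k,'o,'m set) lincat" where "CQ \<equiv> quot_cat F (proj_inj FU)"

section \<open>Comparison of the two suspensions\<close>

lemma susp_FU [simp]: "X \<in> \<U> \<Longrightarrow> stable_susp FU X \<in> \<U>"
  using J.susp_ob[of X] by simp

lemma susp_ext_FU [simp]: "X \<in> \<U> \<Longrightarrow> susp_ext FU X \<in> carrier (Ext F (stable_susp FU X) X)"
  using J.susp_ext_closed[of X] by simp

lemma represents_FU: "X \<in> \<U> \<Longrightarrow> J.represents X (stable_susp FU X) (susp_ext FU X)"
  using J.represents_susp[of X] by simp

text \<open>The Yoneda map between two objects representing the same functor: it pulls one universal
  extension back to the other.\<close>

definition comparison :: "'o \<Rightarrow> 'm" where
  "comparison X = (SOME k. k \<in> arr F (stable_susp FU X) (iysusp X) \<and>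
     pull F (iysusp X) (stable_susp FU X) X k (iy_ext X) = susp_ext FU X)"

lemma comparison:
  assumes "X \<in> \<U>"
  shows "comparison X \<in> arr F (stable_susp FU X) (iysusp X)"
    and "pull F (iysusp X) (stable_susp FU X) X (comparison X) (iy_ext X) = susp_ext FU X"
proof -
  have "\<exists>k. k \<in> arr F (stable_susp FU X) (iysusp X) \<and>
      pull F (iysusp X) (stable_susp FU X) X k (iy_ext X) = susp_ext FU X"
    using J.represents_ex[OF represents_iy[OF assms], of "stable_susp FU X" "susp_ext FU X"] assms by simp blast
  from someI_ex[OF this] show "comparison X \<in> arr F (stable_susp FU X) (iysusp X)"
    and "pull F (iysusp X) (stable_susp FU X) X (comparison X) (iy_ext X) = susp_ext FU X"
    unfolding comparison_def by auto
qed

text \<open>A map in the other direction exists for the same reason; each composite fixes a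
  universal extension and is therefore the identity modulo the ideal.\<close>

lemma comparison_iso:
  assumes X: "X \<in> \<U>"
  shows "iso_arr D (stable_susp FU X) (iysusp X) (dquo (stable_susp FU X) (iysusp X) (comparison X))"
proof -
  let ?S = "stable_susp FU X" and ?k = "comparison X"
  have O: "X \<in> Ob F" "?S \<in> Ob F" "iysusp X \<in> Ob F" "?S \<in> \<U>" "iysusp X \<in> \<U>" using X by simp_all
  note k = comparison[OF X]
  obtain l where l: "l \<in> arr F (iysusp X) ?S" "pull F ?S (iysusp X) X l (susp_ext FU X) = iy_ext X"
    using J.represents_ex[OF represents_FU[OF X], of "iysusp X" "iy_ext X"] X O by auto
  have "pull F ?S (iysusp X) X l (pull F (iysusp X) ?S X ?k (iy_ext X)) = iy_ext X"
    using k(2) l(2) by simp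
  then have "pull F (iysusp X) (iysusp X) X (cmp F (iysusp X) ?S (iysusp X) ?k l) (iy_ext X)
    = pull F (iysusp X) (iysusp X) X (ide F (iysusp X)) (iy_ext X)"
    using X O k(1) l(1) by simp
  then have "J.quo (iysusp X) (iysusp X) (cmp F (iysusp X) ?S (iysusp X) ?k l)
    = J.quo (iysusp X) (iysusp X) (ide F (iysusp X))"
    using J.represents_eq_iff[OF represents_iy[OF X], of "iysusp X"] O k(1) l(1) by simp
  then have 1: "dquo (iysusp X) (iysusp X) (cmp F (iysusp X) ?S (iysusp X) ?k l)
    = dquo (iysusp X) (iysusp X) (ide F (iysusp X))"
    using dquo_eq_iff O k(1) l(1) by simp
  have "pull F (iysusp X) ?S X ?k (pull F ?S (iysusp X) X l (susp_ext FU X)) = susp_ext FU X"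
    using k(2) l(2) by simp
  then have "pull F ?S ?S X (cmp F ?S (iysusp X) ?S l ?k) (susp_ext FU X)
    = pull F ?S ?S X (ide F ?S) (susp_ext FU X)"
    using X O k(1) l(1) by simp
  then have "J.quo ?S ?S (cmp F ?S (iysusp X) ?S l ?k) = J.quo ?S ?S (ide F ?S)"
    using J.represents_eq_iff[OF represents_FU[OF X], of ?S] O k(1) l(1) by simp
  then have 2: "dquo ?S ?S (cmp F ?S (iysusp X) ?S l ?k) = dquo ?S ?S (ide F ?S)"
    using dquo_eq_iff O k(1) l(1) by simp
  have "cmp RA ?S (iysusp X) ?S (dquo (iysusp X) ?S l) (dquo ?S (iysusp X) ?k) = ide RA ?S"
    unfolding cmp_dquo[OF O(2,3,2) k(1) l(1)] ide_dquo by (rule 2)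
  moreover have "cmp RA (iysusp X) ?S (iysusp X) (dquo ?S (iysusp X) ?k) (dquo (iysusp X) ?S l) = ide RA (iysusp X)"
    unfolding cmp_dquo[OF O(3,2,3) l(1) k(1)] ide_dquo by (rule 1)
  ultimately show ?thesis
    unfolding iso_arr_def D_simps using O dquo_arr[OF O(2,3) k(1)] dquo_arr[OF O(3,2) l(1)] by blast
qed

section \<open>The equivalence, identical on objects\<close>

definition to_iy :: "'o \<Rightarrow> 'o \<Rightarrow> 'm set \<Rightarrow> 'm set set" where
  "to_iy X Y G = S.quo X Y ` G"

lemma to_iy_quo: "X \<in> \<U> \<Longrightarrow> Y \<in> \<U> \<Longrightarrow> f \<in> arr F X Y \<Longrightarrow> to_iy X Y (J.quo X Y f) = dquo X Y f"
  unfolding to_iy_def by (rule dquo_image) simp_all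

lemma linear_functor_to_iy: "linear_functor K C D (\<lambda>X. X) to_iy"
  unfolding linear_functor_def linear_map_def J.Ob_stable J.stable_cat_simps D_simps FU_simps
  by (auto simp: J.stab.arr_quot J.stab.add_quot J.stab.smult_quot J.stab.cmp_quot J.stab.ide_quot
      to_iy_quo dquo_arr add_dquo smult_dquo cmp_dquo ide_dquo)

text \<open>\<open>Union\<close> undoes the partition of a coset into stable classes, so this
  functor is a strict inverse and identities serve as the natural isomorphisms of the
  equivalence.\<close>

lemma linear_functor_from_iy: "linear_functor K D C (\<lambda>X. X) (\<lambda>X Y. Union)"
  unfolding linear_functor_def linear_map_def J.Ob_stable J.stable_cat_simps D_simps FU_simps
  by (auto simp: arr_RA J.stab.quot_arrI J.stab.add_quot J.stab.smult_quot J.stab.cmp_quot J.stab.ide_quot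
      dquo_Union add_dquo smult_dquo cmp_dquo ide_dquo)

lemma equivalence_to_iy: "equivalence_functor K C D (\<lambda>X. X) to_iy"
proof -
  interpret RA: linear_category K RA by (rule A.linear_category_quot)
  interpret CQ: linear_category K CQ by (rule J.stab.linear_category_quot)
  have "natural_iso C C (\<lambda>X. X) (\<lambda>X Y f. f) (\<lambda>X. X) (\<lambda>X Y f. \<Union> (to_iy X Y f)) (ide CQ)"
    unfolding natural_iso_def iso_arr_def J.Ob_stable J.stable_cat_simps FU_simps
  proof (intro conjI ballI)
    fix X assume X: "X \<in> \<U>"
    show "X \<in> \<U>" "X \<in> \<U>" by (fact X)+
    show "ide CQ X \<in> arr CQ X X" using X by simp
    show "\<exists>g\<in>arr CQ X X. cmp CQ X X X g (ide CQ X) = ide CQ X \<and> cmp CQ X X X (ide CQ X) g = ide CQ X"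
      using X by (intro bexI[of _ "ide CQ X"]) simp_all
    fix Y f assume Y: "Y \<in> \<U>" and f: "f \<in> arr CQ X Y"
    have O: "X \<in> Ob F" "Y \<in> Ob F" using X Y by simp_all
    obtain g where g: "g \<in> arr F X Y" "f = J.quo X Y g" by (rule J.stab.quot_arrE[OF O f])
    show "cmp CQ X Y Y (ide CQ Y) f = cmp CQ X X Y (\<Union> (to_iy X Y f)) (ide CQ X)"
      unfolding g(2) to_iy_quo[OF X Y g(1)] dquo_Union[OF O g(1)]
      using X Y g(1) by (simp add: J.stab.quot_arrI)
  qed
  moreover have "natural_iso D D (\<lambda>X. X) (\<lambda>X Y f. to_iy X Y (\<Union> f)) (\<lambda>X. X) (\<lambda>X Y f. f) (ide RA)"
    unfolding natural_iso_def iso_arr_def D_simps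
  proof (intro conjI ballI)
    fix X assume X: "X \<in> \<U>"
    show "X \<in> \<U>" "X \<in> \<U>" by (fact X)+
    show "ide RA X \<in> arr RA X X" using X by simp
    show "\<exists>g\<in>arr RA X X. cmp RA X X X g (ide RA X) = ide RA X \<and> cmp RA X X X (ide RA X) g = ide RA X"
      using X by (intro bexI[of _ "ide RA X"]) simp_all
    fix Y f assume Y: "Y \<in> \<U>" and f: "f \<in> arr RA X Y"
    have O: "X \<in> Ob F" "Y \<in> Ob F" using X Y by simp_all
    obtain g where g: "g \<in> arr F X Y" "f = dquo X Y g" using f arr_RA[OF O] by blast
    show "cmp RA X Y Y (ide RA Y) (to_iy X Y (\<Union> f)) = cmp RA X X Y f (ide RA X)"
      unfolding g(2) dquo_Union[OF O g(1)] to_iy_quo[OF X Y g(1)]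
      using X Y dquo_arr[OF O g(1)] by simp
  qed
  ultimately show ?thesis
    unfolding equivalence_functor_def using linear_functor_to_iy linear_functor_from_iy by blast
qed

section \<open>Compatibility with suspensions and triangles\<close>

lemma relative_susp_arr_ex:
  assumes "X \<in> \<U>" "Y \<in> \<U>" "f \<in> arr F X Y"
  obtains s where "s \<in> arr F (stable_susp FU X) (stable_susp FU Y)"
    "pull F (stable_susp FU Y) (stable_susp FU X) Y s (susp_ext FU Y)
      = push F (stable_susp FU X) X Y f (susp_ext FU X)"
    "stable_susp_arr FU X Y (J.quo X Y f) = J.quo (stable_susp FU X) (stable_susp FU Y) s"
  using J.susp_arr_ex[of X Y f] J.stable_susp_arr_eq[of X Y f] assms unfolding FU_simps by metis

lemma iy_susp_arr_ex:
  assumes "X \<in> \<U>" "Y \<in> \<U>" "f \<in> arr F X Y"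
  obtains s where "s \<in> arr F (iysusp X) (iysusp Y)"
    "pull F (iysusp Y) (iysusp X) Y s (iy_ext Y) = push F (iysusp X) X Y f (iy_ext X)"
    "iy_susp_arr (stable_cat F) \<X> X Y (dquo X Y f) = dquo (iysusp X) (iysusp Y) s"
proof -
  have "push F (iysusp X) X Y f (iy_ext X) \<in> carrier (Ext F (iysusp X) Y)" using assms by simp
  then obtain s where s: "s \<in> arr F (iysusp X) (iysusp Y)"
    "pull F (iysusp Y) (iysusp X) Y s (iy_ext Y) = push F (iysusp X) X Y f (iy_ext X)"
    using J.represents_ex[OF represents_iy[OF assms(2)], of "iysusp X"] iysusp_perp[OF assms(1)]
    unfolding FU_simps by blast
  show thesis by (rule that[OF s iy_susp_arr_eq[OF assms s]])
qed

lemma iy_eq_iff: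
  assumes "M \<in> \<U>" "Y \<in> \<U>" "k \<in> arr F M (iysusp Y)" "k' \<in> arr F M (iysusp Y)"
  shows "dquo M (iysusp Y) k = dquo M (iysusp Y) k' \<longleftrightarrow>
    pull F (iysusp Y) M Y k (iy_ext Y) = pull F (iysusp Y) M Y k' (iy_ext Y)"
  using J.represents_eq_iff[OF represents_iy[OF assms(2)], of M k k'] dquo_eq_iff[of M "iysusp Y" k k'] assms
  by simp

abbreviation \<eta> :: "'o \<Rightarrow> 'm set set" where
  "\<eta> X \<equiv> dquo (stable_susp FU X) (iysusp X) (comparison X)"

lemma natural_comparison:
  "natural_iso C D (\<lambda>X. stable_susp FU X)
    (\<lambda>X Y f. to_iy (stable_susp FU X) (stable_susp FU Y) (stable_susp_arr FU X Y f))
    (\<lambda>X. iysusp X) (\<lambda>X Y f. iy_susp_arr (stable_cat F) \<X> X Y (to_iy X Y f)) \<eta>"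
  unfolding natural_iso_def J.Ob_stable J.stable_cat_simps FU_simps
proof (intro conjI ballI)
  fix X assume X: "X \<in> \<U>"
  show "iso_arr D (stable_susp FU X) (iysusp X) (\<eta> X)" by (rule comparison_iso[OF X])
  fix Y G assume Y: "Y \<in> \<U>" and G: "G \<in> arr CQ X Y"
  have XY: "X \<in> Ob F" "Y \<in> Ob F" using X Y by simp_all
  obtain f where f: "f \<in> arr F X Y" "G = J.quo X Y f" by (rule J.stab.quot_arrE[OF XY G])
  obtain s where s: "s \<in> arr F (stable_susp FU X) (stable_susp FU Y)"
    "pull F (stable_susp FU Y) (stable_susp FU X) Y s (susp_ext FU Y)
      = push F (stable_susp FU X) X Y f (susp_ext FU X)"
    "stable_susp_arr FU X Y (J.quo X Y f) = J.quo (stable_susp FU X) (stable_susp FU Y) s"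
    by (rule relative_susp_arr_ex[OF X Y f(1)])
  obtain c where c: "c \<in> arr F (iysusp X) (iysusp Y)"
    "pull F (iysusp Y) (iysusp X) Y c (iy_ext Y) = push F (iysusp X) X Y f (iy_ext X)"
    "iy_susp_arr (stable_cat F) \<X> X Y (dquo X Y f) = dquo (iysusp X) (iysusp Y) c"
    by (rule iy_susp_arr_ex[OF X Y f(1)])
  let ?SX = "stable_susp FU X" and ?SY = "stable_susp FU Y"
  have O: "?SX \<in> \<U>" "?SY \<in> \<U>" "iysusp X \<in> \<U>" "iysusp Y \<in> \<U>" using X Y by simp_all
  note kX = comparison[OF X] and kY = comparison[OF Y]
  \<comment> \<open>Both paths of the naturality square pull \<open>iy_ext Y\<close> back to the
    push-out of \<open>susp_ext FU X\<close> along \<open>f\<close>, so they agree by the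
    representing property.\<close>
  have "pull F (iysusp Y) ?SX Y (cmp F ?SX ?SY (iysusp Y) (comparison Y) s) (iy_ext Y)
    = pull F ?SY ?SX Y s (pull F (iysusp Y) ?SY Y (comparison Y) (iy_ext Y))"
    using X Y O s(1) kY(1) by simp
  also have "\<dots> = push F ?SX X Y f (pull F (iysusp X) ?SX X (comparison X) (iy_ext X))"
    unfolding kX(2) kY(2) by (rule s(2))
  also have "\<dots> = pull F (iysusp X) ?SX Y (comparison X) (push F (iysusp X) X Y f (iy_ext X))"
    using X Y O kX(1) f(1) by simp
  also have "\<dots> = pull F (iysusp Y) ?SX Y (cmp F ?SX (iysusp X) (iysusp Y) c (comparison X)) (iy_ext Y)"
    unfolding c(2)[symmetric] using X Y O kX(1) c(1) by simp
  finally have "dquo ?SX (iysusp Y) (cmp F ?SX ?SY (iysusp Y) (comparison Y) s)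
    = dquo ?SX (iysusp Y) (cmp F ?SX (iysusp X) (iysusp Y) c (comparison X))"
    using iy_eq_iff[OF O(1) Y, of "cmp F ?SX ?SY (iysusp Y) (comparison Y) s"
        "cmp F ?SX (iysusp X) (iysusp Y) c (comparison X)"] X Y O s(1) c(1) kX(1) kY(1) by simp
  then show "cmp D ?SX ?SY (iysusp Y) (\<eta> Y) (to_iy ?SX ?SY (stable_susp_arr FU X Y G))
    = cmp D ?SX (iysusp X) (iysusp Y) (iy_susp_arr (stable_cat F) \<X> X Y (to_iy X Y G)) (\<eta> X)"
    unfolding f(2) s(3) to_iy_quo[OF O(1,2) s(1)] to_iy_quo[OF X Y f(1)] c(3) D_simps
    using cmp_dquo[of ?SX ?SY "iysusp Y" s "comparison Y"] cmp_dquo[of ?SX "iysusp X" "iysusp Y" "comparison X" c]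
      O s(1) c(1) kX(1) kY(1) by simp
qed

text \<open>The third map is prescribed by its extension. Compatibility over the identity of
  \<open>X\<close> is then the hypothesis \<open>kd\<close>, and \<open>retract_fill\<close>
  supplies the middle map into the approximation.\<close>

lemma iy_standard_conflation:
  assumes cf: "(X,Y,Z,f,g,\<delta>) \<in> conflations F" and U: "X \<in> \<U>" "Y \<in> \<U>" "Z \<in> \<U>"
    and k: "k \<in> arr F Z (iysusp X)" and kd: "pull F (iysusp X) Z X k (iy_ext X) = \<delta>"
  shows "(X,Y,Z,dquo X Y f,dquo Y Z g,dquo Z (iysusp X) k) \<in> iy_standard (stable_cat F) \<X>"
proof -
  note t = conflation_arr[OF cf]
  obtain h where h: "h \<in> arr F Z (stable_susp F X)" "pull F (stable_susp F X) Z X h (susp_ext F X) = \<delta>"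
    by (rule S.represents_ex[OF S.represents_susp[OF t(1)] t(3,6)])
  have d: "(X,Y,Z,S.quo X Y f,S.quo Y Z g,S.quo Z (stable_susp F X) h) \<in> dist (stable_cat F)"
    by (rule S.stable_dist_conflation[OF cf h])
  obtain P u v w where a: "approx_triangle (stable_cat F) \<X> X =
      (X, P, iysusp X, S.quo X P u, S.quo P (iysusp X) v, S.quo (iysusp X) (stable_susp F X) w)"
    and w: "w \<in> arr F (iysusp X) (stable_susp F X)"
    and e: "iy_ext X = pull F (stable_susp F X) (iysusp X) X w (susp_ext F X)"
    and r: "S.conflation_retract X P (iysusp X) u v (iy_ext X)"
    by (rule approx_triangleE[OF U(1)])
  note tr = S.retract_arr[OF r]
  have eq: "push F Z X X (ide F X) \<delta> = pull F (iysusp X) Z X k (iy_ext X)" using t kd by simp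
  obtain q where q: "q \<in> arr F Y P" "S.quo X P (cmp F X Y P q f) = S.quo X P (cmp F X X P u (ide F X))"
    "S.quo Y (iysusp X) (cmp F Y P (iysusp X) v q) = S.quo Y (iysusp X) (cmp F Y Z (iysusp X) k g)"
    by (rule S.retract_fill[OF S.conflation_is_retract[OF cf] r ide_arr[OF t(1)] k eq])
  have third: "cmp R Z (stable_susp F X) (stable_susp F X) (stable_susp_arr F X X (S.quo X X (ide F X)))
      (S.quo Z (stable_susp F X) h)
    = cmp R Z (iysusp X) (stable_susp F X) (S.quo (iysusp X) (stable_susp F X) w) (S.quo Z (iysusp X) k)"
    using S.susp_square_iff[OF t(1,1,3) tr(3) ide_arr[OF t(1)] k h(1) w] eq unfolding h(2) e[symmetric] by simp
  have "triangle_morphism (stable_cat F) (susp (stable_cat F)) (susp_arr (stable_cat F))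
      (X,Y,Z,S.quo X Y f,S.quo Y Z g,S.quo Z (stable_susp F X) h) (approx_triangle (stable_cat F) \<X> X)
      (ide (stable_cat F) X) (S.quo Y P q) (S.quo Z (iysusp X) k)"
    unfolding a triangle_morphism.simps S.stable_cat_simps S.stab.ide_quot
    using third q t tr k by (simp add: S.stab.quot_arrI S.stab.cmp_quot)
  with d U show ?thesis
    unfolding iy_standard_def quot_arr_T ext1_perp_eq by blast
qed

text \<open>The given triangle is isomorphic to one from a conflation in \<open>\<U>\<close>, which
  is standard in the reduction as well; the same six arrows of \<open>F\<close> give the isomorphism
  there.\<close>

lemma to_iy_dist:
  assumes "(X,Y,Z,U,V,W) \<in> dist C"
  shows "(X, Y, Z, to_iy X Y U, to_iy Y Z V,
    cmp D Z (stable_susp FU X) (iysusp X) (\<eta> X) (to_iy Z (stable_susp FU X) W)) \<in> dist D"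
proof -
  obtain u v w X' Y' Z' f g h \<delta> a b c a' b' c' where
    O: "X \<in> \<U>" "Y \<in> \<U>" "Z \<in> \<U>" and uvw: "u \<in> arr F X Y" "v \<in> arr F Y Z" "w \<in> arr F Z (stable_susp FU X)"
    "U = J.quo X Y u" "V = J.quo Y Z v" "W = J.quo Z (stable_susp FU X) w" and
    cf: "(X',Y',Z',f,g,\<delta>) \<in> conflations FU" and h: "h \<in> arr F Z' (stable_susp FU X')"
    "pull F (stable_susp FU X') Z' X' h (susp_ext FU X') = \<delta>" and
    s: "a \<in> arr F X X'" "b \<in> arr F Y Y'" "c \<in> arr F Z Z'"
    "a' \<in> arr F X' X" "b' \<in> arr F Y' Y" "c' \<in> arr F Z' Z" and
    e: "J.quo X Y' (cmp F X Y Y' b u) = J.quo X Y' (cmp F X X' Y' f a)"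
    "J.quo Y Z' (cmp F Y Z Z' c v) = J.quo Y Z' (cmp F Y Y' Z' g b)"
    "push F Z X X' a (pull F (stable_susp FU X) Z X w (susp_ext FU X)) = pull F Z' Z X' c \<delta>" and
    i: "J.quo X X (cmp F X X' X a' a) = J.quo X X (ide F X)"
    "J.quo X' X' (cmp F X' X X' a a') = J.quo X' X' (ide F X')"
    "J.quo Y Y (cmp F Y Y' Y b' b) = J.quo Y Y (ide F Y)"
    "J.quo Y' Y' (cmp F Y' Y Y' b b') = J.quo Y' Y' (ide F Y')"
    "J.quo Z Z (cmp F Z Z' Z c' c) = J.quo Z Z (ide F Z)"
    "J.quo Z' Z' (cmp F Z' Z Z' c c') = J.quo Z' Z' (ide F Z')"
    by (rule J.stable_distE[OF assms, unfolded FU_simps])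
  have cf': "(X',Y',Z',f,g,\<delta>) \<in> conflations F" and O': "X' \<in> \<U>" "Y' \<in> \<U>" "Z' \<in> \<U>"
    using cf FU_conflations by blast+
  note t = conflation_arr[OF cf']
  let ?SX = "stable_susp FU X" and ?SX' = "stable_susp FU X'"
  have SU: "?SX \<in> \<U>" "?SX' \<in> \<U>" "iysusp X \<in> \<U>" "iysusp X' \<in> \<U>" using O O' by simp_all
  note obs = O[THEN perp_ob] O'[THEN perp_ob] SU[THEN perp_ob]
  note k = comparison[OF O(1)] and k' = comparison[OF O'(1)]
  \<comment> \<open>Composing with the comparison map turns a third map over \<open>FU\<close> into
    one of the reduction with the same extension, so the two third squares express the same
    condition.\<close>
  let ?w = "cmp F Z ?SX (iysusp X) (comparison X) w"
  let ?h = "cmp F Z' ?SX' (iysusp X') (comparison X') h"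
  have wh: "?w \<in> arr F Z (iysusp X)" "?h \<in> arr F Z' (iysusp X')" using obs uvw(3) h(1) k(1) k'(1) by simp_all
  have pw: "pull F (iysusp X) Z X ?w (iy_ext X) = pull F ?SX Z X w (susp_ext FU X)"
    unfolding k(2)[symmetric] using O obs uvw(3) k(1) by simp
  have "pull F (iysusp X') Z' X' ?h (iy_ext X') = pull F ?SX' Z' X' h (susp_ext FU X')"
    unfolding k'(2)[symmetric] using O' obs h(1) k'(1) by simp
  then have ph: "pull F (iysusp X') Z' X' ?h (iy_ext X') = \<delta>" using h(2) by simp
  let ?t = "(X,Y,Z,dquo X Y u,dquo Y Z v,dquo Z (iysusp X) ?w)"
  let ?t' = "(X',Y',Z',dquo X' Y' f,dquo Y' Z' g,dquo Z' (iysusp X') ?h)"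
  have teq: "(X, Y, Z, to_iy X Y U, to_iy Y Z V, cmp D Z ?SX (iysusp X) (\<eta> X) (to_iy Z ?SX W)) = ?t"
    unfolding uvw to_iy_quo[OF O(1,2) uvw(1)] to_iy_quo[OF O(2,3) uvw(2)] to_iy_quo[OF O(3) SU(1) uvw(3)] D_simps
    using cmp_dquo[OF obs(3,7,9) uvw(3) k(1)] by simp
  have st: "?t' \<in> iy_standard (stable_cat F) \<X>"
    by (rule iy_standard_conflation[OF cf' O' wh(2) ph])
  let ?Q = "iy_cat (stable_cat F) \<X>"
  have tri: "is_triangle ?Q iysusp ?t" "is_triangle ?Q iysusp ?t'"
    using O O' obs t uvw(1,2) wh dquo_arr by (auto simp: iy_cat_eq)
  have iso: "iso_arr ?Q M N (dquo M N m)"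
    if MN: "M \<in> \<U>" "N \<in> \<U>" and m: "m \<in> arr F M N" "m' \<in> arr F N M"
      and q: "J.quo M M (cmp F M N M m' m) = J.quo M M (ide F M)"
        "J.quo N N (cmp F N M N m m') = J.quo N N (ide F N)" for M N m m'
  proof -
    have o: "M \<in> Ob F" "N \<in> Ob F" using MN by simp_all
    have "cmp RA M N M (dquo N M m') (dquo M N m) = ide RA M" "cmp RA N M N (dquo M N m) (dquo N M m') = ide RA N"
      unfolding cmp_dquo[OF o(1,2,1) m] cmp_dquo[OF o(2,1,2) m(2,1)] ide_dquo
      using dquo_eq_iff o m q by simp_all
    then show ?thesis unfolding iso_arr_def iy_cat_eq using MN dquo_arr[OF o m(1)] dquo_arr[OF o(2,1) m(2)] by blast
  qed
  have sq1: "cmp RA X Y Y' (dquo Y Y' b) (dquo X Y u) = cmp RA X X' Y' (dquo X' Y' f) (dquo X X' a)"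
    unfolding cmp_dquo[OF obs(1,2,5) uvw(1) s(2)] cmp_dquo[OF obs(1,4,5) s(1) t(4)]
    using e(1) dquo_eq_iff[OF obs(1,5)] obs uvw(1) s t by simp
  have sq2: "cmp RA Y Z Z' (dquo Z Z' c) (dquo Y Z v) = cmp RA Y Y' Z' (dquo Y' Z' g) (dquo Y Y' b)"
    unfolding cmp_dquo[OF obs(2,3,6) uvw(2) s(3)] cmp_dquo[OF obs(2,5,6) s(2) t(5)]
    using e(2) dquo_eq_iff[OF obs(2,6)] obs uvw(2) s t by simp
  obtain m where m: "m \<in> arr F (iysusp X) (iysusp X')"
    "pull F (iysusp X') (iysusp X) X' m (iy_ext X') = push F (iysusp X) X X' a (iy_ext X)"
    "iy_susp_arr (stable_cat F) \<X> X X' (dquo X X' a) = dquo (iysusp X) (iysusp X') m"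
    by (rule iy_susp_arr_ex[OF O(1) O'(1) s(1)])
  \<comment> \<open>Maps into \<open>iysusp X'\<close> are compared by their extensions, where the
    square reduces to the compatibility \<open>e(3)\<close> with the conflation.\<close>
  have "pull F (iysusp X') Z X' (cmp F Z (iysusp X) (iysusp X') m ?w) (iy_ext X')
    = pull F (iysusp X) Z X' ?w (pull F (iysusp X') (iysusp X) X' m (iy_ext X'))"
    using O O' obs wh(1) m(1) by (simp del: cmp_assoc)
  also have "\<dots> = push F Z X X' a (pull F (iysusp X) Z X ?w (iy_ext X))"
    unfolding m(2) using O O' obs wh(1) s(1) by (simp del: cmp_assoc)
  also have "\<dots> = pull F Z' Z X' c (pull F (iysusp X') Z' X' ?h (iy_ext X'))"
    unfolding pw ph by (rule e(3))
  also have "\<dots> = pull F (iysusp X') Z X' (cmp F Z Z' (iysusp X') ?h c) (iy_ext X')"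
    using O O' obs wh(2) s(3) by (simp del: cmp_assoc)
  finally have "dquo Z (iysusp X') (cmp F Z (iysusp X) (iysusp X') m ?w)
    = dquo Z (iysusp X') (cmp F Z Z' (iysusp X') ?h c)"
    using iy_eq_iff[OF O(3) O'(1), of "cmp F Z (iysusp X) (iysusp X') m ?w" "cmp F Z Z' (iysusp X') ?h c"]
      obs wh m(1) s(3) by (simp del: cmp_assoc)
  then have sq3: "cmp RA Z (iysusp X) (iysusp X') (iy_susp_arr (stable_cat F) \<X> X X' (dquo X X' a)) (dquo Z (iysusp X) ?w)
    = cmp RA Z Z' (iysusp X') (dquo Z' (iysusp X') ?h) (dquo Z Z' c)"
    unfolding m(3) cmp_dquo[OF obs(3,9,10) wh(1) m(1)] cmp_dquo[OF obs(3,6,10) s(3) wh(2)] .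
  have "triangle_morphism ?Q iysusp (iy_susp_arr (stable_cat F) \<X>) ?t ?t' (dquo X X' a) (dquo Y Y' b) (dquo Z Z' c)"
    unfolding triangle_morphism.simps iy_cat_eq
    using sq1 sq2 sq3 dquo_arr[OF obs(1,4) s(1)] dquo_arr[OF obs(2,5) s(2)] dquo_arr[OF obs(3,6) s(3)] by blast
  then have "triangle_iso ?Q iysusp (iy_susp_arr (stable_cat F) \<X>) ?t ?t'"
    unfolding triangle_iso.simps
    using iso[OF O(1) O'(1) s(1,4) i(1,2)] iso[OF O(2) O'(2) s(2,5) i(3,4)] iso[OF O(3) O'(3) s(3,6) i(5,6)] by blast
  then have "?t \<in> triangle_iso_closure ?Q iysusp (iy_susp_arr (stable_cat F) \<X>) (iy_standard (stable_cat F) \<X>)"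
    unfolding triangle_iso_closure_def using tri st by blast
  then have "?t \<in> dist D" by (simp add: iy_reduction_def Let_def)
  then show ?thesis unfolding teq .
qed

lemma triangle_equivalent_reduction: "triangle_equivalent K C D"
proof -
  have "triangle_functor K C D (\<lambda>X. X) to_iy \<eta>"
    unfolding triangle_functor_def
  proof (intro conjI linear_functor_to_iy)
    show "natural_iso C D (\<lambda>X. susp C X) (\<lambda>X Y f. to_iy (susp C X) (susp C Y) (susp_arr C X Y f))
       (\<lambda>X. susp D X) (\<lambda>X Y f. susp_arr D X Y (to_iy X Y f)) \<eta>"
      unfolding J.stable_cat_simps D_simps by (rule natural_comparison)
    show "\<forall>(X,Y,Z,u,v,w)\<in>dist C. (X, Y, Z, to_iy X Y u, to_iy Y Z v,
         cmp D Z (susp C X) (susp D X) (\<eta> X) (to_iy Z (susp C X) w)) \<in> dist D"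
      unfolding J.stable_cat_simps D_simps(5) using to_iy_dist by fast
  qed
  then show ?thesis unfolding triangle_equivalent_def using equivalence_to_iy by blast
qed

end

theorem theorem2:
  fixes K :: "('k,'r) ring_scheme"
    and F :: "('k,'o,'m,'e) excat"
    and \<X> :: "'o set"
  assumes "frobenius_extriangulated K F"
    and "stably_two_calabi_yau K F"
    and "\<X> \<subseteq> Ob F"
    and "rigid F \<X>"
    and "functorially_finite F \<X>"
  shows "triangle_equivalent K (stable_cat (ext_subcat F (ext_perp F \<X>)))
           (iy_reduction (stable_cat F) \<X>)"
  by (rule calabi_yau_reduction.triangle_equivalent_reduction)
    (intro calabi_yau_reduction.intro calabi_yau_reduction_axioms.intro assms)

end
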